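(* Let $G$ be a locally finite, $2$-connected, claw-free graph. Suppose that for every induced subgraph $H$ of $G$ isomorphic to the paw, with vertices labelled $a_1, a_0, b_1, b_2$ as described in the context, there is some $i \in \{1,2\}$ such that $a_1$ and $b_i$ have a common neighbour in $G$ outside $V(H)$. Then $G$ is Hamiltonian, i.e. there is a circle in the Freudenthal compactification $|G|$ containing all vertices of $G$.
   Context: All graphs are simple and undirected; locally finite means every vertex has finite degree. The claw is $K_{1,3}$; $G$ is claw-free if it has no induced subgraph isomorphic to $K_{1,3}$. The paw is the graph obtained from a triangle by adding one vertex adjacent to exactly one vertex of the triangle; in a paw, $a_1$ denotes the vertex of degree $1$, $a_0$ its unique neighbour, and $b_1, b_2$ the two remaining vertices (the two triangle vertices not adjacent to $a_1$). A ray is a one-way infinite path; two rays are equivalent if no finite vertex set separates them; the equivalence classes are the ends of $G$. For a locally finite connected graph $G$, $|G|$ denotes its Freudenthal compactification: $G$ viewed as a 1-complex together with its ends, with the standard topology in which each ray converges to its end. A circle in $|G|$ is a subspace homeomorphic to the unit circle $S^1$. $G$ is Hamiltonian if some circle in $|G|$ contains all vertices of $G$ (for finite $G$ this is the usual notion). *)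

theory Defs
  imports "HOL-Analysis.Analysis"
begin

text \<open>A graph is given by its vertex set and its set of edges, the edges being two-element
  sets of vertices.\<close>

definition simple_graph :: "'a set \<Rightarrow> 'a set set \<Rightarrow> bool" where
  "simple_graph V E \<longleftrightarrow> (\<forall>e\<in>E. e \<subseteq> V \<and> card e = 2)"

definition locally_finite_graph :: "'a set \<Rightarrow> 'a set set \<Rightarrow> bool" where
  "locally_finite_graph V E \<longleftrightarrow> (\<forall>v\<in>V. finite {u. {v, u} \<in> E})"

definition induced_edges :: "'a set set \<Rightarrow> 'a set \<Rightarrow> 'a set set" where
  "induced_edges E W = {e \<in> E. e \<subseteq> W}"

definition linked :: "'a set set \<Rightarrow> 'a \<Rightarrow> 'a \<Rightarrow> bool" where
  "linked E u v \<longleftrightarrow> (u, v) \<in> {(x, y). {x, y} \<in> E}\<^sup>*"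

definition graph_connected :: "'a set \<Rightarrow> 'a set set \<Rightarrow> bool" where
  "graph_connected V E \<longleftrightarrow> V \<noteq> {} \<and> (\<forall>u\<in>V. \<forall>v\<in>V. linked E u v)"

definition graph_components :: "'a set \<Rightarrow> 'a set set \<Rightarrow> 'a set set" where
  "graph_components V E = V // {(u, v). u \<in> V \<and> v \<in> V \<and> linked E u v}"

definition k_connected :: "nat \<Rightarrow> 'a set \<Rightarrow> 'a set set \<Rightarrow> bool" where
  "k_connected k V E \<longleftrightarrow> (infinite V \<or> card V > k) \<and>
     (\<forall>X\<subseteq>V. finite X \<and> card X < k \<longrightarrow> graph_connected (V - X) (induced_edges E (V - X)))"

definition graph_iso ::
  "('a \<Rightarrow> 'b) \<Rightarrow> 'a set \<Rightarrow> 'a set set \<Rightarrow> 'b set \<Rightarrow> 'b set set \<Rightarrow> bool" where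
  "graph_iso f V E V' E' \<longleftrightarrow>
     bij_betw f V V' \<and> (\<forall>u\<in>V. \<forall>v\<in>V. {u, v} \<in> E \<longleftrightarrow> {f u, f v} \<in> E')"

definition claw_vertices :: "nat set" where
  "claw_vertices = {0, 1, 2, 3}"

definition claw_edges :: "nat set set" where
  "claw_edges = {{0, 1}, {0, 2}, {0, 3}}"

definition claw_free :: "'a set \<Rightarrow> 'a set set \<Rightarrow> bool" where
  "claw_free V E \<longleftrightarrow>
     \<not> (\<exists>W\<subseteq>V. \<exists>f. graph_iso f claw_vertices claw_edges W (induced_edges E W))"

datatype paw_vertex = A1 | A0 | B1 | B2

definition paw_edges :: "paw_vertex set set" where
  "paw_edges = {{A1, A0}, {A0, B1}, {A0, B2}, {B1, B2}}"

text \<open>A labelling of the induced subgraph on \<open>W\<close> as a paw is an isomorphism from the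
  standard paw onto it.\<close>

definition paw_labelling ::
  "'a set \<Rightarrow> 'a set set \<Rightarrow> 'a set \<Rightarrow> (paw_vertex \<Rightarrow> 'a) \<Rightarrow> bool" where
  "paw_labelling V E W f \<longleftrightarrow>
     W \<subseteq> V \<and> graph_iso f UNIV paw_edges W (induced_edges E W)"

definition ray :: "'a set \<Rightarrow> 'a set set \<Rightarrow> (nat \<Rightarrow> 'a) \<Rightarrow> bool" where
  "ray V E r \<longleftrightarrow> inj r \<and> range r \<subseteq> V \<and> (\<forall>n. {r n, r (Suc n)} \<in> E)"

definition separates :: "'a set \<Rightarrow> 'a set set \<Rightarrow> 'a set \<Rightarrow> 'a set \<Rightarrow> 'a set \<Rightarrow> bool" where
  "separates V E S A B \<longleftrightarrow>
     \<not> (\<exists>a\<in>A - S. \<exists>b\<in>B - S. linked (induced_edges E (V - S)) a b)"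

definition ray_equiv :: "'a set \<Rightarrow> 'a set set \<Rightarrow> ((nat \<Rightarrow> 'a) \<times> (nat \<Rightarrow> 'a)) set" where
  "ray_equiv V E = {(r, s). ray V E r \<and> ray V E s \<and>
     \<not> (\<exists>S\<subseteq>V. finite S \<and> separates V E S (range r) (range s))}"

definition ends :: "'a set \<Rightarrow> 'a set set \<Rightarrow> (nat \<Rightarrow> 'a) set set" where
  "ends V E = {r. ray V E r} // ray_equiv V E"

definition lives_in :: "(nat \<Rightarrow> 'a) set \<Rightarrow> 'a set \<Rightarrow> bool" where
  "lives_in \<omega> C \<longleftrightarrow> (\<forall>r\<in>\<omega>. \<exists>n. \<forall>m\<ge>n. r m \<in> C)"

text \<open>Points of the 1-complex are given by their barycentric coordinates, that is, as functions
  on the vertices supported on a single vertex or edge. The point \<open>edge_point u v t\<close> lies on the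
  edge between \<open>u\<close> and \<open>v\<close> at distance \<open>t\<close> from \<open>u\<close>.\<close>

datatype 'a freudenthal_point = Complex_Point "'a \<Rightarrow> real" | End_Point "(nat \<Rightarrow> 'a) set"

definition vertex_point :: "'a \<Rightarrow> 'a freudenthal_point" where
  "vertex_point v = Complex_Point (\<lambda>x. if x = v then 1 else 0)"

definition edge_point :: "'a \<Rightarrow> 'a \<Rightarrow> real \<Rightarrow> 'a freudenthal_point" where
  "edge_point u v t = Complex_Point (\<lambda>x. if x = u then 1 - t else if x = v then t else 0)"

definition one_complex :: "'a set \<Rightarrow> 'a set set \<Rightarrow> 'a freudenthal_point set" where
  "one_complex V E =
     vertex_point ` V \<union> {edge_point u v t | u v t. {u, v} \<in> E \<and> 0 \<le> t \<and> t \<le> 1}"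

text \<open>The weak topology of the 1-complex: a set is open if its trace on every closed edge is.\<close>

definition open_in_complex :: "'a set \<Rightarrow> 'a set set \<Rightarrow> 'a freudenthal_point set \<Rightarrow> bool" where
  "open_in_complex V E U \<longleftrightarrow> U \<subseteq> one_complex V E \<and>
     (\<forall>u v. {u, v} \<in> E \<longrightarrow> openin (top_of_set {0..1}) {t \<in> {0..1}. edge_point u v t \<in> U})"

text \<open>The basic neighbourhood, of every end living in the component \<open>C\<close> of the graph minus \<open>S\<close>,
  that consists of this component, all ends living in it, and the initial segments of
  length \<open>\<epsilon>\<close>, taken from \<open>C\<close>, of the edges between \<open>C\<close> and \<open>S\<close>.\<close>

definition end_nbhd ::
  "'a set \<Rightarrow> 'a set set \<Rightarrow> 'a set \<Rightarrow> 'a set \<Rightarrow> real \<Rightarrow> 'a freudenthal_point set" where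
  "end_nbhd V E S C \<epsilon> =
     one_complex C (induced_edges E C) \<union>
     End_Point ` {\<omega> \<in> ends V E. lives_in \<omega> C} \<union>
     {edge_point c s t | c s t. c \<in> C \<and> s \<in> S \<and> {c, s} \<in> E \<and> 0 < t \<and> t < 1 \<and> t < \<epsilon>}"

definition freudenthal :: "'a set \<Rightarrow> 'a set set \<Rightarrow> 'a freudenthal_point topology" where
  "freudenthal V E = topology_generated_by
     ({U. open_in_complex V E U} \<union>
      {end_nbhd V E S C \<epsilon> | S C \<epsilon> \<omega>. S \<subseteq> V \<and> finite S \<and>
         C \<in> graph_components (V - S) (induced_edges E (V - S)) \<and>
         \<omega> \<in> ends V E \<and> lives_in \<omega> C \<and> 0 < \<epsilon>})"

definition circle_in :: "'b topology \<Rightarrow> 'b set \<Rightarrow> bool" where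
  "circle_in X K \<longleftrightarrow> K \<subseteq> topspace X \<and>
     subtopology X K homeomorphic_space top_of_set (sphere (0::complex) 1)"

definition hamiltonian :: "'a set \<Rightarrow> 'a set set \<Rightarrow> bool" where
  "hamiltonian V E \<longleftrightarrow> (\<exists>K. circle_in (freudenthal V E) K \<and> vertex_point ` V \<subseteq> K)"

end

theory Submission
  imports Defs "HOL-Complex_Analysis.Great_Picard"
begin

text \<open>
  A cycle \<open>C\<close> can always be extended by a vertex \<open>v\<close> adjacent to some \<open>u\<close> on \<open>C\<close>. If \<open>v\<close> is adjacent to
  one of the two cycle neighbours of \<open>u\<close> it is inserted there. Otherwise these neighbours are adjacent
  to each other, because there is no claw, and the paw they form with \<open>u\<close> and \<open>v\<close> yields a common
  neighbour \<open>w\<close> of \<open>v\<close> and, say, the successor \<open>x\<close> of \<open>u\<close>. Then \<open>u v w x\<close> replaces \<open>u x\<close>, after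
  \<open>w\<close> has been bypassed if it lies on \<open>C\<close> (or \<open>v\<close> is inserted next to \<open>w\<close>).

  In the infinite case the limit of such cycles is a circle only if it visits every end once. So for
  infinitely many \<open>n\<close> we fix regions: the core consists of the vertices at distance more than \<open>n\<close> from the
  root and those at distance \<open>n\<close> that have a neighbour at distance \<open>n + 1\<close>; the rim consists of the other
  neighbours of the core; and the regions are the classes of core and rim with respect to the edges
  meeting the core. A rim vertex has a neighbour in the core, which has no neighbours outside its region, so
  by claw-freeness the neighbours of a rim vertex outside its region form a clique. This is what allows
  one to cover the finite set of remaining vertices first, to enter the regions one by one, and to fill
  them afterwards, all the while crossing the boundary of each region at most twice. When a region can only be
  entered by cutting through another one, a part of that one is dropped and covered again later.

  Giving the vertices summable weights, a convergent subsequence of the positions of the vertices along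
  these cycles parametrises a circle: a vertex and the edge to its successor occupy an interval, and each
  remaining parameter is surrounded by a decreasing sequence of regions, which determines an end.
\<close>

section \<open>Crossings of a vertex set along a walk\<close>

text \<open>Consecutive cycles need not share edges, because every extension may reroute the cycle,
  so there is no union or edgewise limit to take. What persists from stage to stage is that certain
  vertices are covered and certain regions are crossed at most twice. Since a region never contains
  the root, two crossings mean that its vertices occupy consecutive places on the cycle started at
  the root. This is a condition on the order of the vertices, and bounded positions carry it to the
  limit. Successors, and the first and last vertices of regions, survive the limit because they are
  chosen from finite sets: the neighbours of a vertex, the rim of a stage. The core contains part of
  level \<open>n\<close> for a reason: claws are needed not only at rim vertices but also at core
  vertices next to the rim, where they control the detours made while a region is filled. A finite
  graph needs no separate treatment: its late stages have no regions, so every parameter belongs to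
  a vertex or an edge.\<close>

fun crossings :: "'a set \<Rightarrow> 'a list \<Rightarrow> nat" where
  "crossings K (x # y # xs) = (if x \<in> K \<longleftrightarrow> y \<in> K then 0 else 1) + crossings K (y # xs)"
| "crossings K _ = 0"

lemma crossings_append:
  "crossings K (xs @ x # ys) = crossings K (xs @ [x]) + crossings K (x # ys)"
  by (induction xs rule: induct_list012) auto

lemma crossings_Cons_append:
  "crossings K (u # xs @ x # ys) = crossings K (u # xs @ [x]) + crossings K (x # ys)"
  using crossings_append[of K "u # xs" x ys] by simp

lemma crossings_rev [simp]: "crossings K (rev xs) = crossings K xs"
proof (induction xs rule: induct_list012)
  case (3 x y zs)
  have "crossings K (rev (x # y # zs)) = crossings K (rev zs @ y # [x])" by simp
  also have "\<dots> = crossings K (rev zs @ [y]) + crossings K (y # [x])" by (rule crossings_append)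
  finally show ?case using 3 by auto
qed auto

text \<open>A triangle inequality: if the direct step past \<open>w\<close> crosses, then so does
  one of the two steps through \<open>w\<close>.\<close>

lemma crossings_remove: "crossings K (xs @ ys) \<le> crossings K (xs @ w # ys)"
proof (induction xs rule: induct_list012)
  case 1
  then show ?case by (cases ys) auto
next
  case (2 x)
  then show ?case by (cases ys) auto
qed auto

lemma crossings_eq_0_iff: "crossings K xs = 0 \<longleftrightarrow> set xs \<subseteq> K \<or> set xs \<inter> K = {}"
  by (induction xs rule: induct_list012) auto

lemma crossings_disjoint: "set xs \<inter> K = {} \<Longrightarrow> crossings K xs = 0"
  by (simp add: crossings_eq_0_iff)

lemma crossings_pos:
  "a \<in> set xs \<Longrightarrow> b \<in> set xs \<Longrightarrow> a \<in> K \<Longrightarrow> b \<notin> K \<Longrightarrow> 1 \<le> crossings K xs"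
  using crossings_eq_0_iff[of K xs] by (cases "crossings K xs") auto

text \<open>The first part gets into \<open>K\<close> and the last part gets out of it. Each costs a
  crossing, so none is left for \<open>ys\<close>.\<close>

lemma convex_if_crossings_le_2:
  assumes "crossings K (xs @ ys @ zs) \<le> 2"
    and "xs \<noteq> []" "zs \<noteq> []" "hd xs \<notin> K" "last zs \<notin> K" "last xs \<in> K" "hd zs \<in> K"
  shows "set ys \<subseteq> K"
proof -
  obtain xs' a where xs: "xs = xs' @ [a]" using assms(2) by (metis rev_exhaust)
  obtain b zs' where zs: "zs = b # zs'" using assms(3) by (cases zs) auto
  have "crossings K (xs @ ys @ zs) = crossings K xs + crossings K (a # ys @ [b]) + crossings K zs"
    using crossings_append[of K xs' a "ys @ zs"] crossings_append[of K "a # ys" b zs'] xs zs by simp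
  moreover have "1 \<le> crossings K xs"
    using assms xs by (intro crossings_pos[of a _ "hd xs"]) (auto simp: hd_append split: if_splits)
  moreover have "1 \<le> crossings K zs"
    using assms zs by (intro crossings_pos[of b _ "last zs"]) auto
  ultimately have "crossings K (a # ys @ [b]) = 0" using assms(1) by linarith
  thus ?thesis using assms xs by (auto simp: crossings_eq_0_iff)
qed

section \<open>Extending a cycle by an adjacent vertex\<close>

locale claw_paw =
  fixes adj :: "'a \<Rightarrow> 'a \<Rightarrow> bool"
  assumes adj_sym: "adj x y \<Longrightarrow> adj y x"
    and adj_irrefl: "\<not> adj x x"
    and claw: "adj x a \<Longrightarrow> adj x b \<Longrightarrow> adj x c \<Longrightarrow> a \<noteq> b \<Longrightarrow> a \<noteq> c \<Longrightarrow> b \<noteq> c \<Longrightarrow>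
      adj a b \<or> adj a c \<or> adj b c"
    and paw: "adj u v \<Longrightarrow> adj u x \<Longrightarrow> adj u y \<Longrightarrow> adj x y \<Longrightarrow> v \<noteq> x \<Longrightarrow> v \<noteq> y \<Longrightarrow>
      \<not> adj v x \<Longrightarrow> \<not> adj v y \<Longrightarrow> \<exists>w. w \<notin> {u, v, x, y} \<and> adj w v \<and> (adj w x \<or> adj w y)"
begin

lemma adj_neq: "adj x y \<Longrightarrow> x \<noteq> y"
  using adj_irrefl by auto

text \<open>The base \<open>u\<close> is kept apart from the list; the closed walk is
  \<open>u # ys @ [u]\<close>, so a crossing on the closing edge counts as well. The length bound
  excludes an edge traversed back and forth.\<close>

definition cyc :: "'a \<Rightarrow> 'a list \<Rightarrow> bool" where
  "cyc u ys \<longleftrightarrow> distinct (u # ys) \<and> 2 \<le> length ys \<and> successively adj (u # ys @ [u])"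

abbreviation cyc_crossings :: "'a set \<Rightarrow> 'a \<Rightarrow> 'a list \<Rightarrow> nat" where
  "cyc_crossings K u ys \<equiv> crossings K (u # ys @ [u])"

lemma successively_adj_rev: "successively adj (rev xs) = successively adj xs"
proof -
  have "(\<lambda>x y. adj y x) = adj" using adj_sym by blast
  thus ?thesis using successively_rev[of adj xs] by metis
qed

lemma cyc_rev: "cyc u ys \<Longrightarrow> cyc u (rev ys)"
  using successively_adj_rev[of "u # ys @ [u]"] by (simp add: cyc_def)

lemma cyc_crossings_rev: "cyc_crossings K u (rev ys) = cyc_crossings K u ys"
  using crossings_rev[of K "u # ys @ [u]"] by simp

lemma cyc_rotate:
  assumes "cyc u ys" "w \<in> set (u # ys)"
  obtains zs where "cyc w zs" "set (w # zs) = set (u # ys)"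
    "\<And>K. cyc_crossings K w zs = cyc_crossings K u ys"
proof (cases "w = u")
  case True
  thus ?thesis using that assms by blast
next
  case False
  then obtain as bs where ys: "ys = as @ w # bs" using assms(2) by (auto dest: split_list)
  have "cyc w (bs @ u # as)"
    using assms(1) unfolding cyc_def ys
    by (auto simp: successively_append_iff successively_Cons hd_append split: if_splits)
  moreover have "cyc_crossings K w (bs @ u # as) = cyc_crossings K u ys" for K
    using crossings_Cons_append[of K w bs u "as @ [w]"] crossings_Cons_append[of K u as w "bs @ [u]"]
    by (simp add: ys)
  ultimately show ?thesis using ys by (intro that[of "bs @ u # as"]) auto
qed

lemma cyc_nbrs:
  assumes "cyc u ys"
  shows "adj u (hd ys)" "adj u (last ys)" "hd ys \<noteq> last ys" "hd ys \<in> set ys" "last ys \<in> set ys"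
proof -
  obtain x r where ys: "ys = x # r" "r \<noteq> []"
    using assms by (cases ys) (fastforce simp: cyc_def)+
  then show "adj u (hd ys)" "hd ys \<in> set ys" "last ys \<in> set ys"
    using assms by (auto simp: cyc_def)
  show "adj u (last ys)"
    using assms adj_sym ys by (auto simp: cyc_def successively_append_iff successively_Cons)
  show "hd ys \<noteq> last ys" using assms ys by (auto simp: cyc_def)
qed

lemma cyc_insert_at_base:
  assumes "cyc u ys" "v \<notin> set (u # ys)" "adj u v" "adj v (hd ys)"
  shows "cyc u (v # ys)"
    and "K \<inter> set (u # ys) = {} \<Longrightarrow> cyc_crossings K u (v # ys) \<le> 2"
    and "(u \<in> K \<longleftrightarrow> v \<in> K) \<Longrightarrow> cyc_crossings K u (v # ys) = cyc_crossings K u ys"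
proof -
  obtain x r where ys: "ys = x # r" using assms(1) by (cases ys) (auto simp: cyc_def)
  show "cyc u (v # ys)" using assms ys by (auto simp: cyc_def)
  show "cyc_crossings K u (v # ys) \<le> 2" if "K \<inter> set (u # ys) = {}"
    using that crossings_disjoint[of "ys @ [u]" K] ys by (auto simp: Int_commute)
  show "cyc_crossings K u (v # ys) = cyc_crossings K u ys" if "u \<in> K \<longleftrightarrow> v \<in> K"
    using that ys by auto
qed

lemma cyc_detour_new:
  assumes "cyc u (x # r)" "v \<notin> set (u # x # r)" "w \<notin> set (u # x # r)" "adj u v" "adj w v" "adj w x"
  shows "cyc u (v # w # x # r)"
  using assms adj_sym adj_neq by (auto simp: cyc_def)

text \<open>If \<open>w\<close> lies on the cycle and the new vertex cannot be inserted next to it, claw-freeness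
  at \<open>w\<close> allows to bypass \<open>w\<close>, which is then moved to the detour through \<open>v\<close>.\<close>

lemma cyc_detour:
  assumes cyc: "cyc u (x # r)" and v: "v \<notin> set (u # x # r)" "adj u v" "\<not> adj v x"
    and w: "adj w v" "adj w x" "w \<noteq> u" "w \<noteq> last r"
  shows "\<exists>zs. cyc u zs \<and> set (u # zs) = {v, w} \<union> set (u # x # r) \<and>
     (\<forall>K. K \<inter> set (u # x # r) = {} \<longrightarrow> cyc_crossings K u zs \<le> 2) \<and>
     (\<forall>K. (u \<in> K \<longleftrightarrow> v \<in> K) \<and> (w \<in> K \<longleftrightarrow> v \<in> K) \<longrightarrow> cyc_crossings K u zs \<le> cyc_crossings K u (x # r))"
proof (cases "w \<in> set r")
  case False
  have wx: "w \<noteq> x" using w adj_neq by auto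
  show ?thesis
  proof (intro exI[of _ "v # w # x # r"] conjI allI impI)
    show "cyc u (v # w # x # r)" using False wx assms by (intro cyc_detour_new) auto
    show "cyc_crossings K u (v # w # x # r) \<le> 2" if "K \<inter> set (u # x # r) = {}" for K
      using that crossings_disjoint[of "x # r @ [u]" K] by (auto simp: Int_commute)
    show "cyc_crossings K u (v # w # x # r) \<le> cyc_crossings K u (x # r)"
      if "(u \<in> K \<longleftrightarrow> v \<in> K) \<and> (w \<in> K \<longleftrightarrow> v \<in> K)" for K
      using that by auto
  qed auto
next
  case True
  then obtain as bs where r: "r = as @ w # bs" by (auto dest: split_list)
  \<comment> \<open>Thus the successor \<open>y\<close> of \<open>w\<close> is an entry of the list
    and not the base \<open>u\<close>.\<close>
  with w have "bs \<noteq> []" by auto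
  then obtain y bs' where bs: "bs = y # bs'" by (cases bs) auto
  have succ: "successively adj (u # x # as @ w # bs @ [u])" and dist: "distinct (u # x # as @ w # bs)"
    using cyc r by (auto simp: cyc_def)
  have adj1: "adj u x" "successively adj (x # as)" "adj (last (x # as)) w" "adj w y"
    "successively adj (bs @ [u])"
    using succ by (auto simp: successively_append_iff successively_Cons bs hd_append split: if_splits)
  have vdist: "v \<notin> {u, x, w}" "v \<notin> set as" "v \<notin> set bs" using v r by auto
  have crs: "cyc_crossings K u (x # r)
      = crossings K [u, x] + crossings K (x # as @ [w]) + crossings K (w # bs @ [u])" for K
    using crossings_Cons_append[of K x as w "bs @ [u]"] by (simp add: r)
  \<comment> \<open>\<open>y\<close> and \<open>last (x # as)\<close> are the two neighbours of
    \<open>w\<close> on the cycle. If \<open>v\<close> is adjacent to one of them, it is put next to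
    \<open>w\<close>, and the edge from \<open>u\<close> to \<open>x\<close> stays in place.\<close>
  consider (after) "adj v y" | (before) "adj v (last (x # as))" | (none) "\<not> adj v y" "\<not> adj v (last (x # as))"
    by blast
  then show ?thesis
  proof cases
    case after
    let ?zs = "x # as @ w # v # bs"
    show ?thesis
    proof (intro exI[of _ ?zs] conjI allI impI)
      show "cyc u ?zs"
        using adj1 after dist vdist w(1) unfolding cyc_def
        by (auto simp: successively_append_iff successively_Cons bs hd_append split: if_splits)
      show "set (u # ?zs) = {v, w} \<union> set (u # x # r)" using r by auto
      have c: "cyc_crossings K u ?zs = crossings K (u # x # as @ [w]) + crossings K (w # v # bs @ [u])" for K
        using crossings_append[of K "u # x # as" w "v # bs @ [u]"] by simp
      show "cyc_crossings K u ?zs \<le> 2" if "K \<inter> set (u # x # r) = {}" for K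
        using that crossings_disjoint[of "u # x # as @ [w]" K] crossings_disjoint[of "bs @ [u]" K] c[of K]
        by (auto simp: Int_commute Int_Un_distrib r bs)
      show "cyc_crossings K u ?zs \<le> cyc_crossings K u (x # r)"
        if "(u \<in> K \<longleftrightarrow> v \<in> K) \<and> (w \<in> K \<longleftrightarrow> v \<in> K)" for K
        using that c[of K] crs[of K] by (auto simp: bs)
    qed
  next
    case before
    \<comment> \<open>For empty \<open>as\<close> the predecessor of \<open>w\<close> would be
      \<open>x\<close>, which is not adjacent to \<open>v\<close>.\<close>
    hence "as \<noteq> []" using v by auto
    then obtain as' b where as: "as = as' @ [b]" by (metis rev_exhaust)
    let ?zs = "x # as @ v # w # bs"
    show ?thesis
    proof (intro exI[of _ ?zs] conjI allI impI)
      show "cyc u ?zs"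
        using adj1 dist vdist adj_sym[OF w(1)] adj_sym[OF before] unfolding cyc_def
        by (auto simp: successively_append_iff successively_Cons bs as hd_append split: if_splits)
      show "set (u # ?zs) = {v, w} \<union> set (u # x # r)" using r by auto
      have c: "cyc_crossings K u ?zs =
          crossings K (u # x # as) + crossings K [b, v, w] + crossings K (w # bs @ [u])" for K
        using crossings_append[of K "u # x # as'" b "v # w # bs @ [u]"]
        by (simp add: as)
      have c': "crossings K (x # as @ [w]) = crossings K (x # as) + crossings K [b, w]" for K
        using crossings_append[of K "x # as'" b "[w]"] by (simp add: as)
      show "cyc_crossings K u ?zs \<le> 2" if "K \<inter> set (u # x # r) = {}" for K
        using that crossings_disjoint[of "u # x # as" K] crossings_disjoint[of "w # bs @ [u]" K] c[of K]
        by (auto simp: Int_commute Int_Un_distrib r as)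
      show "cyc_crossings K u ?zs \<le> cyc_crossings K u (x # r)"
        if "(u \<in> K \<longleftrightarrow> v \<in> K) \<and> (w \<in> K \<longleftrightarrow> v \<in> K)" for K
        using that c[of K] c'[of K] crs[of K] by (auto simp: as)
    qed
  next
    case none
    have "adj (last (x # as)) y"
    proof -
      have "adj w (last (x # as))" using adj1 adj_sym by blast
      moreover have "last (x # as) \<noteq> y" "last (x # as) \<in> set (x # as)" using dist bs by auto
      moreover have "v \<noteq> y" "v \<noteq> last (x # as)" using vdist bs calculation by auto
      ultimately show ?thesis using claw[of w v y "last (x # as)"] w(1) adj1(4) none adj_sym by blast
    qed
    moreover have "w \<noteq> x" using dist by auto
    ultimately have "cyc u (v # w # x # as @ bs)"
      using adj1 dist vdist v(2) adj_sym[OF w(1)] w(2) unfolding cyc_def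
      by (auto simp: successively_append_iff successively_Cons bs split: if_splits)
    moreover have "cyc_crossings K u (v # w # x # as @ bs) \<le> 2" if "K \<inter> set (u # x # r) = {}" for K
      using that crossings_disjoint[of "w # x # as @ bs @ [u]" K] by (auto simp: Int_commute r bs)
    moreover have "cyc_crossings K u (v # w # x # as @ bs) \<le> cyc_crossings K u (x # r)"
      if "(u \<in> K \<longleftrightarrow> v \<in> K) \<and> (w \<in> K \<longleftrightarrow> v \<in> K)" for K
      using that crossings_remove[of K "x # as" "bs @ [u]" w] by (auto simp: r)
    ultimately show ?thesis using r by (intro exI[of _ "v # w # x # as @ bs"]) auto
  qed
qed

text \<open>The conclusions hide which detour was taken. A caller learns only where a second new
  vertex can come from and has to place every such candidate relative to a set \<open>K\<close>. The
  last two conclusions serve a set that the cycle has not met, and a set for which everything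
  inserted can be kept on the side of \<open>v\<close>.\<close>

lemma cyc_extend:
  assumes cyc: "cyc u ys" and v: "v \<notin> set (u # ys)" "adj u v"
  obtains zs where "cyc u zs" "insert v (set (u # ys)) \<subseteq> set (u # zs)"
    "\<And>y. y \<in> set (u # zs) \<Longrightarrow> y \<in> insert v (set (u # ys)) \<or>
       adj y v \<and> (\<exists>x\<in>{hd ys, last ys}. adj y x \<and> \<not> adj v x)"
    "\<And>K. K \<inter> set (u # ys) = {} \<Longrightarrow> cyc_crossings K u zs \<le> 2"
    "\<And>K. (u \<in> K \<longleftrightarrow> v \<in> K) \<Longrightarrow>
       (\<And>w x. \<not> adj v (hd ys) \<Longrightarrow> \<not> adj v (last ys) \<Longrightarrow> x \<in> {hd ys, last ys} \<Longrightarrow>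
          adj w v \<Longrightarrow> adj w x \<Longrightarrow> w \<in> K \<longleftrightarrow> v \<in> K) \<Longrightarrow>
       cyc_crossings K u zs \<le> cyc_crossings K u ys"
proof -
  note goal = that
  have last_rev: "hd (rev ys) = last ys" "last (rev ys) = hd ys"
    using cyc by (auto simp: cyc_def hd_rev last_rev)
  show ?thesis
  proof (cases "adj v (hd ys) \<or> adj v (last ys)")
    case True
    then consider "adj v (hd ys)" | "adj v (last ys)" by blast
    then show ?thesis
    proof cases
      case 1
      show ?thesis
        by (rule that[of "v # ys"]) (use cyc_insert_at_base[OF cyc v(1,2) 1] in auto)
    next
      case 2
      show ?thesis
        by (rule that[of "v # rev ys"])
          (use cyc_insert_at_base[OF cyc_rev[OF cyc], of v] v 2 last_rev cyc_crossings_rev in auto)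
    qed
  next
    case False
    note n = cyc_nbrs[OF cyc]
    have neq: "v \<noteq> hd ys" "v \<noteq> last ys" using n v by auto
    have "adj (hd ys) (last ys)"
      using claw[of u v "hd ys" "last ys"] n v neq False by auto
    then obtain w where w: "w \<notin> {u, v, hd ys, last ys}" "adj w v" "adj w (hd ys) \<or> adj w (last ys)"
      using paw[of u v "hd ys" "last ys"] n v neq False by auto
    \<comment> \<open>Stated for \<open>cs\<close> so that it applies to \<open>ys\<close> and to
      its reversal: the cycle neighbour of \<open>u\<close> that is adjacent to \<open>w\<close> may
      then be assumed to come first.\<close>
    have main: ?thesis if cs_cyc: "cyc u cs" and cs_props: "set cs = set ys" "{hd cs, last cs} = {hd ys, last ys}"
      "\<And>K. cyc_crossings K u cs = cyc_crossings K u ys" "adj w (hd cs)" "w \<noteq> last cs" for cs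
    proof -
      obtain x r where cs: "cs = x # r" "r \<noteq> []"
        using cs_cyc by (cases cs) (fastforce simp: cyc_def)+
      have "x \<in> {hd ys, last ys}" using cs_props(2) cs by auto
      hence x: "x \<in> {hd ys, last ys}" "\<not> adj v x" using False by auto
      have d: "cyc u (x # r)" "v \<notin> set (u # x # r)" "adj w x" "w \<noteq> u" "w \<noteq> last r"
        using cs_cyc cs_props cs v w(1) by auto
      from cyc_detour[OF d(1,2) v(2) x(2) w(2) d(3-5)]
      obtain zs where zs: "cyc u zs" "set (u # zs) = {v, w} \<union> set (u # cs)"
        "\<forall>K. K \<inter> set (u # cs) = {} \<longrightarrow> cyc_crossings K u zs \<le> 2"
        "\<forall>K. (u \<in> K \<longleftrightarrow> v \<in> K) \<and> (w \<in> K \<longleftrightarrow> v \<in> K) \<longrightarrow> cyc_crossings K u zs \<le> cyc_crossings K u cs"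
        unfolding cs(1)[symmetric] by blast
      show ?thesis
      proof (rule goal[of zs])
        show "y \<in> insert v (set (u # ys)) \<or>
            adj y v \<and> (\<exists>x\<in>{hd ys, last ys}. adj y x \<and> \<not> adj v x)" if "y \<in> set (u # zs)" for y
          using that zs(2) w(2) x \<open>adj w (hd cs)\<close> cs(1) \<open>set cs = set ys\<close> by auto
        show "cyc_crossings K u zs \<le> cyc_crossings K u ys"
          if "u \<in> K \<longleftrightarrow> v \<in> K" "\<And>w x. \<not> adj v (hd ys) \<Longrightarrow> \<not> adj v (last ys) \<Longrightarrow>
            x \<in> {hd ys, last ys} \<Longrightarrow> adj w v \<Longrightarrow> adj w x \<Longrightarrow> w \<in> K \<longleftrightarrow> v \<in> K" for K
          using zs(4)[rule_format, of K] that(1) that(2)[of x w] False x w(2) \<open>adj w (hd cs)\<close> cs(1)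
            \<open>cyc_crossings K u cs = cyc_crossings K u ys\<close> by auto
      qed (use zs \<open>set cs = set ys\<close> in auto)
    qed
    show ?thesis
    proof (cases "adj w (hd ys)")
      case True
      thus ?thesis using main[of ys] cyc w by auto
    next
      case False
      thus ?thesis using main[of "rev ys"] cyc_rev[OF cyc] w last_rev cyc_crossings_rev by auto
    qed
  qed
qed

end

section \<open>Distance levels and regions\<close>

locale rooted_claw_paw = claw_paw adj for adj :: "'a \<Rightarrow> 'a \<Rightarrow> bool" +
  fixes V :: "'a set" and z :: 'a
  assumes adj_in_V: "adj x y \<Longrightarrow> x \<in> V"
    and z_in_V: "z \<in> V"
    and finite_nbrs: "finite {y. adj x y}"
    and connected: "x \<in> V \<Longrightarrow> (z, x) \<in> {(x, y). adj x y}\<^sup>*"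
begin

definition lev :: "'a \<Rightarrow> nat" where
  "lev x = (LEAST n. (z, x) \<in> {(x, y). adj x y} ^^ n)"

lemma relpow_lev: "x \<in> V \<Longrightarrow> (z, x) \<in> {(x, y). adj x y} ^^ lev x"
  unfolding lev_def using connected[of x] rtrancl_imp_relpow LeastI_ex[of "\<lambda>n. (z, x) \<in> {(x, y). adj x y} ^^ n"]
  by blast

lemma lev_le: "(z, x) \<in> {(x, y). adj x y} ^^ n \<Longrightarrow> lev x \<le> n"
  unfolding lev_def by (rule Least_le)

lemma lev_z [simp]: "lev z = 0"
  using lev_le[of z 0] by simp

lemma lev_adj: "adj x y \<Longrightarrow> lev y \<le> Suc (lev x)"
  using relpow_lev[OF adj_in_V, of x y] by (intro lev_le) auto

lemma lev_adj': "adj x y \<Longrightarrow> lev x \<le> Suc (lev y)"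
  using lev_adj adj_sym by blast

lemma lower_nbr:
  assumes "x \<in> V" "x \<noteq> z"
  obtains y where "adj x y" "lev x = Suc (lev y)"
proof -
  from relpow_lev[OF assms(1)] have rp: "(z, x) \<in> {(x, y). adj x y} ^^ lev x" .
  with assms(2) obtain k where k: "lev x = Suc k" by (cases "lev x") auto
  with rp obtain y where y: "(z, y) \<in> {(x, y). adj x y} ^^ k" "adj y x" by auto
  have "lev y \<le> k" using lev_le[OF y(1)] .
  moreover have "Suc k \<le> Suc (lev y)" using lev_adj[OF y(2)] k by simp
  ultimately show ?thesis using that[of y] adj_sym[OF y(2)] k by auto
qed

lemma finite_ball: "finite {x \<in> V. lev x \<le> n}"
proof (induction n)
  case 0
  have "x = z" if "x \<in> V" "lev x \<le> 0" for x
    by (rule ccontr) (use that in \<open>auto elim: lower_nbr\<close>)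
  hence "{x \<in> V. lev x \<le> 0} \<subseteq> {z}" by auto
  thus ?case by (rule finite_subset) simp
next
  case (Suc n)
  have "{x \<in> V. lev x \<le> Suc n} \<subseteq> insert z (\<Union>y\<in>{x \<in> V. lev x \<le> n}. {x. adj y x})"
  proof
    fix x assume x: "x \<in> {x \<in> V. lev x \<le> Suc n}"
    show "x \<in> insert z (\<Union>y\<in>{x \<in> V. lev x \<le> n}. {x. adj y x})"
    proof (cases "x = z")
      case False
      then obtain y where y: "adj x y" "lev x = Suc (lev y)" using x lower_nbr by blast
      hence "adj y x" "y \<in> V" using adj_sym adj_in_V by blast+
      thus ?thesis using x y by auto
    qed auto
  qed
  thus ?case using Suc finite_nbrs by (auto intro: finite_subset)
qed

text \<open>Because of the second disjunct, a vertex of level \<open>n + 1\<close> has all its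
  neighbours in the core, including those of level \<open>n\<close>. Core vertices next to the rim
  have such a neighbour, which makes them useful centres of claws.\<close>

definition core :: "nat \<Rightarrow> 'a set" where
  "core n = {x \<in> V. n < lev x \<or> lev x = n \<and> (\<exists>y. adj x y \<and> lev y = Suc n)}"

definition rim :: "nat \<Rightarrow> 'a set" where
  "rim n = {x \<in> V - core n. \<exists>d\<in>core n. adj x d}"

definition inside :: "nat \<Rightarrow> 'a set" where
  "inside n = V - core n - rim n"

text \<open>Edges between two rim vertices are left out and may join different regions. In return,
  each step within a region has an end in the core, all of whose neighbours belong to the same
  region.\<close>

definition core_rel :: "nat \<Rightarrow> ('a \<times> 'a) set" where
  "core_rel n = {(x, y). adj x y \<and> (x \<in> core n \<or> y \<in> core n)}"

definition region :: "nat \<Rightarrow> 'a \<Rightarrow> 'a set" where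
  "region n x = {y. (x, y) \<in> (core_rel n)\<^sup>*}"

definition regions :: "nat \<Rightarrow> 'a set set" where
  "regions n = region n ` (V - inside n)"

lemma sym_core_rel: "sym (core_rel n)"
  unfolding core_rel_def sym_def using adj_sym by blast

lemma core_rel_sym: "(x, y) \<in> (core_rel n)\<^sup>* \<Longrightarrow> (y, x) \<in> (core_rel n)\<^sup>*"
  using sym_core_rel sym_rtrancl by (meson symD)

lemma region_eq: "y \<in> region n x \<Longrightarrow> region n y = region n x"
  unfolding region_def using core_rel_sym by (auto intro: rtrancl_trans)

lemma region_self: "x \<in> region n x"
  by (simp add: region_def)

lemma core_nbr: "d \<in> core n \<Longrightarrow> adj d y \<Longrightarrow> y \<in> V - inside n"
  unfolding inside_def rim_def using adj_sym adj_in_V by blast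

lemma region_subset:
  assumes "K \<in> regions n"
  shows "K \<subseteq> V - inside n"
proof -
  from assms obtain x where x: "x \<in> V - inside n" "K = region n x" by (auto simp: regions_def)
  have "y \<in> V - inside n" if "(x, y) \<in> (core_rel n)\<^sup>*" for y
    using that
  proof (induction rule: rtrancl_induct)
    case base
    then show ?case using x by simp
  next
    case (step y y')
    then show ?case using core_nbr[of y n y'] adj_in_V[OF adj_sym, of y y']
      by (auto simp: core_rel_def inside_def)
  qed
  thus ?thesis using x by (auto simp: region_def)
qed

lemma region_in_regions: "x \<in> V - inside n \<Longrightarrow> region n x \<in> regions n"
  by (simp add: regions_def)

lemma regions_eqI: "K \<in> regions n \<Longrightarrow> x \<in> K \<Longrightarrow> K = region n x"
  using region_eq by (auto simp: regions_def)

lemma regions_disjoint: "K \<in> regions n \<Longrightarrow> K' \<in> regions n \<Longrightarrow> x \<in> K \<Longrightarrow> x \<in> K' \<Longrightarrow> K = K'"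
  using regions_eqI by blast

lemma same_region:
  assumes "K \<in> regions n" "d \<in> core n" "adj d y"
  shows "d \<in> K \<longleftrightarrow> y \<in> K"
proof -
  have "(d, y) \<in> (core_rel n)\<^sup>*" using assms by (auto simp: core_rel_def)
  hence "y \<in> region n d" "d \<in> region n y" using core_rel_sym by (auto simp: region_def)
  thus ?thesis using regions_eqI[OF assms(1)] by auto
qed

lemma rim_core_nbr: "x \<in> rim n \<Longrightarrow> \<exists>d\<in>core n. adj x d"
  by (simp add: rim_def)

text \<open>A vertex of a region has a private neighbour in the core unless it lies in the core itself,
  so claw-freeness makes its neighbours outside the region pairwise adjacent.\<close>

lemma outer_clique:
  assumes K: "K \<in> regions n" "k \<in> K" and adj: "adj k v" "adj k x" and out: "v \<notin> K" "x \<notin> K" "v \<noteq> x"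
  shows "adj v x"
proof -
  have "k \<notin> core n" using same_region[OF K(1) _ adj(1)] K out by auto
  moreover have "k \<in> V - inside n" using region_subset[OF K(1)] K by auto
  ultimately have "k \<in> rim n" by (auto simp: inside_def)
  then obtain d where d: "d \<in> core n" "adj k d" using rim_core_nbr by blast
  have "d \<in> K" using same_region[OF K(1) d(1) adj_sym[OF d(2)]] K by auto
  hence "\<not> adj d v" "\<not> adj d x" "d \<noteq> v" "d \<noteq> x" using same_region[OF K(1) d(1)] out by auto
  thus ?thesis using claw[OF d(2) adj] out by blast
qed

section \<open>Levels of core, rim and inside vertices\<close>

lemma core_above: "lev a = Suc n \<Longrightarrow> adj a b \<Longrightarrow> b \<in> core n"
  using lev_adj'[of a b] adj_in_V[OF adj_sym, of a b] adj_sym[of a b]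
  by (cases "lev b = n") (auto simp: core_def)

text \<open>A core neighbour above level \<open>n\<close> would have level \<open>n + 1\<close>, and
  then all its neighbours, \<open>x\<close> among them, would be in the core.\<close>

lemma rim_core_nbr_lev:
  assumes "x \<in> rim n" "d \<in> core n" "adj x d"
  shows "lev d = n" "\<exists>a. adj d a \<and> lev a = Suc n"
proof -
  have x: "x \<in> V" "x \<notin> core n" using assms by (auto simp: rim_def)
  have "\<not> n < lev d"
  proof
    assume "n < lev d"
    moreover have "lev x \<le> n" using x by (auto simp: core_def)
    ultimately have "lev d = Suc n" using lev_adj[OF assms(3)] by simp
    thus False using core_above adj_sym[OF assms(3)] x by blast
  qed
  thus "lev d = n" "\<exists>a. adj d a \<and> lev a = Suc n" using assms(2) by (auto simp: core_def)
qed

lemma core_lev: "x \<in> core n \<Longrightarrow> n \<le> lev x"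
  by (auto simp: core_def)

lemma rim_lev: "x \<in> rim n \<Longrightarrow> n \<le> Suc (lev x)"
  using rim_core_nbr[of x n] rim_core_nbr_lev(1)[of x n] lev_adj[of x] by auto

lemma rim_lev_le: "x \<in> rim n \<Longrightarrow> lev x \<le> n"
  by (auto simp: rim_def core_def)

lemma outside_inside_lev: "x \<in> V - inside n \<Longrightarrow> n \<le> Suc (lev x)"
  using core_lev[of x n] rim_lev[of x n] unfolding inside_def by auto

text \<open>The rim reaches down to level \<open>n - 1\<close>, so only the levels up to
  \<open>n - 2\<close> are certain to be inside. This is the source of the summand 2 wherever a
  stage is chosen.\<close>

lemma inside_if_lev: "x \<in> V \<Longrightarrow> lev x + 2 \<le> n \<Longrightarrow> x \<in> inside n"
  using outside_inside_lev[of x n] by auto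

lemma inside_lev: "x \<in> inside n \<Longrightarrow> x \<in> V \<and> lev x \<le> n"
  by (auto simp: inside_def core_def)

lemma finite_inside: "finite (inside n)"
  by (rule finite_subset[OF _ finite_ball[of n]]) (use inside_lev in auto)

lemma finite_rim: "finite (rim n)"
  by (rule finite_subset[OF _ finite_ball[of n]]) (use rim_lev_le in \<open>auto simp: rim_def\<close>)

text \<open>If a lower neighbour \<open>y\<close> of \<open>x\<close> were in the rim, it would be
  the centre of a claw formed with its own lower neighbour, with \<open>x\<close> and with a core
  neighbour \<open>d\<close>: the first is two levels below the other two, and the inside vertex
  \<open>x\<close> has no neighbour in the core.\<close>

lemma lower_nbr_inside:
  assumes "2 \<le> n" "x \<in> inside n" "x \<noteq> z"
  obtains y where "adj x y" "y \<in> inside n" "lev y < lev x"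
proof -
  have x: "x \<in> V" "lev x \<le> n" using inside_lev assms by auto
  obtain y where y: "adj x y" "lev x = Suc (lev y)" using lower_nbr x assms by blast
  have yV: "y \<in> V" using y adj_sym adj_in_V by blast
  have "y \<in> inside n"
  proof (rule ccontr)
    assume ny: "y \<notin> inside n"
    have "y \<notin> core n" using core_lev[of y n] y x by auto
    with ny yV have rim: "y \<in> rim n" by (auto simp: inside_def)
    then obtain d where d: "d \<in> core n" "adj y d" using rim_core_nbr by blast
    have ld: "lev d = n" using rim_core_nbr_lev[OF rim d] by auto
    have ly: "Suc (lev y) = n" using rim_lev[OF rim] y x by auto
    have "y \<noteq> z" using ly assms(1) by auto
    then obtain b where b: "adj y b" "lev y = Suc (lev b)" using lower_nbr yV by blast
    have "\<not> adj b x" "\<not> adj b d" "b \<noteq> x" "b \<noteq> d"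
      using lev_adj[of b x] lev_adj[of b d] b ly ld y by auto
    moreover have "\<not> adj x d" "x \<noteq> d"
      using assms(2) d x by (auto simp: inside_def rim_def)
    ultimately show False using claw[OF b(1) adj_sym[OF y(1)] d(2)] by blast
  qed
  thus ?thesis using that y by auto
qed

text \<open>Descending from a vertex of the core one reaches the rim at level \<open>n - 1\<close>, and hence the
  interior in one further step.\<close>

lemma region_entrance:
  assumes "2 \<le> n" "K \<in> regions n"
  obtains v u where "v \<in> K" "v \<in> rim n" "u \<in> inside n" "adj u v"
proof -
  have core: "\<exists>v u. v \<in> K \<and> v \<in> rim n \<and> u \<in> inside n \<and> adj u v" if "x \<in> core n" "x \<in> K" for x
    using that
  proof (induction "lev x" arbitrary: x rule: less_induct)
    case less
    have x: "x \<in> V" "n \<le> lev x" using less core_lev by (auto simp: core_def)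
    hence "x \<noteq> z" using assms(1) by auto
    then obtain y where y: "adj x y" "lev x = Suc (lev y)" using lower_nbr x(1) by blast
    have yV: "y \<in> V" using y adj_sym adj_in_V by blast
    have yK: "y \<in> K" using same_region[OF assms(2) less(2) y(1)] less by auto
    show ?case
    proof (cases "y \<in> core n")
      case True
      thus ?thesis using less(1)[OF _ True yK] y by auto
    next
      case False
      hence rim: "y \<in> rim n" using yV less adj_sym[OF y(1)] by (auto simp: rim_def)
      \<comment> \<open>Otherwise \<open>y\<close>, not being in the core, would have level
        \<open>n\<close> and lie below a vertex of level \<open>n + 1\<close>, which is impossible
        by \<open>core_above\<close>.\<close>
      have "lev x = n"
      proof (rule ccontr)
        assume "lev x \<noteq> n"
        hence "n \<le> lev y" using x y by auto
        moreover have "\<not> n < lev y" using False yV by (auto simp: core_def)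
        ultimately have "lev x = Suc n" using y by auto
        thus False using core_above y(1) False by blast
      qed
      hence "y \<noteq> z" using y assms(1) by auto
      then obtain b where b: "adj y b" "lev y = Suc (lev b)" using lower_nbr yV by blast
      hence "b \<in> inside n" using inside_if_lev[of b n] \<open>lev x = n\<close> y adj_sym adj_in_V by auto
      thus ?thesis using rim yK b adj_sym by blast
    qed
  qed
  obtain x where x: "x \<in> V - inside n" "K = region n x" using assms by (auto simp: regions_def)
  have xK: "x \<in> K" using x region_self by auto
  show ?thesis
  proof (cases "x \<in> core n")
    case True
    thus ?thesis using core xK that by blast
  next
    case False
    then obtain d where d: "d \<in> core n" "adj x d" using x rim_core_nbr by (auto simp: inside_def)
    hence "d \<in> K" using same_region[OF assms(2)] adj_sym xK by blast
    thus ?thesis using core d that by blast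
  qed
qed

lemma finite_regions:
  assumes "2 \<le> n"
  shows "finite (regions n)"
proof -
  have "K \<in> region n ` rim n" if K: "K \<in> regions n" for K
  proof -
    obtain v where "v \<in> K" "v \<in> rim n" using region_entrance[OF assms K] by metis
    thus ?thesis using regions_eqI[OF K] by auto
  qed
  hence "regions n \<subseteq> region n ` rim n" by blast
  thus ?thesis using finite_rim by (auto intro: finite_subset)
qed

section \<open>Cycles crossing every region at most twice\<close>

text \<open>Only the vertex set of the cycle is recorded, since the order may change with every
  extension.\<close>

definition cycle_on :: "'a set set \<Rightarrow> 'a set \<Rightarrow> bool" where
  "cycle_on F X \<longleftrightarrow> (\<exists>u c. cyc u c \<and> set (u # c) = X \<and> (\<forall>K\<in>F. cyc_crossings K u c \<le> 2))"

lemma cycle_on_base: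
  assumes "cycle_on F X" "u \<in> X"
  obtains c where "cyc u c" "set (u # c) = X" "\<And>K. K \<in> F \<Longrightarrow> cyc_crossings K u c \<le> 2"
proof -
  obtain u' c' where c': "cyc u' c'" "set (u' # c') = X" "\<forall>K\<in>F. cyc_crossings K u' c' \<le> 2"
    using assms(1) by (auto simp: cycle_on_def)
  with cyc_rotate[of u' c' u] assms(2) obtain c where
    "cyc u c" "set (u # c) = set (u' # c')" "\<And>K. cyc_crossings K u c = cyc_crossings K u' c'"
    by blast
  thus ?thesis using that[of c] c' by auto
qed

lemma cycle_on_extend:
  assumes X: "cycle_on F X" "u \<in> X" and v: "v \<notin> X" "adj u v"
    and side: "\<And>K. K \<in> F \<Longrightarrow> u \<in> K \<longleftrightarrow> v \<in> K"
      "\<And>K w x. K \<in> F \<Longrightarrow> x \<in> X \<Longrightarrow> adj u x \<Longrightarrow> \<not> adj v x \<Longrightarrow> adj w v \<Longrightarrow> adj w x \<Longrightarrow> w \<in> K \<longleftrightarrow> v \<in> K"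
  obtains X' where "cycle_on F X'" "insert v X \<subseteq> X'"
    "\<And>y. y \<in> X' \<Longrightarrow> y \<in> insert v X \<or> adj y v \<and> (\<exists>x\<in>X. adj y x \<and> \<not> adj v x)"
proof -
  obtain c where c: "cyc u c" "set (u # c) = X" "\<And>K. K \<in> F \<Longrightarrow> cyc_crossings K u c \<le> 2"
    using cycle_on_base[OF X] by blast
  have nb: "x \<in> X" "adj u x" if "x \<in> {hd c, last c}" for x using cyc_nbrs[OF c(1)] c(2) that by auto
  have vc: "v \<notin> set (u # c)" using v c(2) by simp
  show ?thesis
  proof (rule cyc_extend[OF c(1) vc v(2)])
    fix zs assume zs: "cyc u zs" "insert v (set (u # c)) \<subseteq> set (u # zs)"
    "\<And>y. y \<in> set (u # zs) \<Longrightarrow> y \<in> insert v (set (u # c)) \<or>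
       adj y v \<and> (\<exists>x\<in>{hd c, last c}. adj y x \<and> \<not> adj v x)"
    "\<And>K. (u \<in> K \<longleftrightarrow> v \<in> K) \<Longrightarrow>
       (\<And>w x. \<not> adj v (hd c) \<Longrightarrow> \<not> adj v (last c) \<Longrightarrow> x \<in> {hd c, last c} \<Longrightarrow>
          adj w v \<Longrightarrow> adj w x \<Longrightarrow> w \<in> K \<longleftrightarrow> v \<in> K) \<Longrightarrow>
       cyc_crossings K u zs \<le> cyc_crossings K u c"
  have "cyc_crossings K u zs \<le> 2" if K: "K \<in> F" for K
  proof -
    have "cyc_crossings K u zs \<le> cyc_crossings K u c"
    proof (rule zs(4))
      show "u \<in> K \<longleftrightarrow> v \<in> K" using side K by blast
      show "w \<in> K \<longleftrightarrow> v \<in> K" if "\<not> adj v (hd c)" "\<not> adj v (last c)" "x \<in> {hd c, last c}"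
        "adj w v" "adj w x" for w x
        using side(2)[OF K nb(1)[OF that(3)] nb(2)[OF that(3)]] that by auto
    qed
    thus ?thesis using c(3)[OF K] by simp
  qed
  hence "cycle_on F (set (u # zs))" using zs(1) by (auto simp: cycle_on_def)
  moreover have "y \<in> insert v X \<or> adj y v \<and> (\<exists>x\<in>X. adj y x \<and> \<not> adj v x)" if "y \<in> set (u # zs)" for y
    using zs(3)[OF that] nb(1) unfolding c(2) by blast
  ultimately show ?thesis using that[of "set (u # zs)"] zs(2) c(2) by blast
  qed
qed

text \<open>In the application \<open>F\<close> holds the regions of earlier stages and
  \<open>S\<close> the vertices of the previous cycle; by \<open>old\<close>, a vertex off
  \<open>S\<close> has no neighbour across the boundary of a member of \<open>F\<close>. A missing
  vertex \<open>v\<close> of least level has a lower neighbour on the cycle. The detour never leaves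
  the inside: an outer vertex \<open>y\<close> adjacent to \<open>v\<close> and \<open>x\<close> has
  both of them outside its region, so they would be adjacent to each other.\<close>

lemma cycle_on_fill_inside:
  assumes n: "2 \<le> n" and old: "\<And>K v x. K \<in> F \<Longrightarrow> v \<in> V - S \<Longrightarrow> adj v x \<Longrightarrow> v \<in> K \<longleftrightarrow> x \<in> K"
    and "cycle_on F X" "z \<in> X" "S \<subseteq> X" "X \<subseteq> inside n"
  shows "cycle_on F (inside n)"
  using assms(3-)
proof (induction "card (inside n - X)" arbitrary: X rule: less_induct)
  case less
  show ?case
  proof (cases "inside n \<subseteq> X")
    case True
    thus ?thesis using less by (simp add: subset_antisym)
  next
    case False
    define v where "v = arg_min lev (\<lambda>v. v \<in> inside n - X)"
    have v: "v \<in> inside n - X" "\<And>y. y \<in> inside n - X \<Longrightarrow> lev v \<le> lev y"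
      using False arg_min_natI[of "\<lambda>v. v \<in> inside n - X"] arg_min_nat_le[of "\<lambda>v. v \<in> inside n - X"]
      unfolding v_def by blast+
    have vV: "v \<in> V - S" using v inside_lev less(4) by auto
    obtain u where u: "adj v u" "u \<in> inside n" "lev u < lev v"
      using lower_nbr_inside[OF n, of v] v less(3) by auto
    have uX: "u \<in> X" using u v(2)[of u] by fastforce
    obtain X' where X': "cycle_on F X'" "insert v X \<subseteq> X'"
      "\<And>y. y \<in> X' \<Longrightarrow> y \<in> insert v X \<or> adj y v \<and> (\<exists>x\<in>X. adj y x \<and> \<not> adj v x)"
    proof (rule cycle_on_extend[OF less(2) uX, of v])
      show "v \<notin> X" "adj u v" using v u adj_sym by auto
      show "u \<in> K \<longleftrightarrow> v \<in> K" if "K \<in> F" for K using old[OF that vV u(1)] by simp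
      show "w \<in> K \<longleftrightarrow> v \<in> K" if "K \<in> F" "adj w v" for K w
        using old[OF that(1) vV adj_sym[OF that(2)]] by simp
    qed blast
    have sub: "X' \<subseteq> inside n"
    proof
      fix y assume y: "y \<in> X'"
      show "y \<in> inside n"
      proof (rule ccontr)
        assume ny: "y \<notin> inside n"
        hence "y \<notin> insert v X" using v less(5) by auto
        then obtain x where x: "adj y v" "x \<in> X" "adj y x" "\<not> adj v x" using X'(3)[OF y] by blast
        have "y \<in> V - inside n" using x adj_in_V ny by auto
        hence K: "region n y \<in> regions n" by (rule region_in_regions)
        have "v \<notin> region n y" "x \<notin> region n y"
          using region_subset[OF K] v x less(5) by auto
        moreover have "v \<noteq> x" using v x by auto
        ultimately show False using outer_clique[OF K region_self x(1,3)] x by blast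
      qed
    qed
    have "card (inside n - X') < card (inside n - X)"
      using X'(2) v finite_inside by (intro psubset_card_mono) auto
    moreover have "z \<in> X'" "S \<subseteq> X'" using X'(2) less by auto
    ultimately show ?thesis using less(1) X'(1) sub by blast
  qed
qed

end

section \<open>Entering and filling the regions of a stage\<close>

context rooted_claw_paw
begin

text \<open>\<open>K1\<close> is entered from the inside vertex \<open>u\<close> at its rim vertex
  \<open>v\<close>. The ordinary extension is safe unless a possible detour vertex \<open>w\<close>
  lies in another region \<open>Kj\<close> (this is \<open>bad\<close>), which might then be crossed
  more than twice. In that case \<open>x\<close> lies in \<open>Kj\<close> too, and the new cycle
  reaches \<open>Kj\<close> through \<open>v\<close> and \<open>w\<close> instead of going from
  \<open>u\<close> straight to \<open>x\<close>. If \<open>w\<close> is new, it is simply inserted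
  before \<open>x\<close>; if it is already on the cycle, the segment from \<open>x\<close> up to
  \<open>w\<close> is cut out. That segment lies in \<open>Kj\<close>, so the inside stays covered,
  and \<open>w\<close> itself keeps \<open>Kj\<close> entered.\<close>

lemma cycle_on_enter:
  assumes n: "2 \<le> n" and old: "\<And>K v x. K \<in> F \<Longrightarrow> v \<in> V - S \<Longrightarrow> adj v x \<Longrightarrow> v \<in> K \<longleftrightarrow> x \<in> K"
    and X: "cycle_on (F \<union> regions n) X" "inside n \<subseteq> X" "X \<subseteq> V" "S \<subseteq> inside n"
    and K1: "K1 \<in> regions n" "K1 \<inter> X = {}"
  shows "\<exists>X'. cycle_on (F \<union> regions n) X' \<and> inside n \<subseteq> X' \<and> X' \<subseteq> V \<and> K1 \<inter> X' \<noteq> {} \<and>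
    (\<forall>K\<in>regions n. K \<inter> X \<noteq> {} \<longrightarrow> K \<inter> X' \<noteq> {})"
proof -
  obtain v u where vu: "v \<in> K1" "v \<in> rim n" "u \<in> inside n" "adj u v"
    using region_entrance[OF n K1(1)] by blast
  have uX: "u \<in> X" using vu X by auto
  have vX: "v \<notin> X" using vu K1 by auto
  have vV: "v \<in> V - S" using vu X by (auto simp: rim_def inside_def)
  have ins: "y \<notin> K" if "K \<in> regions n" "y \<in> inside n" for K y
    using region_subset[OF that(1)] that(2) by auto
  have vK: "v \<in> K \<longleftrightarrow> K = K1" if "K \<in> regions n" for K
    using regions_disjoint[OF that K1(1)] vu by auto
  obtain c where c: "cyc u c" "set (u # c) = X" "\<And>K. K \<in> F \<union> regions n \<Longrightarrow> cyc_crossings K u c \<le> 2"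
    using cycle_on_base[OF X(1) uX] by blast
  have vc: "v \<notin> set (u # c)" using vX c by simp
  note nb = cyc_nbrs[OF c(1)]
  define bad where "bad \<longleftrightarrow> \<not> adj v (hd c) \<and> \<not> adj v (last c) \<and>
    (\<exists>w x. x \<in> {hd c, last c} \<and> adj w v \<and> adj w x \<and> w \<notin> inside n \<and> w \<notin> K1)"
  show ?thesis
  proof (cases bad)
    case False
    show ?thesis
    proof (rule cyc_extend[OF c(1) vc vu(4)])
      fix zs assume zs: "cyc u zs" "insert v (set (u # c)) \<subseteq> set (u # zs)"
        "\<And>y. y \<in> set (u # zs) \<Longrightarrow> y \<in> insert v (set (u # c)) \<or>
           adj y v \<and> (\<exists>x\<in>{hd c, last c}. adj y x \<and> \<not> adj v x)"
        "\<And>K. K \<inter> set (u # c) = {} \<Longrightarrow> cyc_crossings K u zs \<le> 2"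
        "\<And>K. (u \<in> K \<longleftrightarrow> v \<in> K) \<Longrightarrow>
           (\<And>w x. \<not> adj v (hd c) \<Longrightarrow> \<not> adj v (last c) \<Longrightarrow> x \<in> {hd c, last c} \<Longrightarrow>
              adj w v \<Longrightarrow> adj w x \<Longrightarrow> w \<in> K \<longleftrightarrow> v \<in> K) \<Longrightarrow>
           cyc_crossings K u zs \<le> cyc_crossings K u c"
      have "cyc_crossings K u zs \<le> 2" if K: "K \<in> F \<union> regions n" for K
      proof (cases "K = K1")
        case True
        thus ?thesis using zs(4)[of K1] K1(2) unfolding c(2) by blast
      next
        case nK1: False
        have "cyc_crossings K u zs \<le> cyc_crossings K u c"
        proof (cases "K \<in> F")
          case True
          show ?thesis
          proof (rule zs(5))
            show "u \<in> K \<longleftrightarrow> v \<in> K" using old[OF True vV adj_sym[OF vu(4)]] by simp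
            show "w \<in> K \<longleftrightarrow> v \<in> K" if "adj w v" for w using old[OF True vV adj_sym[OF that]] by simp
          qed
        next
          case False
          hence Kr: "K \<in> regions n" using K by simp
          show ?thesis
          proof (rule zs(5))
            show "u \<in> K \<longleftrightarrow> v \<in> K" using ins[OF Kr vu(3)] vK[OF Kr] nK1 by simp
            show "w \<in> K \<longleftrightarrow> v \<in> K" if h: "\<not> adj v (hd c)" "\<not> adj v (last c)" "x \<in> {hd c, last c}"
              "adj w v" "adj w x" for w x
            proof -
              have "w \<notin> K"
              proof
                assume "w \<in> K"
                hence "w \<notin> inside n" "w \<notin> K1"
                  using region_subset[OF Kr] regions_disjoint[OF Kr K1(1)] nK1 by auto
                thus False using \<open>\<not> bad\<close> h unfolding bad_def by blast
              qed
              thus ?thesis using vK[OF Kr] nK1 by simp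
            qed
          qed
        qed
        thus ?thesis using c(3)[OF K] by simp
      qed
      hence "cycle_on (F \<union> regions n) (set (u # zs))" using zs(1) by (auto simp: cycle_on_def)
      moreover have "set (u # zs) \<subseteq> V"
        using zs(3) adj_in_V vV X(3) unfolding c(2) by blast
      ultimately show ?thesis
        using zs(2) vu(1) X(2) unfolding c(2) by (intro exI[of _ "set (u # zs)"]) blast
    qed
  next
    case True
    then obtain w x where wx: "x \<in> {hd c, last c}" "adj w v" "adj w x" "w \<notin> inside n" "w \<notin> K1"
      and nv: "\<not> adj v (hd c)" "\<not> adj v (last c)" unfolding bad_def by blast
    obtain cs where cs: "cyc u cs" "set (u # cs) = X" "hd cs = x"
      "\<And>K. K \<in> F \<union> regions n \<Longrightarrow> cyc_crossings K u cs \<le> 2"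
    proof (cases "x = hd c")
      case True
      thus ?thesis using that c by blast
    next
      case False
      hence "hd (rev c) = x" using wx(1) c(1) by (auto simp: cyc_def hd_rev)
      moreover have "set (u # rev c) = X" using c(2) by auto
      ultimately show ?thesis using that[of "rev c"] cyc_rev[OF c(1)] c(3) cyc_crossings_rev by presburger
    qed
    then obtain r where r: "cs = x # r" by (cases cs) (auto simp: cyc_def)
    have wV: "w \<in> V - inside n" using wx adj_in_V by auto
    define Kj where "Kj = region n w"
    have Kj: "Kj \<in> regions n" "w \<in> Kj" using region_in_regions[OF wV] region_self Kj_def by auto
    have KjK1: "Kj \<noteq> K1" using Kj wx by auto
    have vKj: "v \<notin> Kj" using vK Kj KjK1 by auto
    have xX: "x \<in> X" "v \<noteq> x" "\<not> adj v x" using cs r vX nv wx(1) by auto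
    \<comment> \<open>Otherwise \<open>v\<close> and \<open>x\<close> would be neighbours of
      \<open>w\<close> outside \<open>Kj\<close>, hence adjacent.\<close>
    have xKj: "x \<in> Kj"
      using outer_clique[OF Kj wx(2,3) vKj] xX by blast
    have uK: "u \<notin> K" if "K \<in> regions n" for K using ins that vu by blast
    have wK: "w \<in> K \<longleftrightarrow> K = Kj" if "K \<in> regions n" for K
      using regions_disjoint[OF that Kj(1)] Kj by auto
    have side: "u \<in> K \<longleftrightarrow> v \<in> K" "w \<in> K \<longleftrightarrow> v \<in> K" if "K \<in> F" for K
      using old[OF that vV adj_sym[OF vu(4)]] old[OF that vV adj_sym[OF wx(2)]] by auto
    have c1: "cyc u (x # r)" "v \<notin> set (u # x # r)" using cs r vX by auto
    show ?thesis
    proof (cases "w \<in> X")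
      case False
      let ?zs = "v # w # x # r"
      have cyc: "cyc u ?zs"
        using cyc_detour_new[OF c1 _ vu(4) wx(2,3)] False cs(2) r by auto
      have "cyc_crossings K u ?zs \<le> 2" if K: "K \<in> F \<union> regions n" for K
      proof (cases "K = K1")
        case True
        hence "crossings K (x # r @ [u]) = 0" "x \<notin> K" "u \<notin> K" "w \<notin> K"
          using K1(2) cs(2) r wx(5) by (auto intro!: crossings_disjoint)
        thus ?thesis by auto
      next
        case nK1: False
        have "cyc_crossings K u ?zs \<le> cyc_crossings K u (x # r)"
        proof (cases "K \<in> F")
          case True
          thus ?thesis using side[OF True] by auto
        next
          case False
          hence Kr: "K \<in> regions n" using K by simp
          show ?thesis using uK[OF Kr] vK[OF Kr] wK[OF Kr] nK1 xKj by auto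
        qed
        thus ?thesis using cs(4)[OF K] r by simp
      qed
      hence "cycle_on (F \<union> regions n) (set (u # ?zs))" using cyc unfolding cycle_on_def by blast
      moreover have "set (u # ?zs) = insert v (insert w X)" using cs(2) r by auto
      ultimately show ?thesis
        using X vV wV vu(1) by (intro exI[of _ "insert v (insert w X)"]) auto
    next
      case True
      have "w \<noteq> u" "w \<noteq> x" using wx vu adj_neq by auto
      hence "w \<in> set r" using True cs(2) r by auto
      then obtain as bs where r': "r = as @ w # bs" by (auto dest: split_list)
      let ?zs = "v # w # bs"
      have tot: "cyc_crossings K u (x # r)
          = crossings K [u, x] + crossings K (x # as @ [w]) + crossings K (w # bs @ [u])" for K
        using crossings_Cons_append[of K x as w "bs @ [u]"] by (simp add: r')
      have new: "cyc_crossings K u ?zs = crossings K [u, v, w] + crossings K (w # bs @ [u])" for K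
        by simp
      have suc: "successively adj (w # bs @ [u])"
        using c1(1) by (auto simp: cyc_def r' successively_append_iff successively_Cons)
      have cyc: "cyc u ?zs"
        using c1 suc vu(4) adj_sym[OF wx(2)] by (auto simp: cyc_def r' Suc_le_eq)
      \<comment> \<open>The edge from \<open>u\<close> to \<open>x\<close> is one crossing of
        \<open>Kj\<close> and the return from \<open>w\<close> to \<open>u\<close> contains the
        other, so the segment that is cut out contains none.\<close>
      have "1 \<le> crossings Kj (w # bs @ [u])"
        by (rule crossings_pos[of w _ u]) (use Kj uK in auto)
      moreover have "crossings Kj [u, x] = 1" using uK[OF Kj(1)] xKj by auto
      ultimately have "crossings Kj (x # as @ [w]) = 0"
        using cs(4)[of Kj] Kj tot[of Kj] r by auto
      hence dropped: "set (x # as) \<subseteq> Kj" using xKj by (auto simp: crossings_eq_0_iff)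
      have "cyc_crossings K u ?zs \<le> 2" if K: "K \<in> F \<union> regions n" for K
      proof (cases "K = K1")
        case True
        hence "crossings K (w # bs @ [u]) = 0" "u \<notin> K" "w \<notin> K"
          using K1(2) cs(2) r r' wx(5) by (auto intro!: crossings_disjoint)
        thus ?thesis using new[of K] by auto
      next
        case nK1: False
        have "cyc_crossings K u ?zs \<le> cyc_crossings K u (x # r)"
        proof (cases "K \<in> F")
          case True
          thus ?thesis using side[OF True] new[of K] tot[of K] by auto
        next
          case False
          hence Kr: "K \<in> regions n" using K by simp
          show ?thesis using uK[OF Kr] vK[OF Kr] wK[OF Kr] nK1 xKj new[of K] tot[of K] by auto
        qed
        thus ?thesis using cs(4)[OF K] r by simp
      qed
      hence cyc_on: "cycle_on (F \<union> regions n) (set (u # ?zs))" using cyc unfolding cycle_on_def by blast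
      have X': "X \<subseteq> set (u # ?zs) \<union> Kj" "set (u # ?zs) \<subseteq> insert v X" "w \<in> set (u # ?zs)"
        using dropped cs(2) r r' by auto
      have "inside n \<subseteq> set (u # ?zs)" using X(2) X' ins[OF Kj(1)] by blast
      moreover have "set (u # ?zs) \<subseteq> V" using X' X(3) vV by blast
      moreover have "K1 \<inter> set (u # ?zs) \<noteq> {}" using vu by auto
      moreover have "K \<inter> set (u # ?zs) \<noteq> {}" if K: "K \<in> regions n" "K \<inter> X \<noteq> {}" for K
      proof -
        obtain y where y: "y \<in> K" "y \<in> X" using K by auto
        show ?thesis
        proof (cases "y \<in> Kj")
          case True
          hence "K = Kj" using regions_disjoint[OF K(1) Kj(1)] y by blast
          thus ?thesis using Kj X' by blast
        next
          case False
          thus ?thesis using y X' by blast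
        qed
      qed
      ultimately show ?thesis using cyc_on by (intro exI[of _ "set (u # ?zs)"]) blast
    qed
  qed
qed

lemma cycle_on_enter_all:
  assumes n: "2 \<le> n" and old: "\<And>K v x. K \<in> F \<Longrightarrow> v \<in> V - S \<Longrightarrow> adj v x \<Longrightarrow> v \<in> K \<longleftrightarrow> x \<in> K"
    and "cycle_on (F \<union> regions n) X" "inside n \<subseteq> X" "X \<subseteq> V" "S \<subseteq> inside n"
  shows "\<exists>X'. cycle_on (F \<union> regions n) X' \<and> inside n \<subseteq> X' \<and> X' \<subseteq> V \<and> (\<forall>K\<in>regions n. K \<inter> X' \<noteq> {})"
  using assms(3-5)
proof (induction "card {K \<in> regions n. K \<inter> X = {}}" arbitrary: X rule: less_induct)
  case less
  show ?case
  proof (cases "\<forall>K\<in>regions n. K \<inter> X \<noteq> {}")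
    case True
    thus ?thesis using less by blast
  next
    case False
    then obtain K1 where K1: "K1 \<in> regions n" "K1 \<inter> X = {}" by blast
    from cycle_on_enter[OF n old less(2-4) assms(6) K1] obtain X' where X':
      "cycle_on (F \<union> regions n) X'" "inside n \<subseteq> X'" "X' \<subseteq> V" "K1 \<inter> X' \<noteq> {}"
      "\<forall>K\<in>regions n. K \<inter> X \<noteq> {} \<longrightarrow> K \<inter> X' \<noteq> {}" by blast
    have "card {K \<in> regions n. K \<inter> X' = {}} < card {K \<in> regions n. K \<inter> X = {}}"
      using X'(4,5) K1 finite_regions[OF n] by (intro psubset_card_mono) auto
    thus ?thesis using less(1) X'(1-3) by blast
  qed
qed

text \<open>Each extension follows an edge of \<open>core_rel\<close>, so \<open>u\<close> and
  \<open>v\<close> share their region and it remains to place the detour vertex \<open>w\<close>. If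
  \<open>v\<close> is in the core, its neighbour \<open>w\<close> is in its region. If
  \<open>v\<close> is in the rim, then \<open>u\<close> is in the core and \<open>w\<close> is
  placed by way of \<open>x\<close>, which turns out to be in the core as well.\<close>

lemma cycle_on_fill:
  assumes n: "2 \<le> n" and old: "\<And>K v x. K \<in> F \<Longrightarrow> v \<in> V - S \<Longrightarrow> adj v x \<Longrightarrow> v \<in> K \<longleftrightarrow> x \<in> K"
    and X: "cycle_on (F \<union> regions n) X" "inside n \<subseteq> X" "X \<subseteq> V" "S \<subseteq> inside n"
    and ab: "(a, b) \<in> (core_rel n)\<^sup>*" "a \<in> X"
  shows "\<exists>X'. cycle_on (F \<union> regions n) X' \<and> X \<subseteq> X' \<and> X' \<subseteq> V \<and> b \<in> X'"
  using ab(1)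
proof (induction rule: rtrancl_induct)
  case base
  then show ?case using X ab by blast
next
  case (step u v)
  then obtain X1 where X1: "cycle_on (F \<union> regions n) X1" "X \<subseteq> X1" "X1 \<subseteq> V" "u \<in> X1" by blast
  have uv: "adj u v" "u \<in> core n \<or> v \<in> core n" using step by (auto simp: core_rel_def)
  show ?case
  proof (cases "v \<in> X1")
    case True
    thus ?thesis using X1 by blast
  next
    case False
    have vV: "v \<in> V - S" using adj_in_V[OF adj_sym[OF uv(1)]] False X X1 by auto
    have vin: "v \<notin> inside n" using False X X1 by auto
    obtain X' where "cycle_on (F \<union> regions n) X'" "insert v X1 \<subseteq> X'"
      "\<And>y. y \<in> X' \<Longrightarrow> y \<in> insert v X1 \<or> adj y v \<and> (\<exists>x\<in>X1. adj y x \<and> \<not> adj v x)"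
    proof (rule cycle_on_extend[OF X1(1,4) False uv(1)])
      show "u \<in> K \<longleftrightarrow> v \<in> K" if K: "K \<in> F \<union> regions n" for K
      proof (cases "K \<in> F")
        case True
        thus ?thesis using old[OF True vV adj_sym[OF uv(1)]] by simp
      next
        case False
        hence Kr: "K \<in> regions n" using K by simp
        show ?thesis using same_region[OF Kr _ uv(1)] same_region[OF Kr _ adj_sym[OF uv(1)]] uv(2) by auto
      qed
      show "w \<in> K \<longleftrightarrow> v \<in> K" if K: "K \<in> F \<union> regions n" and x: "x \<in> X1" "adj u x" "\<not> adj v x"
        and w: "adj w v" "adj w x" for K w x
      proof (cases "K \<in> F")
        case True
        thus ?thesis using old[OF True vV adj_sym[OF w(1)]] by simp
      next
        case False
        hence Kr: "K \<in> regions n" using K by simp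
        show ?thesis
        proof (cases "v \<in> core n")
          case True
          thus ?thesis using same_region[OF Kr True adj_sym[OF w(1)]] by simp
        next
          case False
          hence rim: "v \<in> rim n" and u: "u \<in> core n" using vV vin uv(2) by (auto simp: inside_def)
          \<comment> \<open>All neighbours of \<open>a\<close> are in the core, so \<open>v\<close>
            is not one of them. Unless \<open>x = a\<close>, the claw condition at \<open>u\<close>
            for \<open>a\<close>, \<open>v\<close> and \<open>x\<close> then forces \<open>x\<close>
            to be adjacent to \<open>a\<close>.\<close>
          obtain a where a: "adj u a" "lev a = Suc n"
            using rim_core_nbr_lev(2)[OF rim u adj_sym[OF uv(1)]] by blast
          have av: "\<not> adj a v" "a \<noteq> v"
            using core_above[OF a(2), of v] False rim_lev_le[OF rim] a(2) by auto
          have xcore: "x \<in> core n"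
          proof (cases "x = a")
            case True
            thus ?thesis using a adj_in_V[OF adj_sym[OF a(1)]] by (auto simp: core_def)
          next
            case False
            have "v \<noteq> x" using x \<open>v \<notin> X1\<close> by auto
            hence "adj a x" using claw[OF a(1) uv(1) x(2)] av x(3) False by blast
            thus ?thesis using core_above[OF a(2)] by blast
          qed
          show ?thesis
            using same_region[OF Kr xcore adj_sym[OF w(2)]] same_region[OF Kr u x(2)]
              same_region[OF Kr u uv(1)] by simp
        qed
      qed
    qed blast
    thus ?thesis using X1 vV adj_in_V by (intro exI[of _ X']) blast
  qed
qed

lemma cycle_on_fill_finite:
  assumes n: "2 \<le> n" and old: "\<And>K v x. K \<in> F \<Longrightarrow> v \<in> V - S \<Longrightarrow> adj v x \<Longrightarrow> v \<in> K \<longleftrightarrow> x \<in> K"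
    and X: "cycle_on (F \<union> regions n) X" "inside n \<subseteq> X" "X \<subseteq> V" "S \<subseteq> inside n"
    and entered: "\<forall>K\<in>regions n. K \<inter> X \<noteq> {}" and B: "finite B" "B \<subseteq> V"
  shows "\<exists>X'. cycle_on (F \<union> regions n) X' \<and> X \<subseteq> X' \<and> X' \<subseteq> V \<and> B \<subseteq> X'"
  using B
proof (induction B rule: finite_induct)
  case empty
  then show ?case using X by blast
next
  case (insert b B)
  then obtain X1 where X1: "cycle_on (F \<union> regions n) X1" "X \<subseteq> X1" "X1 \<subseteq> V" "B \<subseteq> X1" by auto
  show ?case
  proof (cases "b \<in> inside n")
    case True
    thus ?thesis using X1 X by blast
  next
    case False
    hence "region n b \<in> regions n" using insert by (intro region_in_regions) auto
    then obtain a where a: "a \<in> region n b" "a \<in> X1" using entered X1(2) by blast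
    hence "(a, b) \<in> (core_rel n)\<^sup>*" using core_rel_sym by (auto simp: region_def)
    from cycle_on_fill[OF n old X1(1) _ X1(3) X(4) this a(2)] X X1 show ?thesis by blast
  qed
qed

section \<open>The sequence of stages\<close>

definition tame :: "nat \<Rightarrow> 'a list \<Rightarrow> bool" where
  "tame n ys \<longleftrightarrow> {x \<in> V. lev x \<le> n} \<subseteq> set (z # ys) \<and>
     (\<forall>K\<in>regions n. cyc_crossings K z ys \<le> 2 \<and> K \<inter> set (z # ys) \<noteq> {})"

text \<open>After a stage all vertices off the cycle lie in its core, hence in the same region as all their
  neighbours, so that later extensions do not cross its regions more often.\<close>

lemma next_stage:
  assumes cyc: "cyc z ys" "set ys \<subseteq> V" and N: "\<And>n. n \<in> N \<Longrightarrow> tame n ys"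
    and m: "2 \<le> m" "\<And>x. x \<in> set (z # ys) \<Longrightarrow> lev x + 2 \<le> m"
  shows "\<exists>zs. cyc z zs \<and> set zs \<subseteq> V \<and> (\<forall>n\<in>insert m N. tame n zs)"
proof -
  define F where "F = (\<Union>n\<in>N. regions n)"
  define S where "S = set (z # ys)"
  have old: "v \<in> K \<longleftrightarrow> x \<in> K" if K: "K \<in> F" and v: "v \<in> V - S" "adj v x" for K v x
  proof -
    obtain n where n: "n \<in> N" "K \<in> regions n" using K by (auto simp: F_def)
    have "\<not> lev v \<le> n" using N[OF n(1)] v by (auto simp: tame_def S_def)
    hence "v \<in> core n" using v by (auto simp: core_def)
    thus ?thesis using same_region[OF n(2) _ v(2)] by blast
  qed
  have S: "S \<subseteq> inside m" "z \<in> S" using m(2) cyc(2) z_in_V inside_if_lev by (auto simp: S_def)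
  have "cycle_on F S"
    using cyc N unfolding cycle_on_def F_def S_def tame_def by blast
  hence "cycle_on F (inside m)"
    using cycle_on_fill_inside[OF m(1) old _ S(2) order_refl S(1)] by blast
  then obtain u c where c: "cyc u c" "set (u # c) = inside m" "\<forall>K\<in>F. cyc_crossings K u c \<le> 2"
    by (auto simp: cycle_on_def)
  have "cyc_crossings K u c \<le> 2" if "K \<in> regions m" for K
  proof -
    have "set (u # c @ [u]) \<inter> K = {}" using region_subset[OF that] c(2) by auto
    from crossings_disjoint[OF this] show ?thesis by simp
  qed
  hence "cycle_on (F \<union> regions m) (inside m)" using c unfolding cycle_on_def by blast
  moreover have "inside m \<subseteq> V" using inside_lev by auto
  ultimately have "\<exists>X1. cycle_on (F \<union> regions m) X1 \<and> inside m \<subseteq> X1 \<and> X1 \<subseteq> V \<and>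
    (\<forall>K\<in>regions m. K \<inter> X1 \<noteq> {})"
    by (intro cycle_on_enter_all[OF m(1) old _ order_refl _ S(1)])
  then obtain X1 where X1: "cycle_on (F \<union> regions m) X1" "inside m \<subseteq> X1" "X1 \<subseteq> V"
    "\<forall>K\<in>regions m. K \<inter> X1 \<noteq> {}" by blast
  have "\<exists>X2. cycle_on (F \<union> regions m) X2 \<and> X1 \<subseteq> X2 \<and> X2 \<subseteq> V \<and> {x \<in> V. lev x \<le> m} \<subseteq> X2"
    by (rule cycle_on_fill_finite[OF m(1) old X1(1-3) S(1) X1(4) finite_ball]) auto
  then obtain X2 where X2: "cycle_on (F \<union> regions m) X2" "X1 \<subseteq> X2" "X2 \<subseteq> V" "{x \<in> V. lev x \<le> m} \<subseteq> X2" by blast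
  have "z \<in> X2" using S X1 X2 by blast
  then obtain zs where zs: "cyc z zs" "set (z # zs) = X2"
    "\<And>K. K \<in> F \<union> regions m \<Longrightarrow> cyc_crossings K z zs \<le> 2"
    using cycle_on_base[OF X2(1)] by blast
  have "tame n zs" if "n \<in> insert m N" for n
  proof (cases "n = m")
    case True
    thus ?thesis unfolding tame_def zs(2) using zs(3) X1 X2 by blast
  next
    case False
    hence n: "n \<in> N" using that by simp
    have "S \<subseteq> X2" using S X1 X2 by blast
    thus ?thesis using N[OF n] zs(3) n unfolding tame_def zs(2) S_def F_def by blast
  qed
  thus ?thesis using zs X2(3) by auto
qed

lemma exhausting_cycles:
  assumes "cyc z ys" "set ys \<subseteq> V"
  obtains c :: "nat \<Rightarrow> 'a list" and n :: "nat \<Rightarrow> nat" where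
    "strict_mono n" "\<And>k. 2 \<le> n k" "\<And>k. cyc z (c k)" "\<And>k. set (c k) \<subseteq> V"
    "\<And>j k. j \<le> k \<Longrightarrow> tame (n j) (c k)"
proof -
  \<comment> \<open>A state consists of the set of stages treated so far, the latest of them, and
    the current cycle.\<close>
  define P where "P = (\<lambda>s :: nat set \<times> nat \<times> 'a list. case s of (N, m, c) \<Rightarrow>
    m \<in> N \<and> 2 \<le> m \<and> cyc z c \<and> set c \<subseteq> V \<and> (\<forall>n\<in>N. tame n c))"
  define Q where "Q = (\<lambda>(s :: nat set \<times> nat \<times> 'a list) (s' :: nat set \<times> nat \<times> 'a list). case s of (N, m, c) \<Rightarrow> case s' of (N', m', c') \<Rightarrow>
    N \<subseteq> N' \<and> m < m')"
  have next_step: "\<exists>m' c'. k < m' \<and> P (insert m' N, m', c')"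
    if "cyc z c" "set c \<subseteq> V" "\<And>n. n \<in> N \<Longrightarrow> tame n c" for N c k
  proof -
    \<comment> \<open>The maximum and the 2 put the whole current cycle inside stage
      \<open>m'\<close>; the summand \<open>k\<close> makes the stages increase.\<close>
    define m' where "m' = Max (lev ` set (z # c)) + k + 2"
    have "lev x + 2 \<le> m'" if "x \<in> set (z # c)" for x
    proof -
      have "lev x \<le> Max (lev ` set (z # c))" using that by (intro Max_ge) auto
      thus ?thesis unfolding m'_def by simp
    qed
    moreover have "2 \<le> m'" by (simp add: m'_def)
    ultimately have "\<exists>c'. cyc z c' \<and> set c' \<subseteq> V \<and> (\<forall>n\<in>insert m' N. tame n c')"
      using that by (intro next_stage)
    then obtain c' where "cyc z c'" "set c' \<subseteq> V" "\<forall>n\<in>insert m' N. tame n c'" by blast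
    thus ?thesis unfolding P_def m'_def by (intro exI[of _ m'] exI[of _ c']) (auto simp: m'_def)
  qed
  have "\<exists>s. \<forall>k. P (s k) \<and> Q (s k) (s (Suc k))"
  proof (rule dependent_nat_choice[of "\<lambda>_. P" "\<lambda>_. Q"])
    show "\<exists>s. P s" using next_step[OF assms, of "{}"] by blast
    show "\<exists>s'. P s' \<and> Q s s'" if "P s" for s and k :: nat
    proof -
      obtain N m c where s: "s = (N, m, c)" by (cases s) auto
      from next_step[of c N m] that obtain m' c' where "m < m'" "P (insert m' N, m', c')"
        unfolding P_def s by auto
      thus ?thesis by (intro exI[of _ "(insert m' N, m', c')"]) (auto simp: Q_def s)
    qed
  qed
  then obtain s where s: "\<And>k. P (s k)" "\<And>k. Q (s k) (s (Suc k))" by blast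
  define N where "N = (\<lambda>k. fst (s k))"
  define n where "n = (\<lambda>k. fst (snd (s k)))"
  define c where "c = (\<lambda>k. snd (snd (s k)))"
  have P: "n k \<in> N k" "2 \<le> n k" "cyc z (c k)" "set (c k) \<subseteq> V" "\<And>m. m \<in> N k \<Longrightarrow> tame m (c k)" for k
    using s(1)[of k] unfolding P_def N_def n_def c_def by (auto split: prod.splits)
  have Q: "N k \<subseteq> N (Suc k)" "n k < n (Suc k)" for k
    using s(2)[of k] unfolding Q_def N_def n_def by (auto split: prod.splits)
  have "N j \<subseteq> N k" if "j \<le> k" for j k using lift_Suc_mono_le[of N] Q(1) that by blast
  hence "tame (n j) (c k)" if "j \<le> k" for j k using P(1)[of j] P(5)[of "n j" k] that by blast
  thus ?thesis using that[of n c] P(2-4) Q(2) by (auto simp: strict_mono_Suc_iff)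
qed

end

section \<open>Positions along a cycle and their limits\<close>

text \<open>For a vertex off the list this is the total weight, so the positions stay bounded even
  for vertices that a cycle has not reached yet.\<close>

definition pos :: "('a \<Rightarrow> real) \<Rightarrow> 'a list \<Rightarrow> 'a \<Rightarrow> real" where
  "pos wt l x = sum_list (map wt (takeWhile (\<lambda>y. y \<noteq> x) l))"

lemma pos_append:
  assumes "x \<notin> set as"
  shows "pos wt (as @ x # bs) x = sum_list (map wt as)"
proof -
  have "takeWhile (\<lambda>y. y \<noteq> x) (as @ x # bs) = as"
    using assms by (auto simp: takeWhile_append)
  thus ?thesis by (simp add: pos_def)
qed

lemma sum_list_map_nonneg: "(\<And>y. 0 < wt y) \<Longrightarrow> 0 \<le> sum_list (map (wt :: 'a \<Rightarrow> real) xs)"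
  by (induction xs) (auto simp: less_imp_le add_nonneg_nonneg)

context
  fixes wt :: "'a \<Rightarrow> real" and l :: "'a list"
  assumes wt_pos: "\<And>x. 0 < wt x" and dist: "distinct l"
begin

lemma pos_nonneg: "0 \<le> pos wt l x"
  unfolding pos_def using wt_pos by (rule sum_list_map_nonneg)

lemma pos_order:
  assumes "x \<in> set l" "y \<in> set l" "x \<noteq> y"
  shows "(\<exists>as bs cs. l = as @ x # bs @ y # cs) \<and> pos wt l x + wt x \<le> pos wt l y \<or>
         (\<exists>as bs cs. l = as @ y # bs @ x # cs) \<and> pos wt l y + wt y \<le> pos wt l x"
proof -
  have key: "pos wt l a + wt a \<le> pos wt l b" if l: "l = as @ a # bs @ b # cs" for a b as bs cs
  proof -
    have "pos wt l a = sum_list (map wt as)"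
      using dist pos_append[of a as wt "bs @ b # cs"] l by simp
    moreover have "pos wt l b = sum_list (map wt (as @ a # bs))"
      using dist pos_append[of b "as @ a # bs" wt cs] l by auto
    ultimately show ?thesis using sum_list_map_nonneg[of wt bs] wt_pos by auto
  qed
  obtain as bs where l: "l = as @ x # bs" using assms by (auto dest: split_list)
  show ?thesis
  proof (cases "y \<in> set bs")
    case True
    then obtain bs1 cs where "l = as @ x # bs1 @ y # cs" using l by (auto dest: split_list)
    thus ?thesis using key by blast
  next
    case False
    hence "y \<in> set as" using assms l by auto
    then obtain as1 as2 where "l = as1 @ y # as2 @ x # bs" using l by (auto dest: split_list)
    thus ?thesis using key by blast
  qed
qed

lemma pos_less_split:
  assumes "x \<in> set l" "y \<in> set l" "pos wt l x < pos wt l y"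
  shows "\<exists>as bs cs. l = as @ x # bs @ y # cs"
proof -
  have "x \<noteq> y" using assms by auto
  moreover have "\<not> pos wt l y + wt y \<le> pos wt l x" using wt_pos[of y] assms(3) by linarith
  ultimately show ?thesis using pos_order[OF assms(1,2)] by blast
qed

lemma pos_le_total: "x \<in> set l \<Longrightarrow> pos wt l x + wt x \<le> sum_list (map wt l)"
proof -
  assume "x \<in> set l"
  then obtain as bs where l: "l = as @ x # bs" by (auto dest: split_list)
  hence "pos wt l x = sum_list (map wt as)" using dist pos_append[of x as wt bs] by simp
  thus ?thesis using l sum_list_map_nonneg[of wt bs] wt_pos by auto
qed

end

text \<open>Used contrapositively: an equation that holds for infinitely many \<open>k\<close>
  passes to the limit.\<close>

lemma tendsto_add_const_unique:
  fixes f g :: "nat \<Rightarrow> real"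
  assumes "f \<longlonglongrightarrow> a" "g \<longlonglongrightarrow> b" "a \<noteq> b + d"
  shows "eventually (\<lambda>k. f k \<noteq> g k + d) sequentially"
proof -
  have "(\<lambda>k. f k - (g k + d)) \<longlonglongrightarrow> a - (b + d)" by (intro tendsto_intros assms)
  moreover have "a - (b + d) \<noteq> 0" using assms by simp
  ultimately have "eventually (\<lambda>k. f k - (g k + d) \<noteq> 0) sequentially" by (rule tendsto_imp_eventually_ne)
  thus ?thesis by simp
qed

section \<open>Positions of regions along one cycle\<close>

context rooted_claw_paw
begin

lemma z_notin_regions: "2 \<le> n \<Longrightarrow> K \<in> regions n \<Longrightarrow> z \<notin> K"
  using region_subset inside_if_lev[of z n] z_in_V by auto

lemma rim_if_nbr_outside:
  assumes "K \<in> regions n" "e \<in> K" "adj e y" "y \<notin> K"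
  shows "e \<in> rim n"
  using assms same_region[OF assms(1) _ assms(3)] region_subset[OF assms(1)] by (auto simp: inside_def)

context
  fixes wt :: "'a \<Rightarrow> real" and c :: "'a list"
  assumes wt_pos: "\<And>x. 0 < wt x" and cyc: "cyc z c"
begin

lemma dist_cyc: "distinct (z # c)"
  using cyc by (simp add: cyc_def)

lemma pos_z: "pos wt (z # c) z = 0"
  by (simp add: pos_def)

lemma pos_succ:
  assumes "x \<in> set (z # c)"
  shows "\<exists>y. adj x y \<and> (y \<in> set (z # c) \<and> pos wt (z # c) y = pos wt (z # c) x + wt x \<or>
    y = z \<and> sum_list (map wt (z # c)) = pos wt (z # c) x + wt x)"
proof -
  obtain as bs where l: "z # c = as @ x # bs" using assms by (meson split_list)
  have d: "x \<notin> set as" using dist_cyc unfolding l by auto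
  have px: "pos wt (z # c) x = sum_list (map wt as)" unfolding l using d by (rule pos_append)
  have suc: "successively adj ((z # c) @ [z])" using cyc by (simp add: cyc_def)
  show ?thesis
  proof (cases bs)
    case Nil
    have "adj x z" using suc unfolding l Nil by (auto simp: successively_append_iff)
    moreover have "sum_list (map wt (z # c)) = pos wt (z # c) x + wt x" unfolding px unfolding l Nil by simp
    ultimately show ?thesis by blast
  next
    case (Cons y bs')
    have "adj x y" using suc unfolding l Cons by (auto simp: successively_append_iff)
    moreover have "y \<notin> set (as @ [x])" using dist_cyc unfolding l Cons by auto
    hence "pos wt (z # c) y = sum_list (map wt (as @ [x]))"
      using pos_append[of y "as @ [x]" wt bs'] unfolding l Cons by simp
    moreover have "y \<in> set (z # c)" unfolding l Cons by simp
    ultimately show ?thesis using px by (intro exI[of _ y]) auto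
  qed
qed

lemma pos_pred:
  assumes "y \<in> set (z # c)"
  shows "\<exists>x. adj x y \<and> x \<in> set (z # c) \<and> (pos wt (z # c) y = pos wt (z # c) x + wt x \<or>
    y = z \<and> sum_list (map wt (z # c)) = pos wt (z # c) x + wt x)"
proof -
  obtain as bs where l: "z # c = as @ y # bs" using assms by (meson split_list)
  have d: "y \<notin> set as" using dist_cyc unfolding l by auto
  have py: "pos wt (z # c) y = sum_list (map wt as)" unfolding l using d by (rule pos_append)
  have suc: "successively adj ((z # c) @ [z])" using cyc by (simp add: cyc_def)
  show ?thesis
  proof (cases as rule: rev_cases)
    case Nil
    hence yz: "y = z" using l by simp
    obtain c' x where c': "c = c' @ [x]" using cyc by (cases c rule: rev_cases) (auto simp: cyc_def)
    have "adj x z" using suc unfolding c' by (auto simp: successively_append_iff successively_Cons)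
    moreover have "x \<notin> set (z # c')" using dist_cyc unfolding c' by auto
    hence "pos wt (z # c) x = sum_list (map wt (z # c'))"
      using pos_append[of x "z # c'" wt "[]"] unfolding c' by simp
    ultimately show ?thesis using yz c' by (intro exI[of _ x]) auto
  next
    case (snoc as' x)
    have "adj x y" using suc unfolding l snoc by (auto simp: successively_append_iff successively_Cons split: if_splits)
    moreover have "x \<notin> set as'" using dist_cyc unfolding l snoc by auto
    hence "pos wt (z # c) x = sum_list (map wt as')"
      using pos_append[of x as' wt "y # bs"] unfolding l snoc by simp
    moreover have "x \<in> set (z # c)" unfolding l snoc by simp
    ultimately show ?thesis using py snoc by (intro exI[of _ x]) auto
  qed
qed

lemma region_between:
  assumes K: "z \<notin> K" "cyc_crossings K z c \<le> 2" and xy: "x \<in> K" "y \<in> K" "z # c = as @ x # bs @ y # cs"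
  shows "set bs \<subseteq> K"
proof (rule convex_if_crossings_le_2[of K "as @ [x]" bs "y # cs @ [z]"])
  have eq: "(as @ [x]) @ bs @ y # cs @ [z] = (z # c) @ [z]" using xy by simp
  show "crossings K ((as @ [x]) @ bs @ y # cs @ [z]) \<le> 2" unfolding eq using K by simp
  have "hd (as @ [x]) = z" using xy by (cases as) auto
  thus "hd (as @ [x]) \<notin> K" using K by simp
qed (use K xy in auto)

lemma pos_convex:
  assumes K: "z \<notin> K" "cyc_crossings K z c \<le> 2" and "x \<in> K" "y \<in> K"
    and mem: "x \<in> set (z # c)" "w \<in> set (z # c)" "y \<in> set (z # c)"
    and "pos wt (z # c) x < pos wt (z # c) w" "pos wt (z # c) w < pos wt (z # c) y"
  shows "w \<in> K"
proof -
  obtain as bs cs where l: "z # c = as @ x # bs @ y # cs"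
    using pos_less_split[of wt, OF wt_pos dist_cyc mem(1,3) less_trans[OF assms(8,9)]] by blast
  have "w \<in> set bs"
  proof (rule ccontr)
    assume "w \<notin> set bs"
    moreover have "w \<noteq> x" "w \<noteq> y" using assms by auto
    ultimately consider "w \<in> set as" | "w \<in> set cs" using mem(2) unfolding l by auto
    thus False
    proof cases
      case 1
      then obtain as1 as2 where "as = as1 @ w # as2" by (auto dest: split_list)
      hence l': "z # c = as1 @ w # as2 @ x # bs @ y # cs" using l by simp
      have "pos wt (z # c) w = sum_list (map wt as1)"
        using dist_cyc pos_append[of w as1 wt "as2 @ x # bs @ y # cs"] unfolding l' by auto
      moreover have "pos wt (z # c) x = sum_list (map wt (as1 @ w # as2))"
        using dist_cyc pos_append[of x "as1 @ w # as2" wt "bs @ y # cs"] unfolding l' by auto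
      ultimately show False using assms sum_list_map_nonneg[of wt as2] wt_pos[of w] wt_pos by auto
    next
      case 2
      then obtain cs1 cs2 where "cs = cs1 @ w # cs2" by (auto dest: split_list)
      hence l': "z # c = as @ x # bs @ y # cs1 @ w # cs2" using l by simp
      have "pos wt (z # c) y = sum_list (map wt (as @ x # bs))"
        using dist_cyc pos_append[of y "as @ x # bs" wt "cs1 @ w # cs2"] unfolding l' by auto
      moreover have "pos wt (z # c) w = sum_list (map wt (as @ x # bs @ y # cs1))"
        using dist_cyc pos_append[of w "as @ x # bs @ y # cs1" wt cs2] unfolding l' by auto
      ultimately show False using assms sum_list_map_nonneg[of wt cs1] wt_pos[of y] wt_pos by auto
    qed
  qed
  thus ?thesis using region_between[OF K assms(3,4) l] by blast
qed

text \<open>The segment from \<open>x\<close> to \<open>y\<close> stays in \<open>K\<close>, so its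
  weight is part of that of \<open>K\<close>. This will make the parameter intervals of late regions
  short.\<close>

lemma pos_diff_le:
  assumes K: "z \<notin> K" "cyc_crossings K z c \<le> 2" and xy: "x \<in> K" "y \<in> K"
    and mem: "x \<in> set (z # c)" "y \<in> set (z # c)"
  shows "pos wt (z # c) y - pos wt (z # c) x \<le> sum wt (K \<inter> set (z # c))"
proof (cases "pos wt (z # c) x < pos wt (z # c) y")
  case True
  then obtain as bs cs where l: "z # c = as @ x # bs @ y # cs"
    using pos_less_split[of wt, OF wt_pos dist_cyc mem] by blast
  have "pos wt (z # c) x = sum_list (map wt as)"
    using dist_cyc pos_append[of x as wt "bs @ y # cs"] unfolding l by auto
  moreover have "pos wt (z # c) y = sum_list (map wt (as @ x # bs))"
    using dist_cyc pos_append[of y "as @ x # bs" wt cs] unfolding l by auto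
  ultimately have "pos wt (z # c) y - pos wt (z # c) x = sum_list (map wt (x # bs))" by simp
  also have "\<dots> = sum wt (set (x # bs))"
    using dist_cyc unfolding l by (intro sum_list_distinct_conv_sum_set) auto
  also have "\<dots> \<le> sum wt (K \<inter> set (z # c))"
  proof (intro sum_mono2)
    show "set (x # bs) \<subseteq> K \<inter> set (z # c)" using region_between[OF K xy l] xy unfolding l by auto
  qed (auto simp: wt_pos less_imp_le)
  finally show ?thesis .
next
  case False
  thus ?thesis using sum_nonneg[of "K \<inter> set (z # c)" wt] wt_pos by (auto simp: less_imp_le not_less intro: order_trans[of _ 0])
qed

text \<open>The successor of the last vertex lies outside \<open>K\<close>, and a core vertex has no
  such neighbour. As the rim is finite, only finitely many candidates for the last vertex remain
  when the limit is taken.\<close>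

lemma region_last:
  assumes "2 \<le> n" "K \<in> regions n" "K \<inter> set (z # c) \<noteq> {}"
  shows "\<exists>e\<in>K \<inter> set (z # c) \<inter> rim n. \<forall>x\<in>K \<inter> set (z # c). pos wt (z # c) x \<le> pos wt (z # c) e"
proof -
  have fin: "finite (K \<inter> set (z # c))" by simp
  obtain e where e: "e \<in> K \<inter> set (z # c)" "\<forall>x\<in>K \<inter> set (z # c). pos wt (z # c) x \<le> pos wt (z # c) e"
    using arg_min_if_finite[OF fin assms(3), of "\<lambda>x. - pos wt (z # c) x"] by (meson neg_less_iff_less not_le)
  obtain y where y: "adj e y" "y \<in> set (z # c) \<and> pos wt (z # c) y = pos wt (z # c) e + wt e \<or> y = z"
    using pos_succ[of e] e by blast
  have "y \<notin> K"
  proof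
    assume "y \<in> K"
    hence "y \<noteq> z" using z_notin_regions[OF assms(1,2)] by auto
    hence "y \<in> K \<inter> set (z # c)" "pos wt (z # c) y = pos wt (z # c) e + wt e"
      using y(2) \<open>y \<in> K\<close> by blast+
    thus False using e(2) wt_pos[of e] by (metis less_add_same_cancel1 not_le)
  qed
  hence "e \<in> rim n" using rim_if_nbr_outside[OF assms(2) _ y(1)] e by blast
  thus ?thesis using e by blast
qed

lemma region_first:
  assumes "2 \<le> n" "K \<in> regions n" "K \<inter> set (z # c) \<noteq> {}"
  shows "\<exists>e\<in>K \<inter> set (z # c) \<inter> rim n. \<forall>x\<in>K \<inter> set (z # c). pos wt (z # c) e \<le> pos wt (z # c) x"
proof -
  have fin: "finite (K \<inter> set (z # c))" by simp
  obtain e where e: "e \<in> K \<inter> set (z # c)" "\<forall>x\<in>K \<inter> set (z # c). pos wt (z # c) e \<le> pos wt (z # c) x"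
    using arg_min_if_finite[OF fin assms(3), of "pos wt (z # c)"] by (meson not_le)
  obtain y where y: "adj y e" "y \<in> set (z # c)" "pos wt (z # c) e = pos wt (z # c) y + wt y \<or> e = z"
    using pos_pred[of e] e by blast
  have "y \<notin> K"
  proof
    assume "y \<in> K"
    hence "pos wt (z # c) e \<le> pos wt (z # c) y" using e(2) y(2) by blast
    moreover have "e \<noteq> z" using z_notin_regions[OF assms(1,2)] e(1) by auto
    ultimately show False using y(3) wt_pos[of y] by linarith
  qed
  hence "e \<in> rim n" using rim_if_nbr_outside[OF assms(2) _ adj_sym[OF y(1)]] e by blast
  thus ?thesis using e by blast
qed

end

end

lemma sum_half_powers_le:
  fixes idx :: "'a \<Rightarrow> nat"
  assumes "finite F" "inj_on idx F" "\<And>x. x \<in> F \<Longrightarrow> N \<le> idx x"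
  shows "(\<Sum>x\<in>F. (1/2) ^ Suc (idx x)) \<le> (1/2 :: real) ^ N"
proof -
  have tele: "(\<Sum>i\<in>{N..<N + d}. (1/2) ^ Suc i) = (1/2 :: real) ^ N - (1/2) ^ (N + d)" for d
    by (induction d) simp_all
  define d where "d = Suc (Max (insert 0 (idx ` F)))"
  have "(\<Sum>x\<in>F. (1/2) ^ Suc (idx x)) = (\<Sum>i\<in>idx ` F. (1/2 :: real) ^ Suc i)"
    using assms(2) by (simp add: sum.reindex)
  also have "\<dots> \<le> (\<Sum>i\<in>{N..<N + d}. (1/2 :: real) ^ Suc i)"
  proof (rule sum_mono2)
    show "idx ` F \<subseteq> {N..<N + d}"
    proof
      fix i assume i: "i \<in> idx ` F"
      hence "i \<le> Max (insert 0 (idx ` F))" using assms(1) by (intro Max_ge) auto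
      thus "i \<in> {N..<N + d}" using i assms(3) unfolding d_def by auto
    qed
  qed auto
  also have "\<dots> \<le> (1/2) ^ N" unfolding tele by simp
  finally show ?thesis .
qed

section \<open>Passing to the limit of the positions\<close>

context rooted_claw_paw
begin

lemma countable_V: "countable V"
proof -
  have "V = (\<Union>n. {x \<in> V. lev x \<le> n})" by auto
  moreover have "countable (\<Union>n. {x \<in> V. lev x \<le> n})"
    using finite_ball by (intro countable_UN) (auto intro: countable_finite)
  ultimately show ?thesis by simp
qed

text \<open>Strict inequalities between limits hold for all late cycles, where the order on the
  cycle can be consulted. The existential conclusions survive because the candidates are finite in
  number: if every neighbour, or every rim vertex of the region, failed in the limit, all of them
  would fail on one common cycle.\<close>

lemma limit_positions:
  fixes n :: "nat \<Rightarrow> nat" and c :: "nat \<Rightarrow> 'a list"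
  assumes mono: "strict_mono n" and n2: "\<And>k. 2 \<le> n k" and cyc: "\<And>k. cyc z (c k)"
    and cV: "\<And>k. set (c k) \<subseteq> V" and tame: "\<And>j k. j \<le> k \<Longrightarrow> tame (n j) (c k)"
  obtains p wt :: "'a \<Rightarrow> real" and A :: real where
    "\<And>x. 0 < wt x" "p z = 0" "\<And>x. x \<in> V \<Longrightarrow> 0 \<le> p x" "\<And>x. x \<in> V \<Longrightarrow> p x + wt x \<le> A"
    "\<And>x y. x \<in> V \<Longrightarrow> y \<in> V \<Longrightarrow> x \<noteq> y \<Longrightarrow> p x + wt x \<le> p y \<or> p y + wt y \<le> p x"
    "\<And>x. x \<in> V \<Longrightarrow> \<exists>y. adj x y \<and> (p y = p x + wt x \<or> y = z \<and> A = p x + wt x)"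
    "\<And>y. y \<in> V \<Longrightarrow> \<exists>x. adj x y \<and> (p y = p x + wt x \<or> y = z \<and> A = p x + wt x)"
    "\<And>j K x w y. K \<in> regions (n j) \<Longrightarrow> x \<in> K \<Longrightarrow> y \<in> K \<Longrightarrow> w \<in> V \<Longrightarrow> p x < p w \<Longrightarrow> p w < p y \<Longrightarrow> w \<in> K"
    "\<And>j K. K \<in> regions (n j) \<Longrightarrow> \<exists>e\<in>K. \<forall>x\<in>K. p x \<le> p e"
    "\<And>j K. K \<in> regions (n j) \<Longrightarrow> \<exists>e\<in>K. \<forall>x\<in>K. p e \<le> p x"
    "\<And>\<epsilon>. 0 < \<epsilon> \<Longrightarrow> \<exists>J. \<forall>j\<ge>J. \<forall>K\<in>regions (n j). \<forall>x\<in>K. \<forall>y\<in>K. p y - p x < \<epsilon>"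
proof -
  define idx where "idx = to_nat_on V"
  define wt :: "'a \<Rightarrow> real" where "wt = (\<lambda>x. (1/2) ^ Suc (idx x))"
  have wt_pos: "0 < wt x" for x by (simp add: wt_def)
  have inj: "inj_on idx F" if "F \<subseteq> V" for F
    using inj_on_to_nat_on[OF countable_V] that unfolding idx_def by (rule inj_on_subset)
  have geom: "sum wt F \<le> (1/2) ^ N" if "finite F" "F \<subseteq> V" "\<And>x. x \<in> F \<Longrightarrow> N \<le> idx x" for F N
    unfolding wt_def using sum_half_powers_le[OF that(1) inj[OF that(2)] that(3)] .
  define l where "l = (\<lambda>k. z # c k)"
  have dl: "distinct (l k)" and lV: "set (l k) \<subseteq> V" for k
    using cyc[of k] cV[of k] z_in_V by (auto simp: l_def cyc_def)
  \<comment> \<open>The value at \<open>None\<close> is the total weight, so that a single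
    subsequence makes the total converge together with all positions.\<close>
  define f where "f = (\<lambda>k. case_option (sum_list (map wt (l k))) (pos wt (l k)))"
  have total_le: "sum_list (map wt (l k)) \<le> 1" for k
    using geom[of "set (l k)" 0] lV[of k] sum_list_distinct_conv_sum_set[OF dl[of k], of wt] by simp
  have pos_le: "pos wt (l k) x \<le> 1" for k x
  proof -
    have "sum_list (map wt (l k)) = sum_list (map wt (takeWhile (\<lambda>y. y \<noteq> x) (l k) @ dropWhile (\<lambda>y. y \<noteq> x) (l k)))"
      by simp
    hence "pos wt (l k) x \<le> sum_list (map wt (l k))"
      using sum_list_map_nonneg[of wt "dropWhile (\<lambda>y. y \<noteq> x) (l k)"] wt_pos unfolding pos_def map_append sum_list_append
      by simp
    thus ?thesis using total_le[of k] by simp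
  qed
  have "countable (insert None (Some ` V))" using countable_V by auto
  moreover have "norm (f k x) \<le> 1" for k x
  proof (cases x)
    case None
    thus ?thesis using total_le[of k] sum_list_map_nonneg[of wt "l k"] wt_pos by (simp add: f_def)
  next
    case (Some y)
    thus ?thesis using pos_le[of k y] pos_nonneg[of wt, OF wt_pos dl[of k], of y] by (simp add: f_def)
  qed
  ultimately obtain \<sigma> where \<sigma>: "strict_mono \<sigma>"
    "\<And>x. x \<in> insert None (Some ` V) \<Longrightarrow> \<exists>a. (\<lambda>k. f (\<sigma> k) x) \<longlonglongrightarrow> a"
    using function_convergent_subsequence[of "insert None (Some ` V)" f 1] by blast
  define q where "q = (\<lambda>k. pos wt (l (\<sigma> k)))"
  define T where "T = (\<lambda>k. sum_list (map wt (l (\<sigma> k))))"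
  obtain A where A: "T \<longlonglongrightarrow> A" using \<sigma>(2)[of None] by (auto simp: f_def T_def)
  have "\<exists>a. (\<lambda>k. q k x) \<longlonglongrightarrow> a" if "x \<in> V" for x
    using \<sigma>(2)[of "Some x"] that by (auto simp: f_def q_def)
  then obtain p where p: "\<And>x. x \<in> V \<Longrightarrow> (\<lambda>k. q k x) \<longlonglongrightarrow> p x" by metis
  have ge_\<sigma>: "k \<le> \<sigma> k" for k using \<sigma>(1) by (rule seq_suble)
  have ge_n: "k \<le> n k" for k using mono by (rule seq_suble)
  have mem: "eventually (\<lambda>k. x \<in> set (l (\<sigma> k))) sequentially" if "x \<in> V" for x
    unfolding eventually_sequentially
  proof (intro exI allI impI)
    fix k assume "lev x \<le> k"
    hence "lev x \<le> n (\<sigma> k)" using ge_\<sigma>[of k] ge_n[of "\<sigma> k"] by linarith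
    thus "x \<in> set (l (\<sigma> k))" using tame[of "\<sigma> k" "\<sigma> k"] that by (auto simp: tame_def l_def)
  qed
  have crossK: "eventually (\<lambda>k. cyc_crossings K z (c (\<sigma> k)) \<le> 2 \<and> K \<inter> set (l (\<sigma> k)) \<noteq> {}) sequentially"
    if "K \<in> regions (n j)" for K j
    unfolding eventually_sequentially
  proof (intro exI allI impI)
    fix k assume "j \<le> k"
    hence "j \<le> \<sigma> k" using ge_\<sigma>[of k] by linarith
    thus "cyc_crossings K z (c (\<sigma> k)) \<le> 2 \<and> K \<inter> set (l (\<sigma> k)) \<noteq> {}"
      using tame[of j "\<sigma> k"] that by (auto simp: tame_def l_def)
  qed
  have KV: "K \<subseteq> V" if "K \<in> regions (n j)" for K j using region_subset[OF that] by auto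
  have zK: "z \<notin> K" if "K \<in> regions (n j)" for K j using z_notin_regions[OF n2 that] .
  have less: "eventually (\<lambda>k. q k x + d < q k y) sequentially" if "x \<in> V" "y \<in> V" "p x + d < p y" for x y d
  proof -
    have "(\<lambda>k. q k y - (q k x + d)) \<longlonglongrightarrow> p y - (p x + d)" using that p by (intro tendsto_intros) auto
    hence "eventually (\<lambda>k. 0 < q k y - (q k x + d)) sequentially"
      using that by (intro order_tendstoD(1)[where y = "p y - (p x + d)"]) auto
    thus ?thesis by (rule eventually_mono) auto
  qed
  show ?thesis
  proof (rule that[of wt p A])
    show "0 < wt x" for x by (rule wt_pos)
    have "(\<lambda>k. q k z) = (\<lambda>k. 0)" unfolding q_def l_def using pos_z[of wt, OF wt_pos cyc] by auto
    thus "p z = 0" using p[OF z_in_V] LIMSEQ_unique[OF _ tendsto_const] by metis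
    show "0 \<le> p x" if "x \<in> V" for x
      using p[OF that] by (rule LIMSEQ_le_const) (auto simp: q_def intro: pos_nonneg[of wt, OF wt_pos dl])
    show "p x + wt x \<le> A" if x: "x \<in> V" for x
    proof (rule tendsto_le[OF sequentially_bot A])
      show "(\<lambda>k. q k x + wt x) \<longlonglongrightarrow> p x + wt x" using p[OF x] by (intro tendsto_intros)
      show "eventually (\<lambda>k. q k x + wt x \<le> T k) sequentially"
        using mem[OF x] by (rule eventually_mono) (auto simp: q_def T_def intro: pos_le_total[of wt, OF wt_pos dl])
    qed
    show "p x + wt x \<le> p y \<or> p y + wt y \<le> p x" if xy: "x \<in> V" "y \<in> V" "x \<noteq> y" for x y
    proof (rule ccontr)
      assume neg: "\<not> ?thesis"
      have lims: "(\<lambda>k. q k x + wt x - q k y) \<longlonglongrightarrow> p x + wt x - p y"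
        "(\<lambda>k. q k y + wt y - q k x) \<longlonglongrightarrow> p y + wt y - p x" using xy p by (auto intro!: tendsto_intros)
      hence "eventually (\<lambda>k. 0 < q k x + wt x - q k y) sequentially"
        "eventually (\<lambda>k. 0 < q k y + wt y - q k x) sequentially"
        using order_tendstoD(1)[OF lims(1), of 0] order_tendstoD(1)[OF lims(2), of 0] neg by auto
      with mem[OF xy(1)] mem[OF xy(2)]
      have "eventually (\<lambda>k. x \<in> set (l (\<sigma> k)) \<and> y \<in> set (l (\<sigma> k)) \<and>
          0 < q k x + wt x - q k y \<and> 0 < q k y + wt y - q k x) sequentially"
        by eventually_elim auto
      then obtain k where "x \<in> set (l (\<sigma> k))" "y \<in> set (l (\<sigma> k))"
          "0 < q k x + wt x - q k y" "0 < q k y + wt y - q k x"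
        using eventually_happens'[OF sequentially_bot] by blast
      thus False using pos_order[of wt, OF wt_pos dl[of "\<sigma> k"], of x y] xy(3) by (auto simp: q_def)
    qed
    show "\<exists>y. adj x y \<and> (p y = p x + wt x \<or> y = z \<and> A = p x + wt x)" if x: "x \<in> V" for x
    proof (rule ccontr)
      assume neg: "\<not> ?thesis"
      have "eventually (\<lambda>k. q k y \<noteq> q k x + wt x \<and> (y = z \<longrightarrow> T k \<noteq> q k x + wt x)) sequentially"
        if y: "y \<in> {y. adj x y}" for y
      proof -
        have yV: "y \<in> V" using y adj_sym adj_in_V by blast
        have "eventually (\<lambda>k. q k y \<noteq> q k x + wt x) sequentially"
          using tendsto_add_const_unique[OF p[OF yV] p[OF x]] neg y by blast
        moreover have "eventually (\<lambda>k. y = z \<longrightarrow> T k \<noteq> q k x + wt x) sequentially"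
          using tendsto_add_const_unique[OF A p[OF x]] neg y by (cases "y = z") auto
        ultimately show ?thesis by eventually_elim auto
      qed
      hence "eventually (\<lambda>k. \<forall>y\<in>{y. adj x y}. q k y \<noteq> q k x + wt x \<and> (y = z \<longrightarrow> T k \<noteq> q k x + wt x)) sequentially"
        using finite_nbrs[of x] by (intro eventually_ball_finite) auto
      with mem[OF x] have "eventually (\<lambda>k. x \<in> set (l (\<sigma> k)) \<and>
          (\<forall>y\<in>{y. adj x y}. q k y \<noteq> q k x + wt x \<and> (y = z \<longrightarrow> T k \<noteq> q k x + wt x))) sequentially"
        by eventually_elim auto
      then obtain k where "x \<in> set (l (\<sigma> k))"
          "\<forall>y\<in>{y. adj x y}. q k y \<noteq> q k x + wt x \<and> (y = z \<longrightarrow> T k \<noteq> q k x + wt x)"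
        using eventually_happens'[OF sequentially_bot] by blast
      thus False using pos_succ[of wt, OF wt_pos cyc[of "\<sigma> k"], of x] unfolding q_def T_def l_def by blast
    qed
    show "\<exists>x. adj x y \<and> (p y = p x + wt x \<or> y = z \<and> A = p x + wt x)" if y: "y \<in> V" for y
    proof (rule ccontr)
      assume neg: "\<not> ?thesis"
      have "eventually (\<lambda>k. q k y \<noteq> q k x + wt x \<and> (y = z \<longrightarrow> T k \<noteq> q k x + wt x)) sequentially"
        if x: "x \<in> {x. adj y x}" for x
      proof -
        have xV: "x \<in> V" "adj x y" using x adj_sym adj_in_V by blast+
        have "eventually (\<lambda>k. q k y \<noteq> q k x + wt x) sequentially"
          using tendsto_add_const_unique[OF p[OF y] p[OF xV(1)]] neg xV by blast
        moreover have "eventually (\<lambda>k. y = z \<longrightarrow> T k \<noteq> q k x + wt x) sequentially"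
          using tendsto_add_const_unique[OF A p[OF xV(1)]] neg xV by (cases "y = z") auto
        ultimately show ?thesis by eventually_elim auto
      qed
      hence "eventually (\<lambda>k. \<forall>x\<in>{x. adj y x}. q k y \<noteq> q k x + wt x \<and> (y = z \<longrightarrow> T k \<noteq> q k x + wt x)) sequentially"
        using finite_nbrs[of y] by (intro eventually_ball_finite) auto
      with mem[OF y] have "eventually (\<lambda>k. y \<in> set (l (\<sigma> k)) \<and>
          (\<forall>x\<in>{x. adj y x}. q k y \<noteq> q k x + wt x \<and> (y = z \<longrightarrow> T k \<noteq> q k x + wt x))) sequentially"
        by eventually_elim auto
      then obtain k where k: "y \<in> set (l (\<sigma> k))"
          "\<forall>x\<in>{x. adj y x}. q k y \<noteq> q k x + wt x \<and> (y = z \<longrightarrow> T k \<noteq> q k x + wt x)"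
        using eventually_happens'[OF sequentially_bot] by blast
      from pos_pred[of wt, OF wt_pos cyc[of "\<sigma> k"], of y] k(1) obtain x where
        "adj x y" "q k y = q k x + wt x \<or> y = z \<and> T k = q k x + wt x"
        unfolding q_def T_def l_def by blast
      thus False using k(2) adj_sym by blast
    qed
    show "w \<in> K" if K: "K \<in> regions (n j)" and xy: "x \<in> K" "y \<in> K" "w \<in> V" "p x < p w" "p w < p y" for j K x w y
    proof -
      have V: "x \<in> V" "y \<in> V" using KV[OF K] xy by auto
      have "eventually (\<lambda>k. q k x < q k w) sequentially" "eventually (\<lambda>k. q k w < q k y) sequentially"
        using less[of x w 0] less[of w y 0] V xy by auto
      with mem[OF V(1)] mem[OF V(2)] mem[OF xy(3)] crossK[OF K]
      have "eventually (\<lambda>k. w \<in> K) sequentially"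
      proof eventually_elim
        case (elim k)
        show ?case
          by (rule pos_convex[of wt, OF wt_pos cyc[of "\<sigma> k"] zK[OF K], of x y w])
            (use elim xy in \<open>auto simp: q_def l_def\<close>)
      qed
      thus ?thesis by simp
    qed
    show "\<exists>e\<in>K. \<forall>x\<in>K. p x \<le> p e" if K: "K \<in> regions (n j)" for j K
    proof (rule ccontr)
      assume neg: "\<not> ?thesis"
      have "eventually (\<lambda>k. \<exists>x\<in>K \<inter> set (l (\<sigma> k)). q k e < q k x) sequentially" if e: "e \<in> K \<inter> rim (n j)" for e
      proof -
        obtain x where x: "x \<in> K" "p e < p x" using neg e by (auto simp: not_le)
        hence "eventually (\<lambda>k. q k e < q k x) sequentially" using less[of e x 0] KV[OF K] e by auto
        moreover have "eventually (\<lambda>k. x \<in> set (l (\<sigma> k))) sequentially" using mem KV[OF K] x by auto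
        ultimately show ?thesis by eventually_elim (use x in auto)
      qed
      hence "eventually (\<lambda>k. \<forall>e\<in>K \<inter> rim (n j). \<exists>x\<in>K \<inter> set (l (\<sigma> k)). q k e < q k x) sequentially"
        using finite_rim by (intro eventually_ball_finite) auto
      with crossK[OF K] have "eventually (\<lambda>k. K \<inter> set (l (\<sigma> k)) \<noteq> {} \<and>
          (\<forall>e\<in>K \<inter> rim (n j). \<exists>x\<in>K \<inter> set (l (\<sigma> k)). q k e < q k x)) sequentially"
        by eventually_elim auto
      then obtain k where k: "K \<inter> set (l (\<sigma> k)) \<noteq> {}"
          "\<forall>e\<in>K \<inter> rim (n j). \<exists>x\<in>K \<inter> set (l (\<sigma> k)). q k e < q k x"
        using eventually_happens'[OF sequentially_bot] by blast
      from region_last[of wt, OF wt_pos cyc[of "\<sigma> k"] n2 K] k(1) obtain e where e: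
        "e \<in> K \<inter> rim (n j)" "\<forall>x\<in>K \<inter> set (l (\<sigma> k)). q k x \<le> q k e" unfolding q_def l_def by blast
      thus False using k(2) by (meson not_le)
    qed
    show "\<exists>e\<in>K. \<forall>x\<in>K. p e \<le> p x" if K: "K \<in> regions (n j)" for j K
    proof (rule ccontr)
      assume neg: "\<not> ?thesis"
      have "eventually (\<lambda>k. \<exists>x\<in>K \<inter> set (l (\<sigma> k)). q k x < q k e) sequentially" if e: "e \<in> K \<inter> rim (n j)" for e
      proof -
        obtain x where x: "x \<in> K" "p x < p e" using neg e by (auto simp: not_le)
        hence "eventually (\<lambda>k. q k x < q k e) sequentially" using less[of x e 0] KV[OF K] e by auto
        moreover have "eventually (\<lambda>k. x \<in> set (l (\<sigma> k))) sequentially" using mem KV[OF K] x by auto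
        ultimately show ?thesis by eventually_elim (use x in auto)
      qed
      hence "eventually (\<lambda>k. \<forall>e\<in>K \<inter> rim (n j). \<exists>x\<in>K \<inter> set (l (\<sigma> k)). q k x < q k e) sequentially"
        using finite_rim by (intro eventually_ball_finite) auto
      with crossK[OF K] have "eventually (\<lambda>k. K \<inter> set (l (\<sigma> k)) \<noteq> {} \<and>
          (\<forall>e\<in>K \<inter> rim (n j). \<exists>x\<in>K \<inter> set (l (\<sigma> k)). q k x < q k e)) sequentially"
        by eventually_elim auto
      then obtain k where k: "K \<inter> set (l (\<sigma> k)) \<noteq> {}"
          "\<forall>e\<in>K \<inter> rim (n j). \<exists>x\<in>K \<inter> set (l (\<sigma> k)). q k x < q k e"
        using eventually_happens'[OF sequentially_bot] by blast
      from region_first[of wt, OF wt_pos cyc[of "\<sigma> k"] n2 K] k(1) obtain e where e: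
        "e \<in> K \<inter> rim (n j)" "\<forall>x\<in>K \<inter> set (l (\<sigma> k)). q k e \<le> q k x" unfolding q_def l_def by blast
      thus False using k(2) by (meson not_le)
    qed
    show "\<exists>J. \<forall>j\<ge>J. \<forall>K\<in>regions (n j). \<forall>x\<in>K. \<forall>y\<in>K. p y - p x < \<epsilon>" if "0 < \<epsilon>" for \<epsilon> :: real
    proof -
      obtain N where N: "(1/2) ^ N < \<epsilon>" using real_arch_pow_inv[OF \<open>0 < \<epsilon>\<close>, of "1/2"] by auto
      have fin: "finite {x \<in> V. idx x < N}"
      proof -
        have "finite (idx ` {x \<in> V. idx x < N})" by (rule finite_subset[of _ "{..<N}"]) auto
        thus ?thesis using finite_imageD inj[of "{x \<in> V. idx x < N}"] by blast
      qed
      \<comment> \<open>For \<open>j\<close> from \<open>J\<close> on, all vertices of index below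
        \<open>N\<close> are inside stage \<open>n j\<close>, so any finite part of a region has
        weight at most \<open>(1/2) ^ N\<close>.\<close>
      define J where "J = Max (insert 0 (lev ` {x \<in> V. idx x < N})) + 2"
      have far: "N \<le> idx x" if "J \<le> j" "K \<in> regions (n j)" "x \<in> K" for j K x
      proof (rule ccontr)
        assume "\<not> N \<le> idx x"
        moreover have x: "x \<in> V - inside (n j)" using region_subset[OF that(2)] that by auto
        ultimately have "lev x \<le> Max (insert 0 (lev ` {x \<in> V. idx x < N}))" using fin by (intro Max_ge) auto
        hence "lev x + 2 \<le> n j" using that(1) ge_n[of j] unfolding J_def by linarith
        thus False using inside_if_lev[of x "n j"] x by auto
      qed
      have "p y - p x < \<epsilon>" if j: "J \<le> j" "K \<in> regions (n j)" and xy: "x \<in> K" "y \<in> K" for j K x y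
      proof -
        have V: "x \<in> V" "y \<in> V" using KV[OF j(2)] xy by auto
        have "p y - p x \<le> (1/2) ^ N"
        proof (rule tendsto_upperbound[OF _ _ sequentially_bot])
          show "(\<lambda>k. q k y - q k x) \<longlonglongrightarrow> p y - p x" using p V by (intro tendsto_intros) auto
          from mem[OF V(1)] mem[OF V(2)] crossK[OF j(2)]
          show "eventually (\<lambda>k. q k y - q k x \<le> (1/2) ^ N) sequentially"
          proof eventually_elim
            case (elim k)
            have "q k y - q k x \<le> sum wt (K \<inter> set (l (\<sigma> k)))"
              unfolding q_def l_def
              by (rule pos_diff_le[of wt, OF wt_pos cyc zK[OF j(2)]]) (use elim xy in \<open>auto simp: l_def\<close>)
            also have "\<dots> \<le> (1/2) ^ N" using lV far[OF j] by (intro geom) auto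
            finally show ?case .
          qed
        qed
        thus ?thesis using N by simp
      qed
      thus ?thesis by blast
    qed
  qed
qed

end

section \<open>Components and ends\<close>

lemma linked_refl [simp]: "linked E x x"
  by (simp add: linked_def)

lemma linked_trans: "linked E x y \<Longrightarrow> linked E y w \<Longrightarrow> linked E x w"
  unfolding linked_def by (rule rtrancl_trans)

lemma linked_edge: "{x, y} \<in> E \<Longrightarrow> linked E x y"
  unfolding linked_def by auto

lemma linked_sym: "linked E x y \<Longrightarrow> linked E y x"
proof -
  have "sym {(x, y). {x, y} \<in> E}" by (auto simp: sym_def insert_commute)
  thus "linked E x y \<Longrightarrow> linked E y x" unfolding linked_def using sym_rtrancl by (meson symD)
qed

lemma linked_mono: "linked E x y \<Longrightarrow> E \<subseteq> E' \<Longrightarrow> linked E' x y"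
  unfolding linked_def by (erule rtrancl_mono[THEN subsetD, rotated]) auto

lemma graph_component_iff:
  "C \<in> graph_components X F \<longleftrightarrow> (\<exists>a\<in>X. C = {y \<in> X. linked F a y})"
  unfolding graph_components_def quotient_def by auto

lemma component_subset: "C \<in> graph_components X F \<Longrightarrow> C \<subseteq> X"
  by (auto simp: graph_component_iff)

lemma component_linked: "C \<in> graph_components X F \<Longrightarrow> x \<in> C \<Longrightarrow> y \<in> C \<Longrightarrow> linked F x y"
  using linked_sym linked_trans by (fastforce simp: graph_component_iff)

lemma component_closed:
  "C \<in> graph_components X F \<Longrightarrow> x \<in> C \<Longrightarrow> y \<in> X \<Longrightarrow> linked F x y \<Longrightarrow> y \<in> C"
  using linked_trans by (fastforce simp: graph_component_iff)

lemma component_ex: "x \<in> X \<Longrightarrow> \<exists>C\<in>graph_components X F. x \<in> C"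
  by (intro bexI[of _ "{y \<in> X. linked F x y}"]) (auto simp: graph_component_iff)

lemma component_disjoint:
  assumes "C \<in> graph_components X F" "C' \<in> graph_components X F" "x \<in> C" "x \<in> C'"
  shows "C = C'"
proof -
  have "C \<subseteq> C'" if "C \<in> graph_components X F" "C' \<in> graph_components X F" "x \<in> C" "x \<in> C'" for C C'
    using component_closed[OF that(2,4)] component_linked[OF that(1,3)] component_subset[OF that(1)] by blast
  thus ?thesis using assms by blast
qed

lemma ray_avoids_finite:
  assumes "ray V E r" "finite S"
  shows "\<exists>N. \<forall>m\<ge>N. r m \<notin> S"
proof -
  have "finite (r -` S)" using assms by (intro finite_vimageI) (auto simp: ray_def)
  then obtain N where "\<forall>m\<in>r -` S. m < N" using finite_nat_set_iff_bounded by blast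
  hence "r m \<notin> S" if "m \<ge> N" for m using that by (meson not_le vimageI)
  thus ?thesis by blast
qed

lemma ray_linked:
  assumes "ray V E r" "\<And>m. m \<ge> N \<Longrightarrow> r m \<notin> S" "N \<le> m"
  shows "linked (induced_edges E (V - S)) (r N) (r m)"
  using assms(3)
proof (induction m rule: dec_induct)
  case (step m)
  have "{r m, r (Suc m)} \<in> induced_edges E (V - S)"
    using assms(1,2) step by (auto simp: ray_def induced_edges_def)
  thus ?case using step linked_edge linked_trans by metis
qed simp

lemma ray_tail_component:
  assumes "ray V E r" "finite S"
  shows "\<exists>C\<in>graph_components (V - S) (induced_edges E (V - S)). \<exists>N. \<forall>m\<ge>N. r m \<in> C"
proof -
  obtain N where N: "\<And>m. m \<ge> N \<Longrightarrow> r m \<notin> S" using ray_avoids_finite[OF assms] by blast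
  have V: "r m \<in> V" for m using assms by (auto simp: ray_def)
  have "r N \<in> V - S" using N V by auto
  from component_ex[OF this] obtain C where
    C: "C \<in> graph_components (V - S) (induced_edges E (V - S))" "r N \<in> C" by metis
  have "r m \<in> C" if "m \<ge> N" for m
    using component_closed[OF C _ ray_linked[OF assms(1) N that]] N[OF that] V by auto
  hence "\<exists>N. \<forall>m\<ge>N. r m \<in> C" by blast
  thus ?thesis using C(1) by (intro bexI)
qed

lemma ray_equiv_refl:
  assumes "ray V E r"
  shows "(r, r) \<in> ray_equiv V E"
proof -
  have "\<not> separates V E S (range r) (range r)" if S: "finite S" for S
  proof -
    obtain N where "r N \<notin> S" using ray_avoids_finite[OF assms S] by blast
    thus ?thesis unfolding separates_def using linked_refl by (metis DiffI rangeI)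
  qed
  thus ?thesis using assms by (auto simp: ray_equiv_def)
qed

text \<open>\<open>S\<close> is enlarged by initial pieces of both rays. A path avoiding the larger
  set joins a vertex of \<open>r\<close> in \<open>C\<close> to a vertex of \<open>s\<close> from
  which on \<open>s\<close> avoids \<open>S\<close>, and the rest of \<open>s\<close> stays in the
  same component.\<close>

lemma ray_equiv_tail:
  assumes rs: "(r, s) \<in> ray_equiv V E" and S: "finite S" "S \<subseteq> V"
    and C: "C \<in> graph_components (V - S) (induced_edges E (V - S))" and r: "\<exists>N. \<forall>m\<ge>N. r m \<in> C"
  shows "\<exists>N. \<forall>m\<ge>N. s m \<in> C"
proof -
  have rays: "ray V E r" "ray V E s" using rs by (auto simp: ray_equiv_def)
  have V: "r m \<in> V" "s m \<in> V" for m using rays by (auto simp: ray_def)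
  obtain N where N: "\<And>m. m \<ge> N \<Longrightarrow> r m \<in> C" using r by blast
  obtain M where M: "\<And>m. m \<ge> M \<Longrightarrow> s m \<notin> S" using ray_avoids_finite[OF rays(2) S(1)] by blast
  define S' where "S' = S \<union> r ` {..<N} \<union> s ` {..<M}"
  have "finite S'" "S' \<subseteq> V" using S V by (auto simp: S'_def)
  hence "\<not> separates V E S' (range r) (range s)" using rs by (auto simp: ray_equiv_def)
  then obtain i j where ij: "r i \<notin> S'" "s j \<notin> S'" "linked (induced_edges E (V - S')) (r i) (s j)"
    unfolding separates_def by auto
  have "N \<le> i" "M \<le> j" using ij by (force simp: S'_def not_less[symmetric])+
  have "linked (induced_edges E (V - S)) (r i) (s j)"
    using ij(3) by (rule linked_mono) (auto simp: induced_edges_def S'_def)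
  hence sj: "s j \<in> C" using component_closed[OF C N[OF \<open>N \<le> i\<close>]] M[OF \<open>M \<le> j\<close>] V by auto
  have "s m \<in> C" if "m \<ge> j" for m
  proof (rule component_closed[OF C sj])
    show "s m \<in> V - S" using M[of m] \<open>M \<le> j\<close> that V by auto
    show "linked (induced_edges E (V - S)) (s j) (s m)"
      using ray_linked[OF rays(2) _ that] M \<open>M \<le> j\<close> by auto
  qed
  thus ?thesis by blast
qed

definition end_of :: "'a set \<Rightarrow> 'a set set \<Rightarrow> (nat \<Rightarrow> 'a) \<Rightarrow> (nat \<Rightarrow> 'a) set" where
  "end_of V E r = ray_equiv V E `` {r}"

lemma ends_iff: "\<omega> \<in> ends V E \<longleftrightarrow> (\<exists>r. ray V E r \<and> \<omega> = end_of V E r)"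
  by (auto simp: ends_def quotient_def end_of_def)

lemma end_of_self: "ray V E r \<Longrightarrow> r \<in> end_of V E r"
  using ray_equiv_refl by (auto simp: end_of_def)

lemma lives_in_end_of_iff:
  assumes "ray V E r" "finite S" "S \<subseteq> V" "C \<in> graph_components (V - S) (induced_edges E (V - S))"
  shows "lives_in (end_of V E r) C \<longleftrightarrow> (\<exists>N. \<forall>m\<ge>N. r m \<in> C)"
  using ray_equiv_tail[OF _ assms(2-4)] end_of_self[OF assms(1)]
  unfolding lives_in_def end_of_def by blast

section \<open>Open sets of the Freudenthal compactification\<close>

definition edge_coords :: "'a \<Rightarrow> 'a \<Rightarrow> real \<Rightarrow> 'a \<Rightarrow> real" where
  "edge_coords u v t x = (if x = u then 1 - t else if x = v then t else 0)"

lemma edge_point_eq: "edge_point u v t = Complex_Point (edge_coords u v t)"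
  by (simp add: edge_point_def edge_coords_def fun_eq_iff)

lemma vertex_point_eq: "vertex_point u = edge_point u v 0"
  by (auto simp: vertex_point_def edge_point_def fun_eq_iff)

lemma edge_point_1: "u \<noteq> v \<Longrightarrow> edge_point u v 1 = vertex_point v"
  by (auto simp: vertex_point_def edge_point_def fun_eq_iff)

lemma edge_coords_flip: "u \<noteq> v \<Longrightarrow> edge_coords u v t = edge_coords v u (1 - t)"
  by (auto simp: edge_coords_def fun_eq_iff)

lemma continuous_edge_coords: "continuous_on X (\<lambda>t. edge_coords u v t x)"
  by (cases "x = u"; cases "x = v") (auto simp: edge_coords_def intro!: continuous_intros)

definition complex_set :: "'a set \<Rightarrow> 'a set set \<Rightarrow> (('a \<Rightarrow> real) \<Rightarrow> bool) \<Rightarrow> 'a freudenthal_point set" where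
  "complex_set V E P = {Complex_Point h | h. Complex_Point h \<in> one_complex V E \<and> P h}"

lemma Complex_Point_in_complex_set [simp]:
  "Complex_Point h \<in> complex_set V E P \<longleftrightarrow> Complex_Point h \<in> one_complex V E \<and> P h"
  by (auto simp: complex_set_def)

lemma End_Point_notin_complex_set [simp]: "End_Point \<omega> \<notin> complex_set V E P"
  by (auto simp: complex_set_def)

lemma open_in_complex_set:
  assumes "\<And>u v. {u, v} \<in> E \<Longrightarrow> openin (top_of_set {0..1}) {t \<in> {0..1}. P (edge_coords u v t)}"
  shows "open_in_complex V E (complex_set V E P)"
  unfolding open_in_complex_def
proof (intro conjI allI impI)
  show "complex_set V E P \<subseteq> one_complex V E" by (auto simp: complex_set_def)
  fix u v assume uv: "{u, v} \<in> E"
  have "{t \<in> {0..1}. edge_point u v t \<in> complex_set V E P} = {t \<in> {0..1}. P (edge_coords u v t)}"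
    using uv unfolding edge_point_eq by (fastforce simp: one_complex_def edge_point_eq)
  thus "openin (top_of_set {0..1}) {t \<in> {0..1}. edge_point u v t \<in> complex_set V E P}"
    using assms[OF uv] by simp
qed

lemma openin_preimage_real:
  assumes "continuous_on X f" "open T"
  shows "openin (top_of_set X) {t \<in> X. f t \<in> T}"
proof -
  have "{t \<in> X. f t \<in> T} = X \<inter> f -` T" by auto
  thus ?thesis using continuous_openin_preimage_gen[OF assms] by simp
qed

lemma open_in_complex_less:
  fixes F :: "('a \<Rightarrow> real) \<Rightarrow> real"
  assumes "\<And>u v. continuous_on {0..1} (\<lambda>t. F (edge_coords u v t))"
  shows "open_in_complex V E (complex_set V E (\<lambda>h. F h < c))"
    and "open_in_complex V E (complex_set V E (\<lambda>h. c < F h))"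
  using openin_preimage_real[OF assms, of "{..<c}"] openin_preimage_real[OF assms, of "{c<..}"]
  by (auto intro!: open_in_complex_set)

lemma openin_freudenthal_complex: "open_in_complex V E U \<Longrightarrow> openin (freudenthal V E) U"
  unfolding freudenthal_def by (rule topology_generated_by_Basis) auto

lemma openin_freudenthal_end_nbhd:
  "S \<subseteq> V \<Longrightarrow> finite S \<Longrightarrow> C \<in> graph_components (V - S) (induced_edges E (V - S)) \<Longrightarrow>
   \<omega> \<in> ends V E \<Longrightarrow> lives_in \<omega> C \<Longrightarrow> 0 < \<epsilon> \<Longrightarrow> openin (freudenthal V E) (end_nbhd V E S C \<epsilon>)"
  unfolding freudenthal_def by (rule topology_generated_by_Basis) auto

lemma End_Point_in_end_nbhd: "End_Point \<omega> \<in> end_nbhd V E S C \<epsilon> \<longleftrightarrow> \<omega> \<in> ends V E \<and> lives_in \<omega> C"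
  by (auto simp: end_nbhd_def one_complex_def vertex_point_def edge_point_def)

lemma Complex_Point_in_one_complexE [consumes 2]:
  assumes "Complex_Point h \<in> one_complex V E" "simple_graph V E"
  obtains (vertex) v where "v \<in> V" "h = (\<lambda>x. if x = v then 1 else 0)"
  | (edge) u v t where "{u, v} \<in> E" "u \<noteq> v" "u \<in> V" "v \<in> V" "0 \<le> t" "t \<le> 1" "h = edge_coords u v t"
proof -
  have "\<And>u v. {u, v} \<in> E \<Longrightarrow> u \<noteq> v \<and> u \<in> V \<and> v \<in> V"
    using assms(2) by (auto simp: simple_graph_def)
  thus ?thesis
    using assms(1) vertex edge unfolding one_complex_def edge_point_eq vertex_point_def by blast
qed

lemma edge_coords_in_one_complex:
  "{u, v} \<in> E \<Longrightarrow> 0 \<le> t \<Longrightarrow> t \<le> 1 \<Longrightarrow> Complex_Point (edge_coords u v t) \<in> one_complex V E"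
  unfolding one_complex_def edge_point_eq by blast

lemma sum_edge_coords:
  assumes "finite S" "u \<noteq> v"
  shows "sum (edge_coords u v t) S = (if u \<in> S then 1 - t else 0) + (if v \<in> S then t else 0)"
proof -
  have "edge_coords u v t x = (if x = u then 1 - t else 0) + (if x = v then t else 0)" for x
    using assms(2) by (auto simp: edge_coords_def)
  hence "sum (edge_coords u v t) S = (\<Sum>x\<in>S. if x = u then 1 - t else 0) + (\<Sum>x\<in>S. if x = v then t else 0)"
    by (simp add: sum.distrib)
  thus ?thesis using assms(1) by (simp add: sum.delta)
qed

text \<open>On an edge from \<open>C\<close> to \<open>S\<close> the mass on \<open>S\<close> is the
  distance \<open>t\<close> from the end in \<open>C\<close>. The conditions on \<open>t\<close>
  thus become a strict bound on a finite sum of coordinates, which shows openness and makes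
  separation easy.\<close>

lemma Complex_Point_in_end_nbhd:
  assumes G: "simple_graph V E" and S: "finite S" and C: "C \<in> graph_components (V - S) (induced_edges E (V - S))"
  shows "Complex_Point h \<in> end_nbhd V E S C \<epsilon> \<and> 0 < \<epsilon> \<longleftrightarrow>
    Complex_Point h \<in> one_complex V E \<and> sum h S < min \<epsilon> 1 \<and> 0 < \<epsilon> \<and> (\<exists>x\<in>C. 0 < h x)"
proof -
  have CV: "C \<subseteq> V - S" using component_subset[OF C] .
  have simple: "u \<noteq> v" "u \<in> V" "v \<in> V" if "{u, v} \<in> E" for u v
    using G that by (auto simp: simple_graph_def)
  have closed: "v \<in> C" if "{u, v} \<in> E" "u \<in> C" "v \<notin> S" for u v
    using component_closed[OF C that(2)] linked_edge[of u v "induced_edges E (V - S)"] that simple[OF that(1)] CV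
    by (auto simp: induced_edges_def)
  show ?thesis
  proof
    assume h: "Complex_Point h \<in> end_nbhd V E S C \<epsilon> \<and> 0 < \<epsilon>"
    then consider (v) c where "c \<in> C" "h = (\<lambda>x. if x = c then 1 else 0)"
      | (e) u v t where "{u, v} \<in> E" "u \<in> C" "v \<in> C" "0 \<le> t" "t \<le> 1" "h = edge_coords u v t"
      | (s) u v t where "{u, v} \<in> E" "u \<in> C" "v \<in> S" "0 < t" "t < 1" "t < \<epsilon>" "h = edge_coords u v t"
      unfolding end_nbhd_def one_complex_def edge_point_eq vertex_point_def induced_edges_def by auto
    then show "Complex_Point h \<in> one_complex V E \<and> sum h S < min \<epsilon> 1 \<and> 0 < \<epsilon> \<and> (\<exists>x\<in>C. 0 < h x)"
    proof cases
      case v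
      have "sum h S = 0" unfolding v(2) using v(1) CV S by (auto simp: sum.delta)
      moreover have "0 < h c" using v by simp
      ultimately show ?thesis using h v CV by (auto simp: one_complex_def vertex_point_def)
    next
      case e
      have "u \<notin> S" "v \<notin> S" using e CV by auto
      hence "sum h S = 0" unfolding e(6) using sum_edge_coords[OF S simple(1)[OF e(1)]] by simp
      moreover have "0 < h u \<or> 0 < h v" using e simple(1)[OF e(1)] by (auto simp: edge_coords_def)
      ultimately show ?thesis using h e by (auto simp: one_complex_def edge_point_eq)
    next
      case s
      have "u \<notin> S" using s CV by auto
      hence "sum h S = t" unfolding s(7) using s(3) sum_edge_coords[OF S simple(1)[OF s(1)]] by simp
      moreover have "0 < h u" using s by (auto simp: edge_coords_def)
      ultimately show ?thesis using h s edge_coords_in_one_complex[OF s(1)] by auto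
    qed
  next
    assume h: "Complex_Point h \<in> one_complex V E \<and> sum h S < min \<epsilon> 1 \<and> 0 < \<epsilon> \<and> (\<exists>x\<in>C. 0 < h x)"
    then obtain x where x: "x \<in> C" "0 < h x" by blast
    have key: "Complex_Point (edge_coords u v t) \<in> end_nbhd V E S C \<epsilon>"
      if uv: "{u, v} \<in> E" "u \<in> C" and t: "0 \<le> t" "t \<le> 1" and m: "sum (edge_coords u v t) S < min \<epsilon> 1" for u v t
    proof (cases "v \<in> S")
      case False
      hence "v \<in> C" using closed uv by blast
      hence "{u, v} \<in> induced_edges E C" using uv by (auto simp: induced_edges_def)
      thus ?thesis unfolding end_nbhd_def one_complex_def edge_point_eq using t by blast
    next
      case True
      have "u \<notin> S" using uv CV by auto
      hence "t < \<epsilon>" "t < 1" using m True sum_edge_coords[OF S simple(1)[OF uv(1)], of t] by auto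
      show ?thesis
      proof (cases "t = 0")
        case True
        hence "Complex_Point (edge_coords u v t) = vertex_point u"
          using vertex_point_eq[of u v] edge_point_eq[of u v 0] by simp
        thus ?thesis unfolding end_nbhd_def one_complex_def using uv by simp
      next
        case False
        hence "0 < t" using t by simp
        thus ?thesis unfolding end_nbhd_def edge_point_eq
          using uv True \<open>t < \<epsilon>\<close> \<open>t < 1\<close> by blast
      qed
    qed
    from h have "Complex_Point h \<in> one_complex V E" by simp
    from this G have "Complex_Point h \<in> end_nbhd V E S C \<epsilon>"
    proof (cases rule: Complex_Point_in_one_complexE)
      case (vertex v)
      hence "v \<in> C" using x by (auto split: if_splits)
      thus ?thesis unfolding end_nbhd_def one_complex_def using vertex by (auto simp: vertex_point_def)
    next
      case (edge u v t)
      hence "x = u \<or> x = v" using x by (auto simp: edge_coords_def split: if_splits)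
      thus ?thesis
      proof
        assume "x = u"
        thus ?thesis using key[of u v t] edge x h by auto
      next
        assume "x = v"
        hence "v \<in> C" using x by simp
        thus ?thesis using key[of v u "1 - t"] edge h edge_coords_flip[of u v t] by (auto simp: insert_commute)
      qed
    qed
    thus "Complex_Point h \<in> end_nbhd V E S C \<epsilon> \<and> 0 < \<epsilon>" using h by simp
  qed
qed

text \<open>Lets continuity at a point of the 1-complex be checked in the weak topology even when
  the given open set is a neighbourhood of ends.\<close>

lemma open_in_complex_end_nbhd:
  assumes "simple_graph V E" "finite S" "C \<in> graph_components (V - S) (induced_edges E (V - S))" "0 < \<epsilon>"
  shows "open_in_complex V E (end_nbhd V E S C \<epsilon> \<inter> range Complex_Point)"
proof -
  have "end_nbhd V E S C \<epsilon> \<inter> range Complex_Point =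
      complex_set V E (\<lambda>h. sum h S < min \<epsilon> 1 \<and> (\<exists>x\<in>C. 0 < h x))"
    using Complex_Point_in_end_nbhd[OF assms(1-3), of _ \<epsilon>] assms(4) unfolding complex_set_def by blast
  moreover have "open_in_complex V E (complex_set V E (\<lambda>h. sum h S < min \<epsilon> 1 \<and> (\<exists>x\<in>C. 0 < h x)))"
  proof (rule open_in_complex_set)
    fix u v assume "{u, v} \<in> E"
    have "{t \<in> {0..1}. sum (edge_coords u v t) S < min \<epsilon> 1 \<and> (\<exists>x\<in>C. 0 < edge_coords u v t x)} =
      {t \<in> {0..1}. sum (edge_coords u v t) S \<in> {..<min \<epsilon> 1}} \<inter>
      (\<Union>x\<in>C. {t \<in> {0..1}. edge_coords u v t x \<in> {0<..}})" by auto
    moreover have "openin (top_of_set {0..1}) \<dots>"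
    proof (rule openin_Int)
      show "openin (top_of_set {0..1}) {t \<in> {0..1}. sum (edge_coords u v t) S \<in> {..<min \<epsilon> 1}}"
        by (intro openin_preimage_real continuous_on_sum continuous_edge_coords open_lessThan)
      have "openin (top_of_set {0..1}) {t \<in> {0..1}. edge_coords u v t x \<in> {0<..}}" for x
        by (intro openin_preimage_real continuous_edge_coords open_greaterThan)
      thus "openin (top_of_set {0..1}) (\<Union>x\<in>C. {t \<in> {0..1}. edge_coords u v t x \<in> {0<..}})"
        by (intro openin_Union) blast
    qed
    ultimately show "openin (top_of_set {0..1})
        {t \<in> {0..1}. sum (edge_coords u v t) S < min \<epsilon> 1 \<and> (\<exists>x\<in>C. 0 < edge_coords u v t x)}" by simp
  qed
  ultimately show ?thesis by simp
qed

section \<open>Separation of points\<close>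

lemma separate_complex_points:
  assumes "Complex_Point h \<in> one_complex V E" "Complex_Point h' \<in> one_complex V E" "h \<noteq> h'"
  shows "\<exists>U U'. openin (freudenthal V E) U \<and> openin (freudenthal V E) U' \<and>
    Complex_Point h \<in> U \<and> Complex_Point h' \<in> U' \<and> disjnt U U'"
proof -
  have key: "\<exists>U U'. openin (freudenthal V E) U \<and> openin (freudenthal V E) U' \<and>
    Complex_Point h \<in> U \<and> Complex_Point h' \<in> U' \<and> disjnt U U'"
    if hh': "Complex_Point h \<in> one_complex V E" "Complex_Point h' \<in> one_complex V E" "h x < h' x" for h h' x
  proof -
    obtain c where c: "h x < c" "c < h' x" using dense hh'(3) by blast
    let ?U = "complex_set V E (\<lambda>h. h x < c)" and ?U' = "complex_set V E (\<lambda>h. c < h x)"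
    have "openin (freudenthal V E) ?U" "openin (freudenthal V E) ?U'"
      using open_in_complex_less[of "\<lambda>h. h x" V E c, OF continuous_edge_coords]
      by (auto intro: openin_freudenthal_complex)
    moreover have "disjnt ?U ?U'" by (auto simp: disjnt_def complex_set_def)
    ultimately show ?thesis using c hh' by (intro exI[of _ ?U] exI[of _ ?U']) auto
  qed
  obtain x where "h x \<noteq> h' x" using assms(3) by auto
  then consider "h x < h' x" | "h' x < h x" by linarith
  thus ?thesis
  proof cases
    case 1
    thus ?thesis using key[OF assms(1,2)] by blast
  next
    case 2
    from key[OF assms(2,1) this] show ?thesis by (metis disjnt_sym)
  qed
qed

text \<open>\<open>S\<close> consists of the vertices carrying the point. Its mass on
  \<open>S\<close> is 1, whereas the neighbourhood of the end with radius 1/2 only contains points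
  of mass less than 1/2 on \<open>S\<close>.\<close>

lemma separate_complex_end:
  assumes G: "simple_graph V E" and h: "Complex_Point h \<in> one_complex V E" and \<omega>: "\<omega> \<in> ends V E"
  shows "\<exists>U U'. openin (freudenthal V E) U \<and> openin (freudenthal V E) U' \<and>
    Complex_Point h \<in> U \<and> End_Point \<omega> \<in> U' \<and> disjnt U U'"
proof -
  obtain S where S: "finite S" "S \<subseteq> V" "sum h S = 1"
    using h G
  proof (cases rule: Complex_Point_in_one_complexE)
    case (vertex v)
    thus ?thesis using that[of "{v}"] by simp
  next
    case (edge u v t)
    thus ?thesis using that[of "{u, v}"] sum_edge_coords[of "{u, v}" u v t] by auto
  qed
  obtain r where r: "ray V E r" "\<omega> = end_of V E r" using \<omega> ends_iff by blast
  obtain C where C: "C \<in> graph_components (V - S) (induced_edges E (V - S))" "\<exists>N. \<forall>m\<ge>N. r m \<in> C"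
    using ray_tail_component[OF r(1) S(1)] by blast
  have lives: "lives_in \<omega> C" using lives_in_end_of_iff[OF r(1) S(1,2) C(1)] C(2) r(2) by simp
  let ?U = "complex_set V E (\<lambda>h. 1/2 < sum h S)" and ?U' = "end_nbhd V E S C (1/2)"
  have "openin (freudenthal V E) ?U"
    by (intro openin_freudenthal_complex open_in_complex_less continuous_on_sum continuous_edge_coords)
  moreover have "openin (freudenthal V E) ?U'"
    using S C \<omega> lives by (intro openin_freudenthal_end_nbhd) auto
  moreover have "disjnt ?U ?U'"
    using Complex_Point_in_end_nbhd[OF G S(1) C(1), of _ "1/2"] by (auto simp: disjnt_def complex_set_def)
  moreover have "End_Point \<omega> \<in> ?U'" using End_Point_in_end_nbhd \<omega> lives by blast
  ultimately show ?thesis using h S by (intro exI[of _ ?U] exI[of _ ?U']) auto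
qed

text \<open>A common point in the 1-complex would have positive coordinates in both components and
  so lie on an edge between them; a common end would have a ray with tails in both.\<close>

lemma separate_ends:
  assumes G: "simple_graph V E" and S: "finite S" "S \<subseteq> V" and r: "ray V E r" "ray V E s"
    and C: "C \<in> graph_components (V - S) (induced_edges E (V - S))" "\<exists>N. \<forall>m\<ge>N. r m \<in> C"
    and C': "C' \<in> graph_components (V - S) (induced_edges E (V - S))" "\<exists>N. \<forall>m\<ge>N. s m \<in> C'" and "C \<noteq> C'"
  shows "\<exists>U U'. openin (freudenthal V E) U \<and> openin (freudenthal V E) U' \<and>
    End_Point (end_of V E r) \<in> U \<and> End_Point (end_of V E s) \<in> U' \<and> disjnt U U'"
proof -
  let ?U = "end_nbhd V E S C 1" and ?U' = "end_nbhd V E S C' 1"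
  have ends: "end_of V E r \<in> ends V E" "end_of V E s \<in> ends V E" using r ends_iff by blast+
  have lives: "lives_in (end_of V E r) C" "lives_in (end_of V E s) C'"
    using lives_in_end_of_iff[OF r(1) S C(1)] lives_in_end_of_iff[OF r(2) S C'(1)] C C' by auto
  have disj: "x \<notin> C'" if "x \<in> C" for x using component_disjoint[OF C(1) C'(1)] that \<open>C \<noteq> C'\<close> by blast
  have "P \<notin> ?U'" if P: "P \<in> ?U" for P
  proof
    assume P': "P \<in> ?U'"
    show False
    proof (cases P)
      case (End_Point \<omega>)
      hence \<omega>: "\<omega> \<in> ends V E" "lives_in \<omega> C" "lives_in \<omega> C'" using P P' unfolding End_Point End_Point_in_end_nbhd by auto
      obtain r' where r': "ray V E r'" "\<omega> = end_of V E r'" using \<omega>(1) ends_iff by blast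
      obtain N N' where "\<And>m. m \<ge> N \<Longrightarrow> r' m \<in> C" "\<And>m. m \<ge> N' \<Longrightarrow> r' m \<in> C'"
        using \<omega>(2,3) end_of_self[OF r'(1)] unfolding r'(2) lives_in_def by blast
      from this(1)[of "max N N'"] this(2)[of "max N N'"] show False using disj by auto
    next
      case (Complex_Point h)
      from P P' obtain x y where xy: "x \<in> C" "0 < h x" "y \<in> C'" "0 < h y"
        and h: "Complex_Point h \<in> one_complex V E"
        using Complex_Point_in_end_nbhd[OF G S(1) C(1), of h 1] Complex_Point_in_end_nbhd[OF G S(1) C'(1), of h 1]
        unfolding Complex_Point by auto
      have neq: "x \<noteq> y" using disj xy by auto
      from h G show False
      proof (cases rule: Complex_Point_in_one_complexE)
        case (vertex v)
        thus False using xy neq by (auto split: if_splits)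
      next
        case (edge u v t)
        hence "{x, y} = {u, v}" using xy neq by (auto simp: edge_coords_def split: if_splits)
        hence "{x, y} \<in> E" using edge by simp
        moreover have "x \<in> V - S" "y \<in> V - S" using xy component_subset[OF C(1)] component_subset[OF C'(1)] by auto
        ultimately have "linked (induced_edges E (V - S)) x y" by (intro linked_edge) (auto simp: induced_edges_def)
        thus False using component_closed[OF C(1) xy(1) \<open>y \<in> V - S\<close>] disj xy by blast
      qed
    qed
  qed
  hence "disjnt ?U ?U'" by (auto simp: disjnt_def)
  moreover have "openin (freudenthal V E) ?U" "openin (freudenthal V E) ?U'"
    using openin_freudenthal_end_nbhd[OF S(2,1) C(1) ends(1) lives(1)]
      openin_freudenthal_end_nbhd[OF S(2,1) C'(1) ends(2) lives(2)] by auto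
  moreover have "End_Point (end_of V E r) \<in> ?U" "End_Point (end_of V E s) \<in> ?U'"
    using ends lives by (simp_all add: End_Point_in_end_nbhd)
  ultimately show ?thesis by (intro exI[of _ ?U] exI[of _ ?U']) simp
qed

section \<open>The limit circle\<close>

context rooted_claw_paw
begin

lemma core_antimono: "m \<le> m' \<Longrightarrow> core m' \<subseteq> core m"
  by (cases "m = m'") (auto simp: core_def)

lemma region_refines:
  assumes "m \<le> m'" "K \<in> regions m'"
  shows "\<exists>K'\<in>regions m. K \<subseteq> K'"
proof -
  obtain x where x: "x \<in> V - inside m'" "K = region m' x" using assms by (auto simp: regions_def)
  have core: "core m' \<subseteq> core m" using core_antimono[OF assms(1)] .
  have "x \<in> V - inside m" using x core unfolding inside_def rim_def by blast
  moreover have "core_rel m' \<subseteq> core_rel m" using core unfolding core_rel_def by blast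
  hence "(core_rel m')\<^sup>* \<subseteq> (core_rel m)\<^sup>*" by (rule rtrancl_mono)
  hence "K \<subseteq> region m x" using x unfolding region_def by blast
  ultimately show ?thesis using region_in_regions by blast
qed

definition up :: "('a \<times> 'a) set" where
  "up = {(x, y). adj x y \<and> lev y = Suc (lev x)}"

lemma up_from_root: "x \<in> V \<Longrightarrow> (z, x) \<in> up\<^sup>*"
proof (induction "lev x" arbitrary: x rule: less_induct)
  case less
  show ?case
  proof (cases "x = z")
    case False
    then obtain y where y: "adj x y" "lev x = Suc (lev y)" using lower_nbr less by blast
    hence "adj y x" "y \<in> V" using adj_sym adj_in_V by blast+
    hence "(z, y) \<in> up\<^sup>*" "(y, x) \<in> up" using less(1)[of y] y by (auto simp: up_def)
    thus ?thesis by (rule rtrancl_into_rtrancl)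
  qed simp
qed

text \<open>All vertices of the path have level above \<open>m\<close> and hence lie in the core, so
  no step leaves the region.\<close>

lemma up_in_region:
  assumes "(x, y) \<in> up\<^sup>*" "x \<in> V" "m < lev x" "K \<in> regions m" "y \<in> K"
  shows "x \<in> K"
  using assms
proof (induction rule: converse_rtrancl_induct)
  case (step x x')
  have x: "adj x x'" "lev x' = Suc (lev x)" using step by (auto simp: up_def)
  hence "x' \<in> V" using adj_sym adj_in_V by blast
  hence "x' \<in> K" using step x by auto
  moreover have "x \<in> core m" using step by (auto simp: core_def)
  ultimately show ?case using same_region[OF step(6) _ x(1)] by blast
qed simp

text \<open>Koenig's lemma for the geodesics from the root.\<close>

lemma ray_into_regions:
  fixes n :: "nat \<Rightarrow> nat" and R :: "nat \<Rightarrow> 'a set"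
  assumes n: "strict_mono n" and R: "\<And>j. R j \<in> regions (n j)" and dec: "\<And>i j. i \<le> j \<Longrightarrow> R j \<subseteq> R i"
  shows "\<exists>r. (\<forall>i. lev (r i) = i \<and> adj (r i) (r (Suc i))) \<and> (\<forall>j m. n j < m \<longrightarrow> r m \<in> R j)"
proof -
  define good where "good = (\<lambda>x. x \<in> V \<and> (\<forall>j. \<exists>y\<in>R j. (x, y) \<in> up\<^sup>*))"
  have RV: "R j \<subseteq> V - inside (n j)" for j using region_subset[OF R] .
  have good_z: "good z"
    unfolding good_def
  proof (intro conjI allI)
    fix j
    obtain x where "x \<in> V - inside (n j)" "R j = region (n j) x" using R[of j] by (auto simp: regions_def)
    thus "\<exists>y\<in>R j. (z, y) \<in> up\<^sup>*" using region_self[of x] up_from_root[of x] by blast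
  qed (rule z_in_V)
  have step: "\<exists>y. (x, y) \<in> up \<and> good y" if x: "good x" for x
  proof (rule ccontr)
    assume neg: "\<not> ?thesis"
    define Y where "Y = {y. (x, y) \<in> up}"
    have fin: "finite Y" unfolding Y_def up_def using finite_nbrs[of x] by (auto intro: rev_finite_subset)
    have YV: "y \<in> V" if "y \<in> Y" for y using that adj_sym adj_in_V unfolding Y_def up_def by blast
    have "\<forall>y\<in>Y. \<exists>j. \<forall>w\<in>R j. (y, w) \<notin> up\<^sup>*" using neg YV unfolding good_def Y_def by blast
    then obtain J where J: "\<And>y w. y \<in> Y \<Longrightarrow> w \<in> R (J y) \<Longrightarrow> (y, w) \<notin> up\<^sup>*" by metis
    \<comment> \<open>At \<open>j\<close> all upper neighbours of \<open>x\<close> have failed,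
      since the regions decrease. The 2 puts \<open>x\<close> itself inside the stage, so that a
      path from \<open>x\<close> to \<open>R j\<close> has a first step.\<close>
    define j where "j = Max (insert (lev x + 2) (J ` Y))"
    have jge: "lev x + 2 \<le> j" "\<And>y. y \<in> Y \<Longrightarrow> J y \<le> j" unfolding j_def using fin by auto
    obtain w where w: "w \<in> R j" "(x, w) \<in> up\<^sup>*" using x unfolding good_def by blast
    have "lev x + 2 \<le> n j" using jge(1) seq_suble[OF n, of j] by linarith
    moreover have "x \<in> V" using x by (simp add: good_def)
    ultimately have "x \<in> inside (n j)" using inside_if_lev by blast
    hence "x \<noteq> w" using RV[of j] w by blast
    then obtain y where y: "(x, y) \<in> up" "(y, w) \<in> up\<^sup>*" using w(2) by (metis converse_rtranclE)
    have "y \<in> Y" using y by (simp add: Y_def)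
    thus False using J[of y w] dec[OF jge(2)] w y by blast
  qed
  have "\<exists>r. \<forall>i. (good (r i) \<and> lev (r i) = i) \<and> (r i, r (Suc i)) \<in> up"
  proof (rule dependent_nat_choice[of "\<lambda>i x. good x \<and> lev x = i" "\<lambda>_ x y. (x, y) \<in> up"])
    show "\<exists>x. good x \<and> lev x = 0" using good_z lev_z by blast
    show "\<exists>y. (good y \<and> lev y = Suc i) \<and> (x, y) \<in> up" if "good x \<and> lev x = i" for x i
      using step[of x] that unfolding up_def by auto
  qed
  then obtain r where r: "\<And>i. good (r i)" "\<And>i. lev (r i) = i" "\<And>i. (r i, r (Suc i)) \<in> up" by blast
  have "r m \<in> R j" if m: "n j < m" for j m
  proof -
    obtain y where "y \<in> R j" "(r m, y) \<in> up\<^sup>*" "r m \<in> V" using r(1)[of m] unfolding good_def by blast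
    thus ?thesis using up_in_region[OF _ _ _ R[of j]] r(2)[of m] m by auto
  qed
  moreover have "adj (r i) (r (Suc i))" for i using r(3)[of i] by (simp add: up_def)
  ultimately show ?thesis using r(2) by blast
qed

end

section \<open>Slots of vertices and gaps on the parameter interval\<close>

locale hamilton_limit = rooted_claw_paw "\<lambda>x y. {x, y} \<in> E" V z
  for V :: "'a set" and E :: "'a set set" and z :: 'a +
  fixes n :: "nat \<Rightarrow> nat" and p wt :: "'a \<Rightarrow> real" and A :: real
  assumes simple: "simple_graph V E"
    and three: "\<exists>x y. x \<in> V \<and> y \<in> V \<and> x \<noteq> y \<and> x \<noteq> z \<and> y \<noteq> z"
    and n_mono: "strict_mono n" and n_ge_2: "2 \<le> n k"
    and wt_pos: "0 < wt x" and p_z: "p z = 0" and p_nonneg: "x \<in> V \<Longrightarrow> 0 \<le> p x"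
    and p_le: "x \<in> V \<Longrightarrow> p x + wt x \<le> A"
    and p_disjoint: "x \<in> V \<Longrightarrow> y \<in> V \<Longrightarrow> x \<noteq> y \<Longrightarrow> p x + wt x \<le> p y \<or> p y + wt y \<le> p x"
    and p_succ: "x \<in> V \<Longrightarrow> \<exists>y. {x, y} \<in> E \<and> (p y = p x + wt x \<or> y = z \<and> A = p x + wt x)"
    and p_pred: "y \<in> V \<Longrightarrow> \<exists>x. {x, y} \<in> E \<and> (p y = p x + wt x \<or> y = z \<and> A = p x + wt x)"
    and p_convex: "K \<in> regions (n j) \<Longrightarrow> x \<in> K \<Longrightarrow> y \<in> K \<Longrightarrow> w \<in> V \<Longrightarrow> p x < p w \<Longrightarrow> p w < p y \<Longrightarrow> w \<in> K"
    and p_max: "K \<in> regions (n j) \<Longrightarrow> \<exists>e\<in>K. \<forall>x\<in>K. p x \<le> p e"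
    and p_min: "K \<in> regions (n j) \<Longrightarrow> \<exists>e\<in>K. \<forall>x\<in>K. p e \<le> p x"
    and p_small: "0 < \<epsilon> \<Longrightarrow> \<exists>J. \<forall>j\<ge>J. \<forall>K\<in>regions (n j). \<forall>x\<in>K. \<forall>y\<in>K. p y - p x < \<epsilon>"
begin

lemma edge_V: "{x, y} \<in> E \<Longrightarrow> x \<in> V \<and> y \<in> V \<and> x \<noteq> y"
  using simple by (auto simp: simple_graph_def)

lemma p_less: "x \<in> V \<Longrightarrow> p x < A"
  using p_le[of x] wt_pos[of x] by linarith

lemma p_inj: "x \<in> V \<Longrightarrow> y \<in> V \<Longrightarrow> p x = p y \<Longrightarrow> x = y"
  using p_disjoint[of x y] wt_pos[of x] wt_pos[of y] by fastforce

lemma p_less_imp: "x \<in> V \<Longrightarrow> y \<in> V \<Longrightarrow> p x < p y \<Longrightarrow> p x + wt x \<le> p y"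
  using p_disjoint[of x y] wt_pos[of y] by fastforce

lemma A_pos: "0 < A"
  using p_less[OF z_in_V] p_z by simp

definition sc :: "'a \<Rightarrow> 'a" where
  "sc x = (SOME y. {x, y} \<in> E \<and> (p y = p x + wt x \<or> y = z \<and> A = p x + wt x))"

lemma sc: "x \<in> V \<Longrightarrow> {x, sc x} \<in> E \<and> (p (sc x) = p x + wt x \<or> sc x = z \<and> A = p x + wt x)"
  unfolding sc_def by (rule someI_ex[OF p_succ])

definition slot :: "'a \<Rightarrow> real \<Rightarrow> bool" where
  "slot x t \<longleftrightarrow> x \<in> V \<and> p x \<le> t \<and> t < p x + wt x"

definition gap :: "real \<Rightarrow> bool" where
  "gap t \<longleftrightarrow> 0 \<le> t \<and> t < A \<and> (\<forall>x. \<not> slot x t)"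

lemma slot_unique: "slot x t \<Longrightarrow> slot y t \<Longrightarrow> x = y"
  using p_disjoint[of x y] unfolding slot_def by fastforce

definition surrounds :: "'a set \<Rightarrow> real \<Rightarrow> bool" where
  "surrounds K t \<longleftrightarrow> (\<exists>a\<in>K. p a < t) \<and> (\<exists>b\<in>K. t < p b)"

lemma regions_V: "K \<in> regions m \<Longrightarrow> x \<in> K \<Longrightarrow> x \<in> V"
  using region_subset by blast

text \<open>Take a vertex before \<open>t\<close> from each region. The later one lies between the
  earlier one and a vertex after \<open>t\<close>, so by convexity it belongs to both
  regions.\<close>

lemma surrounds_unique:
  assumes K: "K \<in> regions (n j)" "K' \<in> regions (n j)" and t: "surrounds K t" "surrounds K' t"
  shows "K = K'"
proof -
  obtain a b a' b' where ab: "a \<in> K" "b \<in> K" "p a < t" "t < p b" "a' \<in> K'" "b' \<in> K'" "p a' < t" "t < p b'"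
    using t by (auto simp: surrounds_def)
  have V: "a \<in> V" "a' \<in> V" using ab K regions_V by blast+
  consider "p a < p a'" | "p a' < p a" | "p a = p a'" by linarith
  then obtain x where "x \<in> K" "x \<in> K'"
  proof cases
    case 1
    thus ?thesis using that p_convex[OF K(1) ab(1,2) V(2)] ab by auto
  next
    case 2
    thus ?thesis using that p_convex[OF K(2) ab(5,6) V(1)] ab by auto
  next
    case 3
    thus ?thesis using that p_inj[OF V] ab by auto
  qed
  thus ?thesis using regions_disjoint K by blast
qed

text \<open>Among the finitely many vertices inside stage \<open>j\<close> and first vertices of regions take the last one
  before the gap: following successors, it can only be the first vertex of a region around the gap.\<close>

lemma gap_surrounded:
  assumes "gap t"
  shows "\<exists>K\<in>regions (n j). surrounds K t"
proof -
  \<comment> \<open>As \<open>t\<close> is in no slot, a slot that begins before \<open>t\<close>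
    also ends by \<open>t\<close>.\<close>
  have t: "0 \<le> t" "t < A" "\<And>x. x \<in> V \<Longrightarrow> p x \<le> t \<Longrightarrow> p x + wt x \<le> t"
    using assms unfolding gap_def slot_def by force+
  define fst_of where "fst_of K = (SOME e. e \<in> K \<and> (\<forall>x\<in>K. p e \<le> p x))" for K
  have fst_of: "fst_of K \<in> K" "\<And>x. x \<in> K \<Longrightarrow> p (fst_of K) \<le> p x" if "K \<in> regions (n j)" for K
  proof -
    have "\<exists>e. e \<in> K \<and> (\<forall>x\<in>K. p e \<le> p x)" using p_min[OF that] by blast
    from someI_ex[OF this] show "fst_of K \<in> K" "\<And>x. x \<in> K \<Longrightarrow> p (fst_of K) \<le> p x"
      unfolding fst_of_def by blast+
  qed
  define Y where "Y = {x \<in> inside (n j) \<union> fst_of ` regions (n j). p x \<le> t}"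
  have insV: "x \<in> V" if "x \<in> inside (n j)" for x using that inside_lev by blast
  have YV: "x \<in> V" if "x \<in> Y" for x
    using that insV fst_of(1) regions_V unfolding Y_def by blast
  have "finite Y" unfolding Y_def using finite_inside finite_regions[OF n_ge_2] by auto
  moreover have "z \<in> Y" unfolding Y_def using inside_if_lev[OF z_in_V, of "n j"] n_ge_2[of j] p_z t by auto
  ultimately obtain x where x: "x \<in> Y" "\<And>y. y \<in> Y \<Longrightarrow> p y \<le> p x"
    using arg_min_if_finite[of Y "\<lambda>x. - p x"] by (metis empty_iff neg_less_iff_less not_le)
  have xV: "x \<in> V" "p x \<le> t" using x YV by (auto simp: Y_def)
  \<comment> \<open>A later vertex before the gap contradicts the choice of \<open>x\<close> unless
    it shares a region with \<open>x\<close>: either it is in \<open>Y\<close> itself, or the first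
    vertex of its region is, and then convexity puts \<open>x\<close> into that region.\<close>
  have next_in_Y: False if y: "y \<in> V" "p x < p y" "p y \<le> t" and nK: "\<And>K. K \<in> regions (n j) \<Longrightarrow> y \<in> K \<Longrightarrow> x \<notin> K" for y
  proof (cases "y \<in> inside (n j)")
    case True
    thus False using x(2)[of y] y by (auto simp: Y_def)
  next
    case False
    define K where "K = region (n j) y"
    have K: "K \<in> regions (n j)" "y \<in> K"
      unfolding K_def using False y region_in_regions region_self by auto
    have "fst_of K \<in> Y" using fst_of[OF K(1)] K y by (force simp: Y_def)
    hence "p (fst_of K) \<le> p x" using x by blast
    moreover have "fst_of K \<noteq> x" using fst_of(1)[OF K(1)] nK[OF K] by blast
    ultimately have "p (fst_of K) < p x"
      using p_inj[of "fst_of K" x] xV regions_V[OF K(1) fst_of(1)[OF K(1)]] by fastforce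
    hence "x \<in> K" using p_convex[OF K(1) fst_of(1)[OF K(1)] K(2) xV(1)] y by blast
    thus False using nK K by blast
  qed
  have succ_le: "p (sc y) = p y + wt y" "p (sc y) \<le> t" "sc y \<in> V" if "y \<in> V" "p y \<le> t" for y
    using sc[OF that(1)] t(2) t(3)[OF that] edge_V by auto
  show ?thesis
  proof (cases "x \<in> inside (n j)")
    case True
    have "p x < p (sc x)" using succ_le[OF xV] wt_pos[of x] by simp
    moreover have "x \<notin> K" if "K \<in> regions (n j)" for K using region_subset[OF that] True by blast
    ultimately show ?thesis using next_in_Y[of "sc x"] succ_le[OF xV] by blast
  next
    case False
    then obtain K where K: "K \<in> regions (n j)" "x = fst_of K" using x(1) by (auto simp: Y_def)
    obtain e where e: "e \<in> K" "\<And>y. y \<in> K \<Longrightarrow> p y \<le> p e" using p_max[OF K(1)] by blast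
    have xK: "x \<in> K" using K fst_of by blast
    have eV: "e \<in> V" using regions_V K e by blast
    \<comment> \<open>If the last vertex \<open>e\<close> of \<open>K\<close> came before the gap,
      so would its successor, which lies outside \<open>K\<close> and after
      \<open>x\<close>.\<close>
    have "t < p e"
    proof (rule ccontr)
      assume "\<not> t < p e"
      hence le: "p e \<le> t" by simp
      have "p e < p (sc e)" using succ_le[OF eV le] wt_pos[of e] by simp
      hence "sc e \<notin> K" using e(2)[of "sc e"] by auto
      moreover have "p x < p (sc e)" using e(2)[OF xK] \<open>p e < p (sc e)\<close> by linarith
      ultimately show False
        using next_in_Y[of "sc e"] succ_le[OF eV le] regions_disjoint[OF K(1)] xK by blast
    qed
    moreover have "p x < t" using t(3)[OF xV] wt_pos[of x] by linarith
    ultimately show ?thesis using K(1) xK e(1) unfolding surrounds_def by blast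
  qed
qed

definition gap_region :: "nat \<Rightarrow> real \<Rightarrow> 'a set" where
  "gap_region j t = (SOME K. K \<in> regions (n j) \<and> surrounds K t)"

lemma gap_region:
  assumes "gap t"
  shows "gap_region j t \<in> regions (n j)" "surrounds (gap_region j t) t"
proof -
  have "\<exists>K. K \<in> regions (n j) \<and> surrounds K t" using gap_surrounded[OF assms] by blast
  from someI_ex[OF this] show "gap_region j t \<in> regions (n j)" "surrounds (gap_region j t) t"
    unfolding gap_region_def by blast+
qed

lemma gap_region_decreasing:
  assumes "gap t" "i \<le> j"
  shows "gap_region j t \<subseteq> gap_region i t"
proof -
  have "n i \<le> n j" using n_mono assms(2) by (simp add: strict_mono_less_eq)
  then obtain K where K: "K \<in> regions (n i)" "gap_region j t \<subseteq> K"
    using region_refines gap_region(1)[OF assms(1)] by blast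
  hence "surrounds K t" using gap_region(2)[OF assms(1), of j] unfolding surrounds_def by blast
  hence "K = gap_region i t" using surrounds_unique K gap_region[OF assms(1)] by blast
  thus ?thesis using K by simp
qed

definition gap_ray :: "real \<Rightarrow> nat \<Rightarrow> 'a" where
  "gap_ray t = (SOME r. (\<forall>i. lev (r i) = i \<and> {r i, r (Suc i)} \<in> E) \<and> (\<forall>j m. n j < m \<longrightarrow> r m \<in> gap_region j t))"

lemma gap_ray:
  assumes "gap t"
  shows "ray V E (gap_ray t)" "\<And>j m. n j < m \<Longrightarrow> gap_ray t m \<in> gap_region j t" "lev (gap_ray t i) = i"
proof -
  have "\<exists>r. (\<forall>i. lev (r i) = i \<and> {r i, r (Suc i)} \<in> E) \<and> (\<forall>j m. n j < m \<longrightarrow> r m \<in> gap_region j t)"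
    by (rule ray_into_regions[OF n_mono gap_region(1)[OF assms] gap_region_decreasing[OF assms]])
  from someI_ex[OF this]
  have r: "\<And>i. lev (gap_ray t i) = i" "\<And>i. {gap_ray t i, gap_ray t (Suc i)} \<in> E"
    "\<And>j m. n j < m \<Longrightarrow> gap_ray t m \<in> gap_region j t" unfolding gap_ray_def by blast+
  have "inj (gap_ray t)" using r(1) by (metis injI)
  thus "ray V E (gap_ray t)" using r(2) edge_V by (fastforce simp: ray_def)
  show "\<And>j m. n j < m \<Longrightarrow> gap_ray t m \<in> gap_region j t" "lev (gap_ray t i) = i" using r by blast+
qed

section \<open>The parametrisation of the circle\<close>

definition point :: "real \<Rightarrow> 'a freudenthal_point" where
  "point t = (if t = A then vertex_point z
     else if gap t then End_Point (end_of V E (gap_ray t))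
     else let x = (THE x. slot x t) in edge_point x (sc x) ((t - p x) / wt x))"

lemma point_gap: "gap t \<Longrightarrow> point t = End_Point (end_of V E (gap_ray t))"
  by (auto simp: point_def gap_def)

lemma point_slot:
  assumes "slot x t"
  shows "point t = edge_point x (sc x) ((t - p x) / wt x)"
proof -
  have "(THE y. slot y t) = x" using assms slot_unique by blast
  moreover have "t \<noteq> A" using assms p_le[of x] by (auto simp: slot_def)
  moreover have "\<not> gap t" using assms by (auto simp: gap_def)
  ultimately show ?thesis by (simp add: point_def Let_def)
qed

lemma point_vertex: "x \<in> V \<Longrightarrow> point (p x) = vertex_point x"
  using point_slot[of x "p x"] wt_pos[of x] vertex_point_eq[of x "sc x"] by (simp add: slot_def)

text \<open>At its right end the formula gives the successor's vertex, which is where the next slot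
  begins, or the root if the slot ends at \<open>A\<close>.\<close>

lemma point_closed_slot:
  assumes "x \<in> V" "p x \<le> t" "t \<le> p x + wt x"
  shows "point t = edge_point x (sc x) ((t - p x) / wt x)"
proof (cases "t = p x + wt x")
  case False
  thus ?thesis using assms by (intro point_slot) (auto simp: slot_def)
next
  case True
  have "edge_point x (sc x) ((t - p x) / wt x) = vertex_point (sc x)"
    using True wt_pos[of x] edge_point_1[of x "sc x"] sc[OF assms(1)] edge_V by auto
  moreover have "point t = vertex_point (sc x)"
    using sc[OF assms(1)] True point_vertex[of "sc x"] edge_V by (auto simp: point_def)
  ultimately show ?thesis by simp
qed

lemma slot_or_gap: "0 \<le> t \<Longrightarrow> t < A \<Longrightarrow> gap t \<or> (\<exists>x. slot x t)"
  by (auto simp: gap_def)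

text \<open>For continuity from the left: where a slot begins, the slot of the predecessor ends, so
  gaps cannot accumulate there.\<close>

lemma left_slot:
  assumes "0 < t" "t \<le> A" "\<not> gap t"
  obtains x where "x \<in> V" "p x < t" "t \<le> p x + wt x"
proof (cases "t = A")
  case True
  obtain x where x: "{x, z} \<in> E" "p z = p x + wt x \<or> A = p x + wt x" using p_pred[OF z_in_V] by blast
  have "x \<in> V" using x edge_V by blast
  thus ?thesis using that[of x] x True p_z p_nonneg[of x] wt_pos[of x] by auto
next
  case False
  then obtain y where y: "slot y t" using slot_or_gap[of t] assms by auto
  show ?thesis
  proof (cases "p y = t")
    case False
    thus ?thesis using that[of y] y by (auto simp: slot_def)
  next
    case True
    hence "y \<noteq> z" using p_z assms by auto
    then obtain x where x: "{x, y} \<in> E" "p y = p x + wt x" using p_pred[of y] y by (auto simp: slot_def)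
    hence "x \<in> V" using edge_V by blast
    thus ?thesis using that[of x] x True wt_pos[of x] by auto
  qed
qed

end

section \<open>Injectivity and the Hausdorff property of the image\<close>

context hamilton_limit
begin

lemma core_rel_linked:
  assumes "(x, y) \<in> (core_rel m)\<^sup>*" "S \<subseteq> inside m"
  shows "linked (induced_edges E (V - S)) x y"
  using assms(1)
proof (induction rule: rtrancl_induct)
  case (step y w)
  have yw: "{y, w} \<in> E" "y \<in> core m \<or> w \<in> core m" using step by (auto simp: core_rel_def)
  have "y \<in> V - inside m" "w \<in> V - inside m"
    using yw core_nbr[of y m w] core_nbr[of w m y] edge_V[OF yw(1)] by (auto simp: inside_def insert_commute)
  hence "{y, w} \<in> induced_edges E (V - S)" using yw assms(2) by (auto simp: induced_edges_def)
  thus ?case using step linked_edge linked_trans by metis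
qed simp

text \<open>Outside the ball all vertices are in the core, so a path there cannot leave its region.
  With \<open>core_rel_linked\<close>, regions and the components left by finite sets are
  interleaved and distinguish the same ends.\<close>

lemma linked_same_region:
  assumes "linked (induced_edges E (V - {x \<in> V. lev x \<le> m})) x y" "K \<in> regions m" "x \<in> K"
  shows "y \<in> K"
  using assms(1) unfolding linked_def
proof (induction rule: rtrancl_induct)
  case (step y w)
  have yw: "{y, w} \<in> E" "y \<in> V" "\<not> lev y \<le> m" using step by (auto simp: induced_edges_def)
  hence "y \<in> core m" by (auto simp: core_def)
  thus ?case using same_region[OF assms(2) _ yw(1)] step by blast
qed (use assms in simp)

lemma gap_regions_differ:
  assumes "gap t" "gap t'" "t < t'"
  shows "\<exists>j. gap_region j t \<noteq> gap_region j t'"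
proof -
  obtain j where j: "\<And>K x y. K \<in> regions (n j) \<Longrightarrow> x \<in> K \<Longrightarrow> y \<in> K \<Longrightarrow> p y - p x < t' - t"
    using p_small[of "t' - t"] assms(3) by (meson diff_gt_0_iff_gt order_refl)
  have "gap_region j t \<noteq> gap_region j t'"
  proof
    assume eq: "gap_region j t = gap_region j t'"
    obtain a b where "a \<in> gap_region j t" "p a < t" "b \<in> gap_region j t" "t' < p b"
      using gap_region(2)[OF assms(1), of j] gap_region(2)[OF assms(2), of j] eq
      unfolding surrounds_def by auto
    thus False using j[OF gap_region(1)[OF assms(1)], of a b] by auto
  qed
  thus ?thesis by blast
qed

lemma separate_gaps:
  assumes "gap t" "gap t'" "t < t'"
  shows "\<exists>U U'. openin (freudenthal V E) U \<and> openin (freudenthal V E) U' \<and>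
    point t \<in> U \<and> point t' \<in> U' \<and> disjnt U U'"
proof -
  obtain j where j: "gap_region j t \<noteq> gap_region j t'" using gap_regions_differ[OF assms] by blast
  define S where "S = {x \<in> V. lev x \<le> n j}"
  have S: "finite S" "S \<subseteq> V" unfolding S_def using finite_ball by auto
  note r = gap_ray[OF assms(1)] and r' = gap_ray[OF assms(2)]
  obtain C N where C: "C \<in> graph_components (V - S) (induced_edges E (V - S))" "\<And>m. m \<ge> N \<Longrightarrow> gap_ray t m \<in> C"
    using ray_tail_component[OF r(1) S(1)] by blast
  obtain C' N' where C': "C' \<in> graph_components (V - S) (induced_edges E (V - S))" "\<And>m. m \<ge> N' \<Longrightarrow> gap_ray t' m \<in> C'"
    using ray_tail_component[OF r'(1) S(1)] by blast
  have "C \<noteq> C'"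
  proof
    assume eq: "C = C'"
    define m where "m = Suc (max (n j) (max N N'))"
    have m: "n j < m" "N \<le> m" "N' \<le> m" unfolding m_def by auto
    have "linked (induced_edges E (V - S)) (gap_ray t m) (gap_ray t' m)"
      using component_linked[OF C(1)] C(2)[OF m(2)] C'(2)[OF m(3)] eq by blast
    hence "gap_ray t' m \<in> gap_region j t"
      unfolding S_def using linked_same_region gap_region(1)[OF assms(1)] r(2)[OF m(1)] by blast
    thus False using r'(2)[OF m(1)] regions_disjoint[OF gap_region(1)[OF assms(1)] gap_region(1)[OF assms(2)]] j
      by blast
  qed
  thus ?thesis
    using separate_ends[OF simple S r(1) r'(1) C(1) _ C'(1)] C(2) C'(2)
    unfolding point_gap[OF assms(1)] point_gap[OF assms(2)] by blast
qed

lemma point_complex: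
  assumes "0 \<le> t" "t \<le> A" "\<not> gap t"
  shows "\<exists>h. point t = Complex_Point h \<and> Complex_Point h \<in> one_complex V E"
proof (cases "t = A")
  case True
  hence "point t = vertex_point z" by (simp add: point_def)
  moreover have "vertex_point z \<in> one_complex V E" using z_in_V by (auto simp: one_complex_def)
  ultimately show ?thesis by (auto simp: vertex_point_def)
next
  case False
  then obtain x where x: "slot x t" using slot_or_gap[of t] assms by auto
  hence "0 \<le> (t - p x) / wt x" "(t - p x) / wt x \<le> 1" using wt_pos[of x] by (auto simp: slot_def divide_simps)
  moreover have "{x, sc x} \<in> E" using x sc by (auto simp: slot_def)
  ultimately show ?thesis using point_slot[OF x] edge_point_eq edge_coords_in_one_complex by metis
qed

text \<open>Otherwise the edge between \<open>x\<close> and \<open>y\<close> would be run through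
  twice. Positions increase along successors except on return to the root, so one of the two is the
  root; their slots then fill the whole parameter interval and leave no room for a third
  vertex.\<close>

lemma two_slots_absurd:
  assumes "x \<in> V" "sc x = y" "sc y = x" "y \<in> V"
  shows False
proof -
  have no_z: False if "sc z = y" "sc y = z" "y \<in> V" for y
  proof -
    have y: "{z, y} \<in> E" "p y = wt z \<or> y = z \<and> A = p z + wt z" using sc[OF z_in_V] that p_z by auto
    hence py: "p y = wt z" "y \<noteq> z" using edge_V[OF y(1)] by auto
    have "p z = p y + wt y \<or> A = p y + wt y" using sc[OF that(3)] that by auto
    hence Ay: "A = p y + wt y" using p_z py wt_pos[of z] wt_pos[of y] by linarith
    obtain w where w: "w \<in> V" "w \<noteq> z" "w \<noteq> y" using three by metis
    have "p w < A" "0 \<le> p w" using p_less p_nonneg w by auto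
    thus False
      using p_disjoint[OF w(1) z_in_V w(2)] p_disjoint[OF w(1) that(3) w(3)] wt_pos[of w] p_z py(1) Ay by linarith
  qed
  have "p y = p x + wt x \<or> y = z" "p x = p y + wt y \<or> x = z" 
    using sc[OF assms(1)] sc[OF assms(4)] assms(2,3) by auto
  moreover have "\<not> (p y = p x + wt x \<and> p x = p y + wt y)" using wt_pos[of x] wt_pos[of y] by linarith
  ultimately have "y = z \<or> x = z" by blast
  thus False
  proof
    assume "y = z"
    thus False using no_z[of x] assms by simp
  next
    assume "x = z"
    thus False using no_z[of y] assms by simp
  qed
qed

lemma inj_point: "inj_on point {0..<A}"
proof (rule inj_onI)
  fix t t' assume t: "t \<in> {0..<A}" "t' \<in> {0..<A}" "point t = point t'"
  show "t = t'"
  proof (cases "gap t \<or> gap t'")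
    case True
    have "gap t \<longleftrightarrow> gap t'"
      using point_complex[of t] point_complex[of t'] point_gap[of t] point_gap[of t'] t
      by (cases "gap t"; cases "gap t'") auto
    hence gaps: "gap t" "gap t'" using True by auto
    show ?thesis
    proof (rule ccontr)
      assume "t \<noteq> t'"
      then consider "t < t'" | "t' < t" by linarith
      thus False
        using separate_gaps[OF gaps] separate_gaps[OF gaps(2,1)] t(3) by cases (auto simp: disjnt_iff)
    qed
  next
    case False
    then obtain x y where xy: "slot x t" "slot y t'" using slot_or_gap[of t] slot_or_gap[of t'] t by auto
    define s s' where "s = (t - p x) / wt x" and "s' = (t' - p y) / wt y"
    have s: "0 \<le> s" "s < 1" "0 \<le> s'" "s' < 1"
      using xy wt_pos[of x] wt_pos[of y] by (auto simp: s_def s'_def slot_def divide_simps)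
    have V: "x \<in> V" "y \<in> V" using xy by (auto simp: slot_def)
    have nsc: "sc x \<noteq> x" "sc y \<noteq> y" using sc[OF V(1)] sc[OF V(2)] edge_V by metis+
    have eq: "edge_coords x (sc x) s = edge_coords y (sc y) s'"
      using t(3) point_slot[OF xy(1)] point_slot[OF xy(2)] by (simp add: edge_point_eq s_def s'_def)
    have "x = y"
    proof (rule ccontr)
      assume "x \<noteq> y"
      hence "x = sc y" "y = sc x"
        using fun_cong[OF eq, of x] fun_cong[OF eq, of y] s by (auto simp: edge_coords_def split: if_splits)
      thus False using two_slots_absurd V by metis
    qed
    hence "s = s'" using fun_cong[OF eq, of x] by (simp add: edge_coords_def)
    thus ?thesis using \<open>x = y\<close> wt_pos[of x] by (simp add: s_def s'_def)
  qed
qed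

lemma point_0: "point 0 = vertex_point z"
  using point_vertex[OF z_in_V] p_z by simp

lemma point_A: "point A = vertex_point z"
  by (simp add: point_def)

text \<open>Together with the compactness of the unit circle, this makes the continuous bijection
  onto the image a homeomorphism.\<close>

lemma Hausdorff_image: "Hausdorff_space (subtopology (freudenthal V E) (point ` {0..A}))"
proof -
  have sep: "\<exists>U U'. openin (freudenthal V E) U \<and> openin (freudenthal V E) U' \<and>
      point t \<in> U \<and> point t' \<in> U' \<and> disjnt U U'"
    if t: "t \<in> {0..A}" "t' \<in> {0..A}" "point t \<noteq> point t'" for t t'
  proof (cases "gap t")
    case gt: True
    show ?thesis
    proof (cases "gap t'")
      case True
      consider "t < t'" | "t' < t" using t(3) by fastforce
      thus ?thesis
      proof cases
        case 1
        thus ?thesis using separate_gaps gt True by blast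
      next
        case 2
        from separate_gaps[OF True gt this] show ?thesis by (metis disjnt_sym)
      qed
    next
      case False
      obtain h where h: "point t' = Complex_Point h" "Complex_Point h \<in> one_complex V E"
        using point_complex[of t'] t False by auto
      have "end_of V E (gap_ray t) \<in> ends V E" using gap_ray(1)[OF gt] ends_iff by blast
      from separate_complex_end[OF simple h(2) this] show ?thesis
        unfolding h(1) point_gap[OF gt] by (metis disjnt_sym)
    qed
  next
    case ngt: False
    obtain h where h: "point t = Complex_Point h" "Complex_Point h \<in> one_complex V E"
      using point_complex[of t] t ngt by auto
    show ?thesis
    proof (cases "gap t'")
      case True
      have "end_of V E (gap_ray t') \<in> ends V E" using gap_ray(1)[OF True] ends_iff by blast
      from separate_complex_end[OF simple h(2) this] show ?thesis unfolding h(1) point_gap[OF True] .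
    next
      case False
      obtain h' where h': "point t' = Complex_Point h'" "Complex_Point h' \<in> one_complex V E"
        using point_complex[of t'] t False by auto
      have "h \<noteq> h'" using t(3) h h' by auto
      from separate_complex_points[OF h(2) h'(2) this] show ?thesis unfolding h(1) h'(1) .
    qed
  qed
  show ?thesis
    unfolding Hausdorff_space_def
  proof (intro allI impI)
    fix P Q assume PQ: "P \<in> topspace (subtopology (freudenthal V E) (point ` {0..A})) \<and>
      Q \<in> topspace (subtopology (freudenthal V E) (point ` {0..A})) \<and> P \<noteq> Q"
    then obtain t t' where t: "P = point t" "Q = point t'" "t \<in> {0..A}" "t' \<in> {0..A}" by auto
    from sep[OF t(3,4)] PQ t obtain U U' where U: "openin (freudenthal V E) U" "openin (freudenthal V E) U'"
      "P \<in> U" "Q \<in> U'" "disjnt U U'" by blast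
    let ?K = "point ` {0..A}"
    show "\<exists>U V'. openin (subtopology (freudenthal V E) ?K) U \<and> openin (subtopology (freudenthal V E) ?K) V' \<and>
      P \<in> U \<and> Q \<in> V' \<and> disjnt U V'"
      using U t by (intro exI[of _ "U \<inter> ?K"] exI[of _ "U' \<inter> ?K"])
        (auto simp: openin_subtopology disjnt_def)
  qed
qed

section \<open>Continuity of the parametrisation\<close>

lemma slot_nbhd:
  assumes U: "open_in_complex V E U" and x: "x \<in> V" "p x \<le> t" "t \<le> p x + wt x" "point t \<in> U"
  shows "\<exists>d>0. \<forall>t'. p x \<le> t' \<longrightarrow> t' \<le> p x + wt x \<longrightarrow> \<bar>t' - t\<bar> < d \<longrightarrow> point t' \<in> U"
proof -
  let ?T = "{s \<in> {0..1}. edge_point x (sc x) s \<in> U}"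
  have rng: "(t' - p x) / wt x \<in> {0..1}" if "p x \<le> t'" "t' \<le> p x + wt x" for t'
    using that wt_pos[of x] by (auto simp: divide_simps)
  have "openin (top_of_set {0..1}) ?T" using U sc[OF x(1)] unfolding open_in_complex_def by blast
  moreover have "(t - p x) / wt x \<in> ?T" using rng[OF x(2,3)] point_closed_slot[OF x(1-3)] x(4) by simp
  ultimately obtain e where e: "e > 0" "\<And>s. s \<in> {0..1} \<Longrightarrow> dist s ((t - p x) / wt x) < e \<Longrightarrow> s \<in> ?T"
    unfolding openin_euclidean_subtopology_iff by blast
  have "point t' \<in> U" if t': "p x \<le> t'" "t' \<le> p x + wt x" "\<bar>t' - t\<bar> < e * wt x" for t'
  proof -
    have "(t' - p x) / wt x - (t - p x) / wt x = (t' - t) / wt x" by (simp add: diff_divide_distrib)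
    hence "dist ((t' - p x) / wt x) ((t - p x) / wt x) = \<bar>t' - t\<bar> / wt x"
      using wt_pos[of x] by (simp add: dist_real_def)
    also have "\<dots> < e" using t'(3) wt_pos[of x] by (simp add: divide_simps)
    finally show ?thesis using e(2)[OF rng[OF t'(1,2)]] point_closed_slot[OF x(1) t'(1,2)] by simp
  qed
  thus ?thesis using e(1) wt_pos[of x] by (intro exI[of _ "e * wt x"]) auto
qed

text \<open>To the right the slot of \<open>t\<close> is used, to the left the closed slot from
  \<open>left_slot\<close>; at the parameter of a vertex these are different slots.\<close>

lemma complex_nbhd:
  assumes U: "open_in_complex V E U" and t: "0 \<le> t" "t \<le> A" "point t \<in> U" "\<not> gap t"
  shows "\<exists>d>0. \<forall>t'. 0 \<le> t' \<longrightarrow> t' \<le> A \<longrightarrow> \<bar>t' - t\<bar> < d \<longrightarrow> point t' \<in> U"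
proof -
  have "\<exists>d>0. \<forall>t'. t \<le> t' \<longrightarrow> t' \<le> A \<longrightarrow> \<bar>t' - t\<bar> < d \<longrightarrow> point t' \<in> U"
  proof (cases "t = A")
    case True
    have "point t' \<in> U" if "t \<le> t'" "t' \<le> A" for t' using that True t by simp
    thus ?thesis by (intro exI[of _ 1]) auto
  next
    case False
    then obtain x where x: "slot x t" using slot_or_gap[of t] t by auto
    then obtain d where d: "d > 0"
      "\<And>t'. p x \<le> t' \<Longrightarrow> t' \<le> p x + wt x \<Longrightarrow> \<bar>t' - t\<bar> < d \<Longrightarrow> point t' \<in> U"
      using slot_nbhd[OF U, of x t] t unfolding slot_def by auto
    show ?thesis
      using x d by (intro exI[of _ "min d (p x + wt x - t)"]) (auto simp: slot_def)
  qed
  then obtain d1 where d1: "d1 > 0" "\<And>t'. t \<le> t' \<Longrightarrow> t' \<le> A \<Longrightarrow> \<bar>t' - t\<bar> < d1 \<Longrightarrow> point t' \<in> U" by blast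
  have "\<exists>d>0. \<forall>t'. 0 \<le> t' \<longrightarrow> t' \<le> t \<longrightarrow> \<bar>t' - t\<bar> < d \<longrightarrow> point t' \<in> U"
  proof (cases "t = 0")
    case True
    have "point t' \<in> U" if "0 \<le> t'" "t' \<le> t" for t' using that True t by simp
    thus ?thesis by (intro exI[of _ 1]) auto
  next
    case False
    then obtain x where x: "x \<in> V" "p x < t" "t \<le> p x + wt x" using left_slot[of t] t by auto
    then obtain d where d: "d > 0"
      "\<And>t'. p x \<le> t' \<Longrightarrow> t' \<le> p x + wt x \<Longrightarrow> \<bar>t' - t\<bar> < d \<Longrightarrow> point t' \<in> U"
      using slot_nbhd[OF U x(1) less_imp_le[OF x(2)] x(3) t(3)] by blast
    show ?thesis
      using x d by (intro exI[of _ "min d (t - p x)"]) auto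
  qed
  then obtain d2 where d2: "d2 > 0" "\<And>t'. 0 \<le> t' \<Longrightarrow> t' \<le> t \<Longrightarrow> \<bar>t' - t\<bar> < d2 \<Longrightarrow> point t' \<in> U" by blast
  have "point t' \<in> U" if "0 \<le> t'" "t' \<le> A" "\<bar>t' - t\<bar> < min d1 d2" for t'
    using that d1(2)[of t'] d2(2)[of t'] by (cases "t \<le> t'") auto
  thus ?thesis using d1(1) d2(1) by (intro exI[of _ "min d1 d2"]) auto
qed

text \<open>A late region around \<open>t\<close> is connected off \<open>S\<close> and contains a
  tail of the ray of \<open>t\<close>, so it lies in \<open>C\<close>. Take one of its vertices on
  each side of \<open>t\<close>. Between them, slots belong to vertices of the region whose
  successors are also in it, and gaps are surrounded by the same region, so their rays end up in
  \<open>C\<close>.\<close>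

lemma end_nbhd_nbhd:
  assumes S: "finite S" "S \<subseteq> V" and C: "C \<in> graph_components (V - S) (induced_edges E (V - S))"
    and t: "gap t" "point t \<in> end_nbhd V E S C \<epsilon>"
  shows "\<exists>d>0. \<forall>t'. 0 \<le> t' \<longrightarrow> t' \<le> A \<longrightarrow> \<bar>t' - t\<bar> < d \<longrightarrow> point t' \<in> end_nbhd V E S C \<epsilon>"
proof -
  define j where "j = Max (insert 0 (lev ` S)) + 2"
  have "lev x + 2 \<le> n j" if "x \<in> S" for x
  proof -
    have "lev x \<le> Max (insert 0 (lev ` S))" using S that by (intro Max_ge) auto
    thus ?thesis using seq_suble[OF n_mono, of j] unfolding j_def by linarith
  qed
  hence Sin: "S \<subseteq> inside (n j)" using inside_if_lev S by blast
  define K where "K = gap_region j t"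
  have K: "K \<in> regions (n j)" "surrounds K t" using gap_region[OF t(1)] by (auto simp: K_def)
  have KS: "K \<subseteq> V - S" using region_subset[OF K(1)] Sin by blast
  have "lives_in (end_of V E (gap_ray t)) C" using t(2) unfolding point_gap[OF t(1)] End_Point_in_end_nbhd by blast
  then obtain N where N: "\<And>m. m \<ge> N \<Longrightarrow> gap_ray t m \<in> C"
    using lives_in_end_of_iff[OF gap_ray(1)[OF t(1)] S C] by blast
  define y where "y = gap_ray t (Suc (max N (n j)))"
  have y: "y \<in> C" "y \<in> K" unfolding y_def K_def using N gap_ray(2)[OF t(1)] by auto
  have KC: "K \<subseteq> C"
  proof
    fix x assume x: "x \<in> K"
    hence "(y, x) \<in> (core_rel (n j))\<^sup>*" using regions_eqI[OF K(1) y(2)] by (auto simp: region_def)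
    from core_rel_linked[OF this Sin] show "x \<in> C" using component_closed[OF C y(1)] x KS by blast
  qed
  obtain a b where ab: "a \<in> K" "p a < t" "b \<in> K" "t < p b" using K(2) by (auto simp: surrounds_def)
  have abV: "a \<in> V" "b \<in> V" using ab K(1) regions_V by blast+
  have "point t' \<in> end_nbhd V E S C \<epsilon>" if t': "p a < t'" "t' < p b" for t'
  proof (cases "gap t'")
    case True
    have "surrounds K t'" using ab t' by (auto simp: surrounds_def)
    hence eq: "gap_region j t' = K" using surrounds_unique gap_region[OF True] K(1) by blast
    have "gap_ray t' m \<in> C" if "m \<ge> Suc (n j)" for m using gap_ray(2)[OF True, of j m] that eq KC by auto
    hence "lives_in (end_of V E (gap_ray t')) C"
      using lives_in_end_of_iff[OF gap_ray(1)[OF True] S C] by blast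
    moreover have "end_of V E (gap_ray t') \<in> ends V E" using gap_ray(1)[OF True] ends_iff by blast
    ultimately show ?thesis unfolding point_gap[OF True] End_Point_in_end_nbhd by blast
  next
    case False
    have "0 \<le> t'" "t' < A" using t' p_nonneg[OF abV(1)] p_less[OF abV(2)] by auto
    then obtain x where x: "slot x t'" using slot_or_gap False by blast
    hence xV: "x \<in> V" "p x \<le> t'" "t' < p x + wt x" by (auto simp: slot_def)
    have xb: "p x < p b" using xV t' by simp
    have "x \<in> K"
    proof (cases "x = a")
      case False
      hence "p a < p x" using p_disjoint[OF xV(1) abV(1)] xV t' wt_pos[of a] by auto
      thus ?thesis using p_convex[OF K(1) ab(1,3) xV(1)] xb by blast
    qed (use ab in simp)
    have le: "p x + wt x \<le> p b" using p_less_imp[OF xV(1) abV(2) xb] .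
    hence "p x + wt x < A" using p_less[OF abV(2)] by simp
    hence scx: "{x, sc x} \<in> E" "p (sc x) = p x + wt x" "sc x \<in> V" using sc[OF xV(1)] edge_V by auto
    have "sc x \<in> K"
    proof (cases "sc x = b")
      case False
      hence "p (sc x) < p b" using le scx p_inj[OF scx(3) abV(2)] by fastforce
      moreover have "p x < p (sc x)" using scx wt_pos[of x] by simp
      ultimately show ?thesis using p_convex[OF K(1) \<open>x \<in> K\<close> ab(3) scx(3)] by blast
    qed (use ab in simp)
    hence "{x, sc x} \<in> induced_edges E C" using \<open>x \<in> K\<close> KC scx(1) by (auto simp: induced_edges_def)
    moreover have "0 \<le> (t' - p x) / wt x" "(t' - p x) / wt x \<le> 1"
      using xV wt_pos[of x] by (auto simp: divide_simps)
    ultimately have "edge_point x (sc x) ((t' - p x) / wt x) \<in> one_complex C (induced_edges E C)"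
      unfolding edge_point_eq by (rule edge_coords_in_one_complex)
    thus ?thesis unfolding point_slot[OF x] by (simp add: end_nbhd_def)
  qed
  thus ?thesis using ab by (intro exI[of _ "min (t - p a) (p b - t)"]) auto
qed

lemma continuous_point: "continuous_map (top_of_set {0..A}) (freudenthal V E) point"
  unfolding freudenthal_def
proof (rule continuous_on_generated_topo)
  have openI: "openin (top_of_set {0..A}) (point -` U \<inter> topspace (top_of_set {0..A}))"
    if nbhd: "\<And>t. 0 \<le> t \<Longrightarrow> t \<le> A \<Longrightarrow> point t \<in> U \<Longrightarrow>
      \<exists>d>0. \<forall>t'. 0 \<le> t' \<longrightarrow> t' \<le> A \<longrightarrow> \<bar>t' - t\<bar> < d \<longrightarrow> point t' \<in> U" for U
    unfolding openin_euclidean_subtopology_iff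
  proof (intro conjI ballI)
    fix t assume "t \<in> point -` U \<inter> topspace (top_of_set {0..A})"
    then obtain d where "d > 0" "\<forall>t'. 0 \<le> t' \<longrightarrow> t' \<le> A \<longrightarrow> \<bar>t' - t\<bar> < d \<longrightarrow> point t' \<in> U"
      using nbhd[of t] by auto
    thus "\<exists>e>0. \<forall>t'\<in>{0..A}. dist t' t < e \<longrightarrow> t' \<in> point -` U \<inter> topspace (top_of_set {0..A})"
      by (intro exI[of _ d]) (auto simp: dist_real_def)
  qed auto
  fix U assume "U \<in> {U. open_in_complex V E U} \<union>
      {end_nbhd V E S C \<epsilon> | S C \<epsilon> \<omega>. S \<subseteq> V \<and> finite S \<and>
         C \<in> graph_components (V - S) (induced_edges E (V - S)) \<and> \<omega> \<in> ends V E \<and> lives_in \<omega> C \<and> 0 < \<epsilon>}"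
  then consider "open_in_complex V E U" |
    S C \<epsilon> where "S \<subseteq> V" "finite S" "C \<in> graph_components (V - S) (induced_edges E (V - S))" "0 < \<epsilon>"
      "U = end_nbhd V E S C \<epsilon>" by blast
  thus "openin (top_of_set {0..A}) (point -` U \<inter> topspace (top_of_set {0..A}))"
  proof cases
    case 1
    show ?thesis
    proof (rule openI)
      fix t assume t: "0 \<le> t" "t \<le> A" "point t \<in> U"
      have "U \<subseteq> one_complex V E" using 1 by (auto simp: open_in_complex_def)
      hence "\<not> gap t" using t(3) point_gap[of t] by (auto simp: one_complex_def vertex_point_def edge_point_def)
      thus "\<exists>d>0. \<forall>t'. 0 \<le> t' \<longrightarrow> t' \<le> A \<longrightarrow> \<bar>t' - t\<bar> < d \<longrightarrow> point t' \<in> U" using complex_nbhd[OF 1 t] by blast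
    qed
  next
    case 2
    show ?thesis
    proof (rule openI)
      fix t assume t: "0 \<le> t" "t \<le> A" "point t \<in> U"
      show "\<exists>d>0. \<forall>t'. 0 \<le> t' \<longrightarrow> t' \<le> A \<longrightarrow> \<bar>t' - t\<bar> < d \<longrightarrow> point t' \<in> U"
      proof (cases "gap t")
        case True
        thus ?thesis using end_nbhd_nbhd[OF 2(2,1,3) True, of \<epsilon>] t 2(5) by blast
      next
        case False
        have o: "open_in_complex V E (U \<inter> range Complex_Point)"
          using open_in_complex_end_nbhd[OF simple 2(2,3,4)] 2(5) by simp
        have "point t \<in> U \<inter> range Complex_Point" using point_complex[OF t(1,2) False] t(3) by auto
        from complex_nbhd[OF o t(1,2) this False] show ?thesis by blast
      qed
    qed
  qed
next
  show "point ` topspace (top_of_set {0..A}) \<subseteq> \<Union> ({U. open_in_complex V E U} \<union>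
      {end_nbhd V E S C \<epsilon> | S C \<epsilon> \<omega>. S \<subseteq> V \<and> finite S \<and>
         C \<in> graph_components (V - S) (induced_edges E (V - S)) \<and> \<omega> \<in> ends V E \<and> lives_in \<omega> C \<and> 0 < \<epsilon>})"
  proof
    fix P assume "P \<in> point ` topspace (top_of_set {0..A})"
    then obtain t where t: "P = point t" "0 \<le> t" "t \<le> A" by auto
    show "P \<in> \<Union> ({U. open_in_complex V E U} \<union>
      {end_nbhd V E S C \<epsilon> | S C \<epsilon> \<omega>. S \<subseteq> V \<and> finite S \<and>
         C \<in> graph_components (V - S) (induced_edges E (V - S)) \<and> \<omega> \<in> ends V E \<and> lives_in \<omega> C \<and> 0 < \<epsilon>})"
    proof (cases "gap t")
      case False
      have "open_in_complex V E (complex_set V E (\<lambda>_. True))" 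
        by (rule open_in_complex_set) (use openin_preimage_real[of "{0..1}" "\<lambda>t. t" UNIV] in simp)
      moreover have "P \<in> complex_set V E (\<lambda>_. True)" using point_complex[OF t(2,3) False] t(1) by auto
      ultimately show ?thesis by blast
    next
      case True
      define \<omega> where "\<omega> = end_of V E (gap_ray t)"
      have r: "ray V E (gap_ray t)" "\<omega> \<in> ends V E" using gap_ray(1)[OF True] ends_iff unfolding \<omega>_def by blast+
      obtain C where C: "C \<in> graph_components (V - {}) (induced_edges E (V - {}))" "\<exists>N. \<forall>m\<ge>N. gap_ray t m \<in> C"
        using ray_tail_component[OF r(1), of "{}"] by blast
      have "lives_in \<omega> C" unfolding \<omega>_def using lives_in_end_of_iff[OF r(1) _ _ C(1)] C(2) by simp
      moreover from this have "P \<in> end_nbhd V E {} C 1"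
        unfolding t(1) point_gap[OF True] End_Point_in_end_nbhd using r(2) \<omega>_def by simp
      ultimately show ?thesis using C(1) r(2) by (intro UnionI[of "end_nbhd V E {} C 1"]) fastforce+
    qed
  qed
qed

lemma hamiltonian_limit: "hamiltonian V E"
proof -
  define e where "e = (\<lambda>t. cis (2 * pi * t / A))"
  define K where "K = point ` {0..A}"
  have e_cont: "continuous_map (top_of_set {0..A}) (top_of_set (sphere 0 1)) e"
    unfolding continuous_map_in_subtopology continuous_map_iff_continuous e_def cis_conv_exp
    using A_pos by (auto intro!: continuous_intros)
  have e_surj: "\<exists>t\<in>{0..<A}. e t = w" if "w \<in> sphere 0 1" for w
  proof -
    define t where "t = A * Arg2pi w / (2 * pi)"
    have "norm w = 1" using that by simp
    hence "cis (Arg2pi w) = w" using complex_norm_eq_1_exp[of w] by (simp add: cis_conv_exp)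
    moreover have "2 * pi * t / A = Arg2pi w" using A_pos by (simp add: t_def)
    moreover have "0 \<le> t" "t < A"
      using Arg2pi[of w] A_pos pi_gt_zero by (auto simp: t_def divide_simps mult_less_cancel_left)
    ultimately show ?thesis by (intro bexI[of _ t]) (auto simp: e_def)
  qed
  have e_inj: "t = t'" if "t \<in> {0..<A}" "t' \<in> {0..<A}" "e t = e t'" for t t'
  proof -
    have "sin (2 * pi * t / A) = sin (2 * pi * t' / A) \<and> cos (2 * pi * t / A) = cos (2 * pi * t' / A)"
      using that(3) by (simp add: e_def cis.ctr)
    then obtain k :: int where "2 * pi * t / A = 2 * pi * t' / A + 2 * pi * k"
      using sin_cos_eq_iff by blast
    hence "2 * pi * (t / A) = 2 * pi * (t' / A + k)" by (simp add: algebra_simps)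
    hence "t / A = t' / A + k" unfolding mult_cancel_left by simp
    moreover have "0 \<le> t / A" "t / A < 1" "0 \<le> t' / A" "t' / A < 1" using that A_pos by auto
    ultimately have "\<bar>real_of_int k\<bar> < 1" by linarith
    hence "k = 0" by linarith
    thus ?thesis using \<open>t / A = t' / A + k\<close> A_pos by simp
  qed
  have e_A: "e A = e 0" using A_pos by (simp add: e_def)
  define h where "h = (\<lambda>w. point (SOME t. t \<in> {0..<A} \<and> e t = w))"
  have h_e: "h (e t) = point t" if "t \<in> {0..A}" for t
  proof -
    have *: "h (e t) = point t" if "t \<in> {0..<A}" for t
    proof -
      have "(SOME t'. t' \<in> {0..<A} \<and> e t' = e t) = t" using that e_inj by (intro some_equality) auto
      thus ?thesis by (simp add: h_def)
    qed
    show ?thesis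
    proof (cases "t = A")
      case True
      thus ?thesis using *[of 0] A_pos e_A point_0 point_A by simp
    qed (use * that in auto)
  qed
  have K: "K \<subseteq> topspace (freudenthal V E)"
    using continuous_point unfolding continuous_map_def K_def by auto
  have e_range: "e ` {0..A} = sphere 0 1"
  proof
    show "e ` {0..A} \<subseteq> sphere 0 1" by (auto simp: e_def)
    show "sphere 0 1 \<subseteq> e ` {0..A}" using e_surj by fastforce
  qed
  have hom: "homeomorphic_map (top_of_set (sphere 0 1)) (subtopology (freudenthal V E) K) h"
  proof (rule continuous_imp_homeomorphic_map)
    \<comment> \<open>The circle is a quotient of the interval, so \<open>h\<close> is continuous
      because its composition with \<open>e\<close> is \<open>point\<close>.\<close>
    have q: "quotient_map (top_of_set {0..A}) (top_of_set (sphere 0 1)) e"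
      using e_cont e_range
      by (intro continuous_imp_quotient_map) (auto simp: compact_space_subtopology Hausdorff_space_subtopology)
    have "continuous_map (top_of_set {0..A}) (subtopology (freudenthal V E) K) point"
      using continuous_point by (auto simp: continuous_map_in_subtopology K_def)
    hence "continuous_map (top_of_set {0..A}) (subtopology (freudenthal V E) K) (h \<circ> e)"
      by (rule continuous_map_eq) (simp add: h_e)
    thus "continuous_map (top_of_set (sphere 0 1)) (subtopology (freudenthal V E) K) h"
      by (rule continuous_compose_quotient_map[OF q])
    show "compact_space (top_of_set (sphere (0 :: complex) 1))" by (simp add: compact_space_subtopology)
    show "Hausdorff_space (subtopology (freudenthal V E) K)" using Hausdorff_image by (simp add: K_def)
    have "h ` sphere 0 1 = K" unfolding e_range[symmetric] image_image K_def using h_e by (auto intro!: image_cong)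
    thus "h ` topspace (top_of_set (sphere 0 1)) = topspace (subtopology (freudenthal V E) K)"
      using K by (simp add: Int_absorb1)
    show "inj_on h (topspace (top_of_set (sphere 0 1)))"
    proof (rule inj_onI)
      fix w w' assume w: "w \<in> topspace (top_of_set (sphere 0 1))" "w' \<in> topspace (top_of_set (sphere 0 1))" "h w = h w'"
      obtain t t' where t: "t \<in> {0..<A}" "e t = w" "t' \<in> {0..<A}" "e t' = w'" using e_surj w by (metis topspace_euclidean_subtopology)
      hence "point t = point t'" using h_e[of t] h_e[of t'] w by auto
      thus "w = w'" using inj_point t by (auto dest: inj_onD)
    qed
  qed
  hence "circle_in (freudenthal V E) K"
    using K homeomorphic_map_imp_homeomorphic_space homeomorphic_space_sym unfolding circle_in_def by blast
  moreover have "vertex_point ` V \<subseteq> K"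
  proof
    fix P assume "P \<in> vertex_point ` V"
    then obtain x where x: "x \<in> V" "P = vertex_point x" by blast
    hence "P = point (p x)" using point_vertex by simp
    moreover have "p x \<in> {0..A}" using p_nonneg[OF x(1)] p_less[OF x(1)] by simp
    ultimately show "P \<in> K" unfolding K_def by blast
  qed
  ultimately show ?thesis unfolding hamiltonian_def by blast
qed

end

section \<open>Hamiltonicity\<close>

lemma claw_free_adj:
  assumes "simple_graph V E" "claw_free V E"
    and E: "{x, a} \<in> E" "{x, b} \<in> E" "{x, c} \<in> E" and d: "a \<noteq> b" "a \<noteq> c" "b \<noteq> c"
  shows "{a, b} \<in> E \<or> {a, c} \<in> E \<or> {b, c} \<in> E"
proof (rule ccontr)
  assume neg: "\<not> ?thesis"
  have simple: "{u, v} \<in> E \<Longrightarrow> u \<in> V \<and> v \<in> V \<and> u \<noteq> v" for u v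
    using assms(1) by (auto simp: simple_graph_def)
  define f :: "nat \<Rightarrow> 'a" where "f i = (if i = 0 then x else if i = 1 then a else if i = 2 then b else c)" for i
  have f: "f 0 = x" "f (Suc 0) = a" "f 1 = a" "f 2 = b" "f 3 = c" by (auto simp: f_def)
  define W where "W = {x, a, b, c}"
  have ne: "x \<noteq> a" "x \<noteq> b" "x \<noteq> c" using simple E by blast+
  have loops: "{u} \<notin> E" for u using simple[of u u] by auto
  have "bij_betw f claw_vertices W"
    unfolding bij_betw_def inj_on_def claw_vertices_def W_def using d ne by (auto simp: f)
  moreover have "\<forall>u\<in>claw_vertices. \<forall>v\<in>claw_vertices.
      {u, v} \<in> claw_edges \<longleftrightarrow> {f u, f v} \<in> induced_edges E W"
    using neg E loops
    by (simp add: claw_vertices_def claw_edges_def induced_edges_def W_def f doubleton_eq_iff insert_commute)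
  ultimately have "graph_iso f claw_vertices claw_edges W (induced_edges E W)"
    unfolding graph_iso_def by blast
  moreover have "W \<subseteq> V" using simple E unfolding W_def by blast
  ultimately show False using assms(2) unfolding claw_free_def by blast
qed

lemma paw_common_nbr:
  assumes "simple_graph V E"
    and paw: "\<And>W f. paw_labelling V E W f \<Longrightarrow>
           \<exists>b\<in>{B1, B2}. \<exists>w\<in>V - W. {w, f A1} \<in> E \<and> {w, f b} \<in> E"
    and E: "{u, v} \<in> E" "{u, x} \<in> E" "{u, y} \<in> E" "{x, y} \<in> E" and ne: "v \<noteq> x" "v \<noteq> y"
    and nE: "{v, x} \<notin> E" "{v, y} \<notin> E"
  shows "\<exists>w. w \<notin> {u, v, x, y} \<and> {w, v} \<in> E \<and> ({w, x} \<in> E \<or> {w, y} \<in> E)"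
proof -
  have simple: "{u, v} \<in> E \<Longrightarrow> u \<in> V \<and> v \<in> V \<and> u \<noteq> v" for u v
    using assms(1) by (auto simp: simple_graph_def)
  define f where "f = (\<lambda>i. case i of A1 \<Rightarrow> v | A0 \<Rightarrow> u | B1 \<Rightarrow> x | B2 \<Rightarrow> y)"
  have f: "f A1 = v" "f A0 = u" "f B1 = x" "f B2 = y" by (auto simp: f_def)
  define W where "W = {u, v, x, y}"
  have ne': "u \<noteq> v" "u \<noteq> x" "u \<noteq> y" "x \<noteq> y" using simple E by blast+
  have loops: "{u} \<notin> E" for u using simple[of u u] by auto
  have U: "(UNIV :: paw_vertex set) = {A1, A0, B1, B2}" using paw_vertex.exhaust by blast
  have "bij_betw f UNIV W"
    unfolding bij_betw_def inj_on_def U W_def using ne ne' by (auto simp: f)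
  moreover have "\<forall>i\<in>UNIV. \<forall>j\<in>UNIV. {i, j} \<in> paw_edges \<longleftrightarrow> {f i, f j} \<in> induced_edges E W"
    unfolding U using nE E loops
    by (simp add: paw_edges_def induced_edges_def W_def f doubleton_eq_iff insert_commute)
  moreover have "W \<subseteq> V" using simple E unfolding W_def by blast
  ultimately have "paw_labelling V E W f" unfolding paw_labelling_def graph_iso_def by blast
  from paw[OF this] show ?thesis unfolding W_def by (auto simp: f)
qed

section \<open>A first cycle\<close>

lemma rtrancl_distinct_path:
  assumes "(a, b) \<in> {(x, y). R x y}\<^sup>*" "a \<in> X" "\<And>x y. R x y \<Longrightarrow> y \<in> X"
  shows "\<exists>ps. ps \<noteq> [] \<and> hd ps = a \<and> last ps = b \<and> distinct ps \<and> successively R ps \<and> set ps \<subseteq> X"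
  using assms(1)
proof (induction rule: rtrancl_induct)
  case base
  show ?case using assms(2) by (intro exI[of _ "[a]"]) auto
next
  case (step b w)
  then obtain ps where ps: "ps \<noteq> []" "hd ps = a" "last ps = b" "distinct ps" "successively R ps" "set ps \<subseteq> X"
    by blast
  have w: "R b w" "w \<in> X" using step assms(3) by auto
  show ?case
  proof (cases "w \<in> set ps")
    case True
    then obtain as bs where s: "ps = as @ w # bs" by (auto dest: split_list)
    show ?thesis
      using ps unfolding s
      by (intro exI[of _ "as @ [w]"]) (auto simp: successively_append_iff hd_append split: if_splits)
  next
    case False
    show ?thesis
      using ps w False by (intro exI[of _ "ps @ [w]"]) (auto simp: successively_append_iff)
  qed
qed

text \<open>Deleting one neighbour of \<open>z\<close> leaves it another one, and the two are joined
  by a path avoiding \<open>z\<close>, which closes up through \<open>z\<close>.\<close>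

lemma two_connected_cycle:
  assumes G: "simple_graph V E" and k: "k_connected 2 V E" and adj: "claw_paw (\<lambda>x y. {x, y} \<in> E)"
  obtains z ys where "z \<in> V" "claw_paw.cyc (\<lambda>x y. {x, y} \<in> E) z ys" "set ys \<subseteq> V"
proof -
  have simple: "{u, v} \<in> E \<Longrightarrow> u \<in> V \<and> v \<in> V \<and> u \<noteq> v" for u v
    using G by (auto simp: simple_graph_def)
  have big: "infinite V \<or> 2 < card V" using k by (simp add: k_connected_def)
  have conn: "graph_connected (V - X) (induced_edges E (V - X))" if "X \<subseteq> V" "finite X" "card X < 2" for X
    using k that unfolding k_connected_def by blast
  have more: "\<exists>w\<in>V. w \<notin> X" if "finite X" "card X \<le> 2" for X
  proof (rule ccontr)
    assume "\<not> ?thesis"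
    hence "V \<subseteq> X" by blast
    hence "finite V" "card V \<le> 2" using that by (auto intro: finite_subset dest: card_mono)
    thus False using big by simp
  qed
  have nbr: "\<exists>b. {z, b} \<in> E \<and> b \<notin> X" if X: "X \<subseteq> V" "finite X" "card X < 2" and z: "z \<in> V - X" for z X
  proof -
    have "card (insert z X) \<le> 2" using X by (simp add: card_insert_if)
    then obtain w where w: "w \<in> V" "w \<notin> insert z X" using more[of "insert z X"] X by auto
    have "linked (induced_edges E (V - X)) z w" using conn[OF X] z w unfolding graph_connected_def by blast
    then obtain b where "{z, b} \<in> induced_edges E (V - X)"
      unfolding linked_def using w(2) by (auto elim: converse_rtranclE)
    thus ?thesis by (auto simp: induced_edges_def)
  qed
  obtain z where z: "z \<in> V" using more[of "{}"] by auto
  obtain a where a: "{z, a} \<in> E" using nbr[of "{}" z] z by auto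
  obtain b where b: "{z, b} \<in> E" "b \<noteq> a" using nbr[of "{a}" z] z simple[OF a] by auto
  have "linked (induced_edges E (V - {z})) a b"
    using conn[of "{z}"] z simple[OF a] simple[OF b(1)] unfolding graph_connected_def by auto
  hence "(a, b) \<in> {(x, y). {x, y} \<in> induced_edges E (V - {z})}\<^sup>*" by (simp add: linked_def)
  from rtrancl_distinct_path[OF this, of "V - {z}"] simple[OF a]
  obtain ps where ps: "ps \<noteq> []" "hd ps = a" "last ps = b" "distinct ps"
    "successively (\<lambda>x y. {x, y} \<in> induced_edges E (V - {z})) ps" "set ps \<subseteq> V - {z}"
    by (auto simp: induced_edges_def)
  have "successively (\<lambda>x y. {x, y} \<in> E) ps"
    using ps(5) by (rule successively_mono) (auto simp: induced_edges_def)
  hence suc: "successively (\<lambda>x y. {x, y} \<in> E) (z # ps @ [z])"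
    using ps(1-3) a b by (auto simp: successively_append_iff successively_Cons insert_commute)
  have "length ps \<noteq> 1" using ps(1-3) b(2) by (auto simp: length_Suc_conv)
  hence len: "2 \<le> length ps" using ps(1) by (cases ps) (auto simp: Suc_le_eq)
  have "claw_paw.cyc (\<lambda>x y. {x, y} \<in> E) z ps"
    unfolding claw_paw.cyc_def[OF adj] using ps(4,6) suc len by auto
  thus ?thesis using that[OF z, of ps] ps(6) by auto
qed

theorem theorem1p3:
  fixes V :: "'a set" and E :: "'a set set"
  assumes "simple_graph V E"
    and "locally_finite_graph V E"
    and "k_connected 2 V E"
    and "claw_free V E"
    and "\<And>W f. paw_labelling V E W f \<Longrightarrow>
           \<exists>b\<in>{B1, B2}. \<exists>w\<in>V - W. {w, f A1} \<in> E \<and> {w, f b} \<in> E"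
  shows "hamiltonian V E"
proof -
  have simple: "{u, v} \<in> E \<Longrightarrow> u \<in> V \<and> v \<in> V \<and> u \<noteq> v" for u v
    using assms(1) by (auto simp: simple_graph_def)
  have cp: "claw_paw (\<lambda>x y. {x, y} \<in> E)"
  proof
    show "{x, y} \<in> E \<Longrightarrow> {y, x} \<in> E" for x y by (simp add: insert_commute)
    show "{x, x} \<notin> E" for x using simple[of x x] by auto
  qed (rule claw_free_adj[OF assms(1,4)] paw_common_nbr[OF assms(1,5)]; assumption)+
  obtain z ys where z: "z \<in> V" "claw_paw.cyc (\<lambda>x y. {x, y} \<in> E) z ys" "set ys \<subseteq> V"
    using two_connected_cycle[OF assms(1,3) cp] by blast
  have "graph_connected (V - {}) (induced_edges E (V - {}))"
    using assms(3) unfolding k_connected_def by (metis card.empty empty_subsetI finite.emptyI zero_less_numeral)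
  moreover have "induced_edges E V = E" using assms(1) by (auto simp: induced_edges_def simple_graph_def)
  ultimately have conn: "\<And>x. x \<in> V \<Longrightarrow> linked E z x" using z(1) by (auto simp: graph_connected_def)
  interpret rooted_claw_paw "\<lambda>x y. {x, y} \<in> E" V z
  proof (intro rooted_claw_paw.intro cp rooted_claw_paw_axioms.intro)
    show "finite {y. {x, y} \<in> E}" for x
    proof (cases "x \<in> V")
      case True
      thus ?thesis using assms(2) by (simp add: locally_finite_graph_def)
    next
      case False
      hence "{y. {x, y} \<in> E} = {}" using simple[of x] by blast
      thus ?thesis by (metis finite.emptyI)
    qed
    show "(z, x) \<in> {(x, y). {x, y} \<in> E}\<^sup>*" if "x \<in> V" for x using conn[OF that] by (simp add: linked_def)
  qed (use simple z in auto)
  have three: "\<exists>x y. x \<in> V \<and> y \<in> V \<and> x \<noteq> y \<and> x \<noteq> z \<and> y \<noteq> z"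
  proof (intro exI conjI)
    have "z \<notin> set ys" using z(2) by (simp add: cyc_def)
    thus "hd ys \<noteq> z" "last ys \<noteq> z" using cyc_nbrs(4,5)[OF z(2)] by auto
    show "hd ys \<in> V" "last ys \<in> V" "hd ys \<noteq> last ys" using cyc_nbrs(3-5)[OF z(2)] z(3) by auto
  qed
  show ?thesis
  proof (rule exhausting_cycles[OF z(2,3)])
    fix c and n :: "nat \<Rightarrow> nat"
    assume cn: "strict_mono n" "\<And>k. 2 \<le> n k" "\<And>k. cyc z (c k)" "\<And>k. set (c k) \<subseteq> V"
      "\<And>j k. j \<le> k \<Longrightarrow> tame (n j) (c k)"
    show ?thesis
    proof (rule limit_positions[OF cn])
      fix p wt :: "'a \<Rightarrow> real" and A :: real
      assume lim: "\<And>x. 0 < wt x" "p z = 0" "\<And>x. x \<in> V \<Longrightarrow> 0 \<le> p x" "\<And>x. x \<in> V \<Longrightarrow> p x + wt x \<le> A"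
        "\<And>x y. x \<in> V \<Longrightarrow> y \<in> V \<Longrightarrow> x \<noteq> y \<Longrightarrow> p x + wt x \<le> p y \<or> p y + wt y \<le> p x"
        "\<And>x. x \<in> V \<Longrightarrow> \<exists>y. {x, y} \<in> E \<and> (p y = p x + wt x \<or> y = z \<and> A = p x + wt x)"
        "\<And>y. y \<in> V \<Longrightarrow> \<exists>x. {x, y} \<in> E \<and> (p y = p x + wt x \<or> y = z \<and> A = p x + wt x)"
        "\<And>j K x w y. K \<in> regions (n j) \<Longrightarrow> x \<in> K \<Longrightarrow> y \<in> K \<Longrightarrow> w \<in> V \<Longrightarrow> p x < p w \<Longrightarrow> p w < p y \<Longrightarrow> w \<in> K"
        "\<And>j K. K \<in> regions (n j) \<Longrightarrow> \<exists>e\<in>K. \<forall>x\<in>K. p x \<le> p e"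
        "\<And>j K. K \<in> regions (n j) \<Longrightarrow> \<exists>e\<in>K. \<forall>x\<in>K. p e \<le> p x"
        "\<And>\<epsilon>. 0 < \<epsilon> \<Longrightarrow> \<exists>J. \<forall>j\<ge>J. \<forall>K\<in>regions (n j). \<forall>x\<in>K. \<forall>y\<in>K. p y - p x < \<epsilon>"
      interpret hamilton_limit V E z n p wt A
        by unfold_locales (fact assms(1) three cn(1,2) lim)+
      show "hamiltonian V E" by (rule hamiltonian_limit)
    qed
  qed
qed

end
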